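(* Let $G$ be a finite group and let ${\rm RSR}(G,r,\overrightarrow\rho,u)$ be of central quantum linear type. For $C=\{g_C\}\in{\mathcal K}_r(G)$ and $i\in I_C(r,u)$ let $q_{C,C}^{(i)}\in k$ be the scalar with $\rho_C^{(i)}(g_C)=q_{C,C}^{(i)}\,{\rm id}$, and let $N_C^{(i)}={\rm ord}(q_{C,C}^{(i)})$. Then $\mathfrak{B}(G,r,\overrightarrow\rho,u)$ is a generalized quantum linear space with the arrow PBW basis $$\{b_{\nu_1}^{m_1}b_{\nu_2}^{m_2}\cdots b_{\nu_n}^{m_n}\mid \nu_1\prec\nu_2\prec\cdots\prec\nu_n;\ 0\le m_s<N_{\nu_s};\ 1\le s\le n;\ n\in\mathbb{N}\},$$ where $\{b_\nu\mid\nu\in\Omega\}:=Q_1^1$, $\prec$ is a total order on $\Omega$, and $N_{\nu_s}={\rm ord}(q_{C,C}^{(i)})$ if $b_{\nu_s}=a_{g_C,1}^{(i,j)}$; and $$\dim\mathfrak{B}(G,r,\overrightarrow\rho,u)=\prod_{C\in{\mathcal K}_r(G),\ i\in I_C(r,u)}(N_C^{(i)})^{\deg(\rho_C^{(i)})\,|C|}.$$ In particular, if ${\rm RSR}(G,r,\overrightarrow\rho,u)$ is quantum weakly symmetric and of $-1$-type with $C\subseteq Z(G)$ for any $C\in{\mathcal K}_r(G)$, then it is of central quantum linear type with $N_C^{(i)}=2$ and $$\dim\mathfrak{B}(G,r,\overrightarrow\rho,u)=2^{\sum_{C\in{\mathcal K}_r(G),\ i\in I_C(r,u)}\deg(\r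ho_C^{(i)})\,|C|}.$$
   Context: $k=\mathbb{C}$; $Z(G)$ is the center of $G$; $G^s$ is the centralizer of $s$; ${\mathcal K}(G)$ is the set of conjugacy classes. A ramification is a formal sum $r=\sum_{C\in{\mathcal K}(G)}r_CC$ with cardinal coefficients; ${\mathcal K}_r(G)=\{C:r_C\ne0\}$. An ${\rm RSR}(G,r,\overrightarrow\rho,u)$ consists of a ramification $r$, a map $u:{\mathcal K}(G)\to G$ with $u(C)\in C$, and for each $C\in{\mathcal K}_r(G)$ a finite nonempty index set $I_C(r,u)$ and irreducible representations $\rho_C^{(i)}$ ($i\in I_C(r,u)$) of $G^{u(C)}$ with characters $\chi_C^{(i)}$, written as right actions on spaces $X_C^{(i)}$ with bases $\{x_C^{(i,j)}\mid j\in J_C(i)\}$, $|J_C(i)|=\deg\rho_C^{(i)}$, $r_C=\sum_i\deg\rho_C^{(i)}$. Fix $G=\bigcup_{\theta\in\Theta_C}G^{u(C)}g_\theta$. The arrow YD module $kQ_1^1$ over $kG$ has basis $Q_1^1=\{a_{x,1}^{(i,j)}\mid x\in C\in{\mathcal K}_r(G),i\in I_C(r,u),j\in J_C(i)\}$, coaction $\delta^-(a_{x,1}^{(i,j)})=x\otimes a_{x,1}^{(i,j)}$ and action $h\rhd a_{x,1}^{(i,j)}=\sum_pk_pa_{hxh^{-1},1}^{(i,p)}$, where $x=g_\theta^{-1}u(C)g_\theta$, $g_\theta h^{-1}=\zeta_\theta(h^{-1})g_{\theta'}$, $\zeta_\theta(h^{-1})\in G^{u(C)}$, $x_C^{(i,j)}\cdot\zeta_\theta(h^{-1})=\sum_pk_px_C^{(i,p)}$.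 $\mathfrak{B}(G,r,\overrightarrow\rho,u)$ is its Nichols algebra. For $C\in{\mathcal K}_r(G)$, $i\in I_C(r,u)$, let $M_C^{(i)}$ be the YD submodule spanned by the $a_{x,1}^{(i,j)}$, $x\in C$, $j\in J_C(i)$, and $\mathfrak{B}({\mathcal O}_{u(C)},\rho_C^{(i)})$ its Nichols algebra. Let $\sigma$ be the braiding of ${}^{kG}_{kG}{\mathcal{YD}}$ and $\sigma_{C^{(i)},D^{(j)}}=\sigma_{M_C^{(i)},M_D^{(j)}}$. The RSR is quantum symmetric if $\sigma_{C^{(i)},D^{(j)}}=(\sigma_{D^{(j)},C^{(i)}})^{-1}$ for all $C,D\in{\mathcal K}_r(G)$, $i\in I_C(r,u)$, $j\in I_D(r,u)$; quantum weakly symmetric if this holds whenever $(C,i)\ne(D,j)$. It is of non-essentially infinite type if $\dim\mathfrak{B}({\mathcal O}_{u(C)},\rho_C^{(i)})<\infty$ for all $C\in{\mathcal K}_r(G)$, $i\in I_C(r,u)$. It is of central quantum linear type if it is quantum symmetric, of non-essentially infinite type, and $C\subseteq Z(G)$ for all $C\in{\mathcal K}_r(G)$. It is of $-1$-type if for all $C\in{\mathcal K}_r(G)$, $i\in I_C(r,u)$: $u(C)$ is conjugate to its inverse, has even order, and $\chi_C^{(i)}(u(C))=-\chi_C^{(i)}(1)$. Generalized quantum linear space: given a finite set $\Omega$, $0\ne k_{i,j}\in k$ ($i,j\in\Omega$) with $1<N_i:={\rm ord}(k_{i,i})<\infty$, it is the algebra generated by $\{x_j\mid j\in\Omega\}$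 with relations $x_l^{N_l}=0$ and $x_ix_j=k_{i,j}x_jx_i$ for $i\ne j$; here the generators are the arrows in $Q_1^1$. An arrow PBW basis is a basis of the displayed monomial form whose generators $b_\nu$ are arrows. *)

theory Defs
  imports
    Complex_Main
    "HOL-Library.Poly_Mapping"
    "HOL-Algebra.Multiplicative_Group"
    "HOL-Algebra.QuotRing"
    "HOL-Algebra.Embedded_Algebras"
begin

section \<open>Vector spaces with a chosen basis\<close>

text \<open>The space with basis a set \<open>B\<close> consists of the finitely supported functions
  \<open>p :: 'b \<Rightarrow>\<^sub>0 complex\<close> with \<open>Poly_Mapping.keys p \<subseteq> B\<close>.\<close>

definition cscale :: "complex \<Rightarrow> ('a \<Rightarrow>\<^sub>0 complex) \<Rightarrow> ('a \<Rightarrow>\<^sub>0 complex)" where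
  "cscale c p = Poly_Mapping.map ((*) c) p"

lemma lookup_cscale: "Poly_Mapping.lookup (cscale c p) a = c * Poly_Mapping.lookup p a"
  unfolding cscale_def by transfer (simp add: when_def)

interpretation pm: vector_space "cscale :: complex \<Rightarrow> ('a \<Rightarrow>\<^sub>0 complex) \<Rightarrow> _"
  by unfold_locales
    (auto intro!: poly_mapping_eqI simp: lookup_cscale lookup_add algebra_simps)

definition linear_extension ::
  "('a \<Rightarrow> 'c \<Rightarrow>\<^sub>0 complex) \<Rightarrow> ('a \<Rightarrow>\<^sub>0 complex) \<Rightarrow> ('c \<Rightarrow>\<^sub>0 complex)" where
  "linear_extension f p = (\<Sum>a\<in>Poly_Mapping.keys p. cscale (Poly_Mapping.lookup p a) (f a))"

text \<open>The tensor product of the spaces with bases \<open>A\<close> and \<open>B\<close> is the space with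
  basis \<open>A \<times> B\<close>.\<close>

definition tensor :: "('a \<Rightarrow>\<^sub>0 complex) \<Rightarrow> ('b \<Rightarrow>\<^sub>0 complex) \<Rightarrow> ('a \<times> 'b \<Rightarrow>\<^sub>0 complex)" where
  "tensor p q = linear_extension (\<lambda>a. linear_extension (\<lambda>b. Poly_Mapping.single (a, b) 1) q) p"


section \<open>Free algebras and generalized quantum linear spaces\<close>

text \<open>Lists form a monoid under concatenation, so that the convolution product of
  \<^theory>\<open>HOL-Library.Poly_Mapping\<close> makes \<open>'b list \<Rightarrow>\<^sub>0 complex\<close> the free associative
  algebra on \<open>'b\<close>.\<close>

instantiation list :: (type) monoid_add
begin
definition zero_list :: "'a list" where "zero_list = []"
definition plus_list :: "'a list \<Rightarrow> 'a list \<Rightarrow> 'a list" where "plus_list = (@)"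
instance by standard (auto simp: zero_list_def plus_list_def)
end

definition free_algebra :: "'b set \<Rightarrow> ('b list \<Rightarrow>\<^sub>0 complex) ring" where
  "free_algebra B =
    \<lparr>carrier = {p. Poly_Mapping.keys p \<subseteq> lists B}, monoid.mult = (*), one = 1, zero = 0, add = (+)\<rparr>"

abbreviation gen :: "'b \<Rightarrow> 'b list \<Rightarrow>\<^sub>0 complex" where
  "gen b \<equiv> Poly_Mapping.single [b] 1"

text \<open>The order in the group of nonzero complex numbers; it is \<open>0\<close> for numbers of infinite
  order.\<close>

definition scalar_ord :: "complex \<Rightarrow> nat" where
  "scalar_ord c = group.ord \<lparr>carrier = - {0}, monoid.mult = (*), one = 1\<rparr> c"

definition quantum_linear_relations ::
  "'b set \<Rightarrow> ('b \<Rightarrow> nat) \<Rightarrow> ('b \<Rightarrow> 'b \<Rightarrow> complex) \<Rightarrow> ('b list \<Rightarrow>\<^sub>0 complex) set" where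
  "quantum_linear_relations \<Omega> N k =
    {gen l ^ N l | l. l \<in> \<Omega>} \<union>
    {gen i * gen j - cscale (k i j) (gen j * gen i) | i j. i \<in> \<Omega> \<and> j \<in> \<Omega> \<and> i \<noteq> j}"

text \<open>The algebra \<open>A\<close> is given as a quotient of the free algebra on \<open>\<Omega>\<close>, with the classes of
  the elements of \<open>\<Omega>\<close> as generators.\<close>

definition generalized_quantum_linear_space ::
  "('b list \<Rightarrow>\<^sub>0 complex) set ring \<Rightarrow> 'b set \<Rightarrow> ('b \<Rightarrow> nat) \<Rightarrow> bool" where
  "generalized_quantum_linear_space A \<Omega> N \<longleftrightarrow>
    finite \<Omega> \<and>
    (\<exists>k. (\<forall>i\<in>\<Omega>. \<forall>j\<in>\<Omega>. k i j \<noteq> 0) \<and>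
         (\<forall>i\<in>\<Omega>. N i = scalar_ord (k i i) \<and> 1 < N i) \<and>
         A = free_algebra \<Omega> Quot (Idl\<^bsub>free_algebra \<Omega>\<^esub> (quantum_linear_relations \<Omega> N k)))"

definition is_basis :: "('a, 'm) ring_scheme \<Rightarrow> 'a set \<Rightarrow> 'a set \<Rightarrow> bool" where
  "is_basis A K S \<longleftrightarrow>
    (\<exists>Us. set Us = S \<and> ring.independent A K Us \<and> ring.Span A K Us = carrier A)"

definition pbw_monomials ::
  "('a, 'm) ring_scheme \<Rightarrow> 'v set \<Rightarrow> ('v \<times> 'v) set \<Rightarrow> ('v \<Rightarrow> nat) \<Rightarrow> ('v \<Rightarrow> 'a) \<Rightarrow> 'a set" where
  "pbw_monomials A \<Omega> lt N b =
    {foldr (\<lambda>(\<nu>, m) y. (b \<nu> [^]\<^bsub>A\<^esub> m) \<otimes>\<^bsub>A\<^esub> y) (zip \<nu>s ms) \<one>\<^bsub>A\<^esub> | \<nu>s (ms :: nat list).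
      set \<nu>s \<subseteq> \<Omega> \<and> sorted_wrt (\<lambda>\<mu> \<nu>. (\<mu>, \<nu>) \<in> lt) \<nu>s \<and> length ms = length \<nu>s \<and>
      (\<forall>s<length \<nu>s. ms ! s < N (\<nu>s ! s))}"


section \<open>Yetter--Drinfeld modules over a group algebra and Nichols algebras\<close>

text \<open>A coaction of the group algebra is a grading by the group. A Yetter--Drinfeld module is
  given by a basis of homogeneous elements, i.e. with coaction
  \<open>b \<mapsto> yd_degree V b \<otimes> b\<close>, and by the action of group elements on this basis. The record
  holds these data without the axioms.\<close>

record ('g, 'b) yd_data =
  yd_basis :: "'b set"
  yd_degree :: "'b \<Rightarrow> 'g"
  yd_action :: "'g \<Rightarrow> 'b \<Rightarrow> 'b \<Rightarrow>\<^sub>0 complex"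

text \<open>\<open>v \<otimes> w \<mapsto> (v\<^sub>-\<^sub>1 \<rhd> w) \<otimes> v\<^sub>0\<close>; its restriction to \<open>M \<otimes> N\<close>, for
  submodules \<open>M\<close> and \<open>N\<close> of \<open>V\<close>, is the braiding of \<open>M\<close> and \<open>N\<close>.\<close>

definition braiding ::
  "('g, 'b) yd_data \<Rightarrow> ('b \<times> 'b \<Rightarrow>\<^sub>0 complex) \<Rightarrow> ('b \<times> 'b \<Rightarrow>\<^sub>0 complex)" where
  "braiding V = linear_extension
    (\<lambda>(a, b). tensor (yd_action V (yd_degree V a) b) (Poly_Mapping.single a 1))"

abbreviation tensor_algebra :: "('g, 'b) yd_data \<Rightarrow> ('b list \<Rightarrow>\<^sub>0 complex) ring" where
  "tensor_algebra V \<equiv> free_algebra (yd_basis V)"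

definition word_degree :: "('g, 'm) monoid_scheme \<Rightarrow> ('g, 'b) yd_data \<Rightarrow> 'b list \<Rightarrow> 'g" where
  "word_degree G V w = foldr (\<lambda>b g. yd_degree V b \<otimes>\<^bsub>G\<^esub> g) w \<one>\<^bsub>G\<^esub>"

definition word_action :: "('g, 'b) yd_data \<Rightarrow> 'g \<Rightarrow> 'b list \<Rightarrow> 'b list \<Rightarrow>\<^sub>0 complex" where
  "word_action V h w = prod_list (map (\<lambda>b. linear_extension gen (yd_action V h b)) w)"

text \<open>The product of the braided tensor square of the tensor algebra:
  \<open>(u \<otimes> v) (u' \<otimes> v') = u (v\<^sub>-\<^sub>1 \<rhd> u') \<otimes> v\<^sub>0 v'\<close>.\<close>

definition braided_mult ::
  "('g, 'm) monoid_scheme \<Rightarrow> ('g, 'b) yd_data \<Rightarrow>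
   ('b list \<times> 'b list \<Rightarrow>\<^sub>0 complex) \<Rightarrow> ('b list \<times> 'b list \<Rightarrow>\<^sub>0 complex) \<Rightarrow>
   ('b list \<times> 'b list \<Rightarrow>\<^sub>0 complex)" where
  "braided_mult G V s t = linear_extension
    (\<lambda>((u, v), (u', v')).
       tensor (Poly_Mapping.single u 1 * word_action V (word_degree G V v) u')
              (Poly_Mapping.single (v @ v') 1))
    (tensor s t)"

text \<open>The comultiplication of the tensor algebra: the algebra map to the braided tensor square
  with \<open>b \<mapsto> b \<otimes> 1 + 1 \<otimes> b\<close>.\<close>

fun word_coproduct ::
  "('g, 'm) monoid_scheme \<Rightarrow> ('g, 'b) yd_data \<Rightarrow> 'b list \<Rightarrow> ('b list \<times> 'b list \<Rightarrow>\<^sub>0 complex)" where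
  "word_coproduct G V [] = tensor 1 1"
| "word_coproduct G V (b # w) =
    braided_mult G V (tensor (gen b) 1 + tensor 1 (gen b)) (word_coproduct G V w)"

definition coproduct ::
  "('g, 'm) monoid_scheme \<Rightarrow> ('g, 'b) yd_data \<Rightarrow>
   ('b list \<Rightarrow>\<^sub>0 complex) \<Rightarrow> ('b list \<times> 'b list \<Rightarrow>\<^sub>0 complex)" where
  "coproduct G V = linear_extension (word_coproduct G V)"

definition homogeneous :: "nat \<Rightarrow> ('b list \<Rightarrow>\<^sub>0 complex) \<Rightarrow> bool" where
  "homogeneous n p \<longleftrightarrow> (\<forall>w\<in>Poly_Mapping.keys p. length w = n)"

definition is_coideal ::
  "('g, 'm) monoid_scheme \<Rightarrow> ('g, 'b) yd_data \<Rightarrow> ('b list \<Rightarrow>\<^sub>0 complex) set \<Rightarrow> bool" where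
  "is_coideal G V I \<longleftrightarrow>
    coproduct G V ` I \<subseteq>
      pm.span ({tensor p q | p q. p \<in> I \<and> q \<in> carrier (tensor_algebra V)} \<union>
               {tensor p q | p q. p \<in> carrier (tensor_algebra V) \<and> q \<in> I})"

text \<open>The Nichols algebra is the quotient of the tensor algebra by its largest coideal among
  the ideals generated by homogeneous elements of degree at least two; this largest one is the
  sum of all of them. (Being the largest, it is automatically stable under the action and the
  coaction.)\<close>

definition nichols_ideal ::
  "('g, 'm) monoid_scheme \<Rightarrow> ('g, 'b) yd_data \<Rightarrow> ('b list \<Rightarrow>\<^sub>0 complex) set" where
  "nichols_ideal G V = pm.span (\<Union>{I. is_coideal G V I \<and>
    (\<exists>S \<subseteq> carrier (tensor_algebra V).
       (\<forall>s\<in>S. \<exists>n\<ge>2. homogeneous n s) \<and> I = Idl\<^bsub>tensor_algebra V\<^esub> S)})"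

definition nichols_algebra ::
  "('g, 'm) monoid_scheme \<Rightarrow> ('g, 'b) yd_data \<Rightarrow> ('b list \<Rightarrow>\<^sub>0 complex) set ring" where
  "nichols_algebra G V = tensor_algebra V Quot nichols_ideal G V"

definition nichols_class ::
  "('g, 'm) monoid_scheme \<Rightarrow> ('g, 'b) yd_data \<Rightarrow> ('b list \<Rightarrow>\<^sub>0 complex) \<Rightarrow>
   ('b list \<Rightarrow>\<^sub>0 complex) set" where
  "nichols_class G V p = nichols_ideal G V +>\<^bsub>tensor_algebra V\<^esub> p"

definition nichols_scalars ::
  "('g, 'm) monoid_scheme \<Rightarrow> ('g, 'b) yd_data \<Rightarrow> ('b list \<Rightarrow>\<^sub>0 complex) set set" where
  "nichols_scalars G V = {nichols_class G V (cscale c 1) | c. True}"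

definition nichols_dim :: "('g, 'm) monoid_scheme \<Rightarrow> ('g, 'b) yd_data \<Rightarrow> nat \<Rightarrow> bool" where
  "nichols_dim G V n \<longleftrightarrow>
    ring.dimension (nichols_algebra G V) n (nichols_scalars G V) (carrier (nichols_algebra G V))"


section \<open>Ramification systems with irreducible representations\<close>

definition conj_class :: "('g, 'm) monoid_scheme \<Rightarrow> 'g \<Rightarrow> 'g set" where
  "conj_class G x = {g \<otimes>\<^bsub>G\<^esub> x \<otimes>\<^bsub>G\<^esub> inv\<^bsub>G\<^esub> g | g. g \<in> carrier G}"

definition conj_classes :: "('g, 'm) monoid_scheme \<Rightarrow> 'g set set" where
  "conj_classes G = conj_class G ` carrier G"

definition centralizer :: "('g, 'm) monoid_scheme \<Rightarrow> 'g \<Rightarrow> 'g set" where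
  "centralizer G s = {g \<in> carrier G. g \<otimes>\<^bsub>G\<^esub> s = s \<otimes>\<^bsub>G\<^esub> g}"

definition group_center :: "('g, 'm) monoid_scheme \<Rightarrow> 'g set" where
  "group_center G = {z \<in> carrier G. \<forall>g\<in>carrier G. z \<otimes>\<^bsub>G\<^esub> g = g \<otimes>\<^bsub>G\<^esub> z}"

definition right_rep ::
  "('g, 'm) monoid_scheme \<Rightarrow> 'g set \<Rightarrow> (complex \<Rightarrow> 'x :: ab_group_add \<Rightarrow> 'x) \<Rightarrow> 'x set \<Rightarrow>
   ('x \<Rightarrow> 'g \<Rightarrow> 'x) \<Rightarrow> bool" where
  "right_rep G H scale X act \<longleftrightarrow>
    module.subspace scale X \<and>
    (\<forall>v\<in>X. \<forall>h\<in>H. act v h \<in> X) \<and>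
    (\<forall>v\<in>X. \<forall>w\<in>X. \<forall>h\<in>H. act (v + w) h = act v h + act w h) \<and>
    (\<forall>c. \<forall>v\<in>X. \<forall>h\<in>H. act (scale c v) h = scale c (act v h)) \<and>
    (\<forall>v\<in>X. act v \<one>\<^bsub>G\<^esub> = v) \<and>
    (\<forall>v\<in>X. \<forall>h\<in>H. \<forall>h'\<in>H. act v (h \<otimes>\<^bsub>G\<^esub> h') = act (act v h) h')"

definition irreducible_right_rep ::
  "('g, 'm) monoid_scheme \<Rightarrow> 'g set \<Rightarrow> (complex \<Rightarrow> 'x :: ab_group_add \<Rightarrow> 'x) \<Rightarrow> 'x set \<Rightarrow>
   ('x \<Rightarrow> 'g \<Rightarrow> 'x) \<Rightarrow> bool" where
  "irreducible_right_rep G H scale X act \<longleftrightarrow>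
    right_rep G H scale X act \<and> X \<noteq> {0} \<and>
    (\<forall>W\<subseteq>X. right_rep G H scale W act \<longrightarrow> W = {0} \<or> W = X)"

text \<open>The fields stand for \<open>r\<close>, \<open>u\<close>, \<open>I\<^sub>C(r,u)\<close>, \<open>J\<^sub>C(i)\<close>, the scalar multiplication of an
  ambient space containing all \<open>X\<^sub>C\<^sup>(\<^sup>i\<^sup>)\<close>, the spaces \<open>X\<^sub>C\<^sup>(\<^sup>i\<^sup>)\<close>, the right actions
  \<open>\<rho>\<^sub>C\<^sup>(\<^sup>i\<^sup>)\<close>, the basis vectors \<open>x\<^sub>C\<^sup>(\<^sup>i\<^sup>,\<^sup>j\<^sup>)\<close>, and the set of coset representatives
  \<open>{g\<^sub>\<theta> | \<theta> \<in> \<Theta>\<^sub>C}\<close>. The coefficients \<open>r\<^sub>C\<close> are natural numbers, because they are finite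
  sums of degrees of irreducible representations of finite groups.\<close>

record ('g, 'i, 'j, 'x) rsr =
  rsr_r :: "'g set \<Rightarrow> nat"
  rsr_u :: "'g set \<Rightarrow> 'g"
  rsr_I :: "'g set \<Rightarrow> 'i set"
  rsr_J :: "'g set \<Rightarrow> 'i \<Rightarrow> 'j set"
  rsr_scale :: "complex \<Rightarrow> 'x \<Rightarrow> 'x"
  rsr_X :: "'g set \<Rightarrow> 'i \<Rightarrow> 'x set"
  rsr_act :: "'g set \<Rightarrow> 'i \<Rightarrow> 'x \<Rightarrow> 'g \<Rightarrow> 'x"
  rsr_x :: "'g set \<Rightarrow> 'i \<Rightarrow> 'j \<Rightarrow> 'x"
  rsr_T :: "'g set \<Rightarrow> 'g set"

definition rsr_classes ::
  "('g, 'm) monoid_scheme \<Rightarrow> ('g, 'i, 'j, 'x) rsr \<Rightarrow> 'g set set" where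
  "rsr_classes G R = {C \<in> conj_classes G. rsr_r R C \<noteq> 0}"

definition rsr_deg ::
  "('g, 'i, 'j, 'x :: ab_group_add) rsr \<Rightarrow> 'g set \<Rightarrow> 'i \<Rightarrow> nat" where
  "rsr_deg R C i = vector_space.dim (rsr_scale R) (rsr_X R C i)"

definition is_rsr ::
  "('g, 'm) monoid_scheme \<Rightarrow> ('g, 'i, 'j, 'x :: ab_group_add) rsr \<Rightarrow> bool" where
  "is_rsr G R \<longleftrightarrow>
    vector_space (rsr_scale R) \<and>
    (\<forall>C\<in>conj_classes G. rsr_u R C \<in> C) \<and>
    (\<forall>C\<in>rsr_classes G R.
       finite (rsr_I R C) \<and> rsr_I R C \<noteq> {} \<and>
       rsr_r R C = (\<Sum>i\<in>rsr_I R C. rsr_deg R C i) \<and>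
       (\<forall>i\<in>rsr_I R C.
          irreducible_right_rep G (centralizer G (rsr_u R C)) (rsr_scale R)
            (rsr_X R C i) (rsr_act R C i) \<and>
          finite (rsr_J R C i) \<and> card (rsr_J R C i) = rsr_deg R C i \<and>
          inj_on (rsr_x R C i) (rsr_J R C i) \<and>
          \<not> module.dependent (rsr_scale R) (rsr_x R C i ` rsr_J R C i) \<and>
          module.span (rsr_scale R) (rsr_x R C i ` rsr_J R C i) = rsr_X R C i) \<and>
       rsr_T R C \<subseteq> carrier G \<and>
       (\<forall>g\<in>carrier G. \<exists>!t. t \<in> rsr_T R C \<and> g \<in> centralizer G (rsr_u R C) #>\<^bsub>G\<^esub> t))"

text \<open>The coefficient of \<open>x\<^sub>C\<^sup>(\<^sup>i\<^sup>,\<^sup>p\<^sup>)\<close> in \<open>x\<^sub>C\<^sup>(\<^sup>i\<^sup>,\<^sup>j\<^sup>) \<cdot> h\<close>.\<close>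

definition rsr_coeff ::
  "('g, 'i, 'j, 'x :: ab_group_add) rsr \<Rightarrow> 'g set \<Rightarrow> 'i \<Rightarrow> 'j \<Rightarrow> 'g \<Rightarrow> 'j \<Rightarrow> complex" where
  "rsr_coeff R C i j h p =
    module.representation (rsr_scale R) (rsr_x R C i ` rsr_J R C i)
      (rsr_act R C i (rsr_x R C i j) h) (rsr_x R C i p)"

definition rsr_character ::
  "('g, 'i, 'j, 'x :: ab_group_add) rsr \<Rightarrow> 'g set \<Rightarrow> 'i \<Rightarrow> 'g \<Rightarrow> complex" where
  "rsr_character R C i h = (\<Sum>j\<in>rsr_J R C i. rsr_coeff R C i j h j)"

text \<open>The triple \<open>(x, i, j)\<close> is the arrow \<open>a\<^sub>x\<^sub>,\<^sub>1\<^sup>(\<^sup>i\<^sup>,\<^sup>j\<^sup>)\<close>.\<close>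

definition component_arrows ::
  "('g, 'i, 'j, 'x) rsr \<Rightarrow> 'g set \<Rightarrow> 'i \<Rightarrow> ('g \<times> 'i \<times> 'j) set" where
  "component_arrows R C i = {(x, i, j) | x j. x \<in> C \<and> j \<in> rsr_J R C i}"

definition arrows ::
  "('g, 'm) monoid_scheme \<Rightarrow> ('g, 'i, 'j, 'x) rsr \<Rightarrow> ('g \<times> 'i \<times> 'j) set" where
  "arrows G R = (\<Union>C\<in>rsr_classes G R. \<Union>i\<in>rsr_I R C. component_arrows R C i)"

text \<open>Here \<open>t = g\<^sub>\<theta>\<close>, \<open>t' = g\<^sub>\<theta>\<^sub>'\<close> and \<open>\<zeta> = \<zeta>\<^sub>\<theta>(h\<^sup>-\<^sup>1)\<close>.\<close>

definition arrow_action ::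
  "('g, 'm) monoid_scheme \<Rightarrow> ('g, 'i, 'j, 'x :: ab_group_add) rsr \<Rightarrow>
   'g \<Rightarrow> 'g \<times> 'i \<times> 'j \<Rightarrow> 'g \<times> 'i \<times> 'j \<Rightarrow>\<^sub>0 complex" where
  "arrow_action G R h = (\<lambda>(x, i, j).
    let C = conj_class G x;
        t = (THE t. t \<in> rsr_T R C \<and> x = inv\<^bsub>G\<^esub> t \<otimes>\<^bsub>G\<^esub> rsr_u R C \<otimes>\<^bsub>G\<^esub> t);
        t' = (THE t'. t' \<in> rsr_T R C \<and>
                t \<otimes>\<^bsub>G\<^esub> inv\<^bsub>G\<^esub> h \<in> centralizer G (rsr_u R C) #>\<^bsub>G\<^esub> t');
        \<zeta> = t \<otimes>\<^bsub>G\<^esub> inv\<^bsub>G\<^esub> h \<otimes>\<^bsub>G\<^esub> inv\<^bsub>G\<^esub> t'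
    in \<Sum>p\<in>rsr_J R C i.
         Poly_Mapping.single (h \<otimes>\<^bsub>G\<^esub> x \<otimes>\<^bsub>G\<^esub> inv\<^bsub>G\<^esub> h, i, p) (rsr_coeff R C i j \<zeta> p))"

definition arrow_module ::
  "('g, 'm) monoid_scheme \<Rightarrow> ('g, 'i, 'j, 'x :: ab_group_add) rsr \<Rightarrow>
   ('g, 'g \<times> 'i \<times> 'j) yd_data" where
  "arrow_module G R =
    \<lparr>yd_basis = arrows G R, yd_degree = fst, yd_action = arrow_action G R\<rparr>"

definition component_module ::
  "('g, 'm) monoid_scheme \<Rightarrow> ('g, 'i, 'j, 'x :: ab_group_add) rsr \<Rightarrow> 'g set \<Rightarrow> 'i \<Rightarrow>
   ('g, 'g \<times> 'i \<times> 'j) yd_data" where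
  "component_module G R C i = (arrow_module G R)\<lparr>yd_basis := component_arrows R C i\<rparr>"

definition component_tensor ::
  "('g, 'i, 'j, 'x) rsr \<Rightarrow> 'g set \<Rightarrow> 'i \<Rightarrow> 'g set \<Rightarrow> 'i \<Rightarrow>
   (('g \<times> 'i \<times> 'j) \<times> ('g \<times> 'i \<times> 'j) \<Rightarrow>\<^sub>0 complex) set" where
  "component_tensor R C i D j =
    {t. Poly_Mapping.keys t \<subseteq> component_arrows R C i \<times> component_arrows R D j}"

definition braidings_inverse ::
  "('g, 'm) monoid_scheme \<Rightarrow> ('g, 'i, 'j, 'x :: ab_group_add) rsr \<Rightarrow>
   'g set \<Rightarrow> 'i \<Rightarrow> 'g set \<Rightarrow> 'i \<Rightarrow> bool" where
  "braidings_inverse G R C i D j \<longleftrightarrow>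
    (\<forall>t\<in>component_tensor R C i D j.
       braiding (arrow_module G R) t =
       inv_into (component_tensor R D j C i) (braiding (arrow_module G R)) t)"

definition quantum_symmetric ::
  "('g, 'm) monoid_scheme \<Rightarrow> ('g, 'i, 'j, 'x :: ab_group_add) rsr \<Rightarrow> bool" where
  "quantum_symmetric G R \<longleftrightarrow>
    (\<forall>C\<in>rsr_classes G R. \<forall>D\<in>rsr_classes G R. \<forall>i\<in>rsr_I R C. \<forall>j\<in>rsr_I R D.
       braidings_inverse G R C i D j)"

definition quantum_weakly_symmetric ::
  "('g, 'm) monoid_scheme \<Rightarrow> ('g, 'i, 'j, 'x :: ab_group_add) rsr \<Rightarrow> bool" where
  "quantum_weakly_symmetric G R \<longleftrightarrow>
    (\<forall>C\<in>rsr_classes G R. \<forall>D\<in>rsr_classes G R. \<forall>i\<in>rsr_I R C. \<forall>j\<in>rsr_I R D.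
       (C, i) \<noteq> (D, j) \<longrightarrow> braidings_inverse G R C i D j)"

definition non_essentially_infinite_type ::
  "('g, 'm) monoid_scheme \<Rightarrow> ('g, 'i, 'j, 'x :: ab_group_add) rsr \<Rightarrow> bool" where
  "non_essentially_infinite_type G R \<longleftrightarrow>
    (\<forall>C\<in>rsr_classes G R. \<forall>i\<in>rsr_I R C. \<exists>n. nichols_dim G (component_module G R C i) n)"

definition central_quantum_linear_type ::
  "('g, 'm) monoid_scheme \<Rightarrow> ('g, 'i, 'j, 'x :: ab_group_add) rsr \<Rightarrow> bool" where
  "central_quantum_linear_type G R \<longleftrightarrow>
    quantum_symmetric G R \<and> non_essentially_infinite_type G R \<and>
    (\<forall>C\<in>rsr_classes G R. C \<subseteq> group_center G)"

definition minus_one_type ::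
  "('g, 'm) monoid_scheme \<Rightarrow> ('g, 'i, 'j, 'x :: ab_group_add) rsr \<Rightarrow> bool" where
  "minus_one_type G R \<longleftrightarrow>
    (\<forall>C\<in>rsr_classes G R. \<forall>i\<in>rsr_I R C.
       inv\<^bsub>G\<^esub> (rsr_u R C) \<in> conj_class G (rsr_u R C) \<and>
       even (group.ord G (rsr_u R C)) \<and>
       rsr_character R C i (rsr_u R C) = - rsr_character R C i \<one>\<^bsub>G\<^esub>)"

definition acts_by_scalar ::
  "('g, 'i, 'j, 'x) rsr \<Rightarrow> 'g set \<Rightarrow> 'i \<Rightarrow> complex \<Rightarrow> bool" where
  "acts_by_scalar R C i q \<longleftrightarrow>
    (\<forall>v\<in>rsr_X R C i. rsr_act R C i v (rsr_u R C) = rsr_scale R q v)"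

definition rsr_scalar :: "('g, 'i, 'j, 'x) rsr \<Rightarrow> 'g set \<Rightarrow> 'i \<Rightarrow> complex" where
  "rsr_scalar R C i = (THE q. acts_by_scalar R C i q)"

definition rsr_N :: "('g, 'i, 'j, 'x) rsr \<Rightarrow> 'g set \<Rightarrow> 'i \<Rightarrow> nat" where
  "rsr_N R C i = scalar_ord (rsr_scalar R C i)"

definition arrow_N ::
  "('g, 'm) monoid_scheme \<Rightarrow> ('g, 'i, 'j, 'x) rsr \<Rightarrow> 'g \<times> 'i \<times> 'j \<Rightarrow> nat" where
  "arrow_N G R = (\<lambda>(x, i, j). rsr_N R (conj_class G x) i)"

end

theory Submission
  imports Defs
begin

text \<open>By Schur's lemma the degree of an arrow, being central, acts on each \<open>X\<^sub>C\<^sup>(\<^sup>i\<^sup>)\<close> by a scalar,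
  so the braiding of the arrow module is diagonal: \<open>\<sigma>(a \<otimes> b) = q\<^sub>a\<^sub>b b \<otimes> a\<close>. Quantum symmetry means
  \<open>q\<^sub>a\<^sub>b q\<^sub>b\<^sub>a = 1\<close>, in particular \<open>q\<^sub>a\<^sub>a = 1\<close> or \<open>q\<^sub>a\<^sub>a = -1\<close>. If \<open>q\<^sub>a\<^sub>a = 1\<close>, the powers of \<open>a\<close> are
  linearly independent in the Nichols algebra; hence finite dimension of the components forces
  \<open>q\<^sub>a\<^sub>a = -1\<close>, and all the orders in question are \<open>2\<close>.

  The ideal generated by the elements \<open>a b - q\<^sub>a\<^sub>b b a\<close> (which is \<open>2 a\<^sup>2\<close> for \<open>a = b\<close>) is a coideal,
  and modulo it the strictly increasing words span. The functionals that apply an iterated skew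
  derivation and then the counit vanish on every coideal ideal generated in degrees at least two,
  and up to nonzero factors they are dual to the increasing words. Hence no such ideal is larger,
  and the increasing words form a basis of the Nichols algebra.\<close>

section \<open>Finitely supported functions\<close>

text \<open>The Nichols ideal is given only as a sum over all admissible ideals, so it is squeezed
  between an explicit coideal and the common zeros of functionals that kill every admissible ideal
  \<open>I\<close>. They kill it because a skew derivation contracts the first leg of the coproduct
  with a one-letter word: \<open>I \<otimes> T\<close> contributes nothing, as \<open>I\<close> has
  no one-letter words, \<open>T \<otimes> I\<close> lands in \<open>I\<close>, and \<open>I\<close>
  has no constant term. Their duality rests on letter sets: a derivation deletes its letter from a
  word with distinct letters at the cost of a nonzero scalar, and an increasing word is determined
  by its letters. One twist lies in the conventions: \<open>h\<close> acts on arrows through a right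
  action of its inverse, so the braiding scalars are inverse to those of the representations; the
  value -1 is its own inverse, so both have it together. In the second half of the theorem the
  finite dimension of the components is a conclusion. It comes from the result on quantum exterior
  algebras, applied to each component; hence the abstract locales, which serve the whole arrow
  module and its components alike.\<close>

lemma cscale_eq_single_mult: "cscale c p = Poly_Mapping.single 0 c * (p :: 'a::monoid_add \<Rightarrow>\<^sub>0 complex)"
  unfolding cscale_def by (rule mult_map_scale_conv_mult)

lemma cscale_single: "cscale c (Poly_Mapping.single a d) = Poly_Mapping.single a (c * d)"
  by (rule poly_mapping_eqI) (simp add: lookup_cscale lookup_single when_def)

lemma keys_cscale: "Poly_Mapping.keys (cscale c p) \<subseteq> Poly_Mapping.keys p"
  by (auto simp: in_keys_iff lookup_cscale)

lemma sum_cscale_single: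
  "(\<Sum>a\<in>Poly_Mapping.keys p. cscale (Poly_Mapping.lookup p a) (Poly_Mapping.single a 1)) = p"
proof (rule poly_mapping_eqI)
  fix b
  have "(\<Sum>a\<in>Poly_Mapping.keys p. Poly_Mapping.lookup (cscale (Poly_Mapping.lookup p a) (Poly_Mapping.single a 1)) b)
      = (\<Sum>a\<in>Poly_Mapping.keys p. if a = b then Poly_Mapping.lookup p b else 0)"
    by (intro sum.cong) (auto simp: lookup_cscale lookup_single when_def)
  also have "\<dots> = Poly_Mapping.lookup p b" by (auto simp: in_keys_iff)
  finally show "Poly_Mapping.lookup (\<Sum>a\<in>Poly_Mapping.keys p. cscale (Poly_Mapping.lookup p a) (Poly_Mapping.single a 1)) b = Poly_Mapping.lookup p b"
    by (simp add: lookup_sum)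
qed

text \<open>Linear induction over the support: identities between linear maps reduce to basis
  elements. The scalar belongs to the middle case because \<open>P\<close> is not assumed to be
  closed under scaling.\<close>

lemma keys_induct [consumes 1, case_names zero single add]:
  assumes "Poly_Mapping.keys p \<subseteq> A"
    and "P 0"
    and "\<And>a c. a \<in> A \<Longrightarrow> P (cscale c (Poly_Mapping.single a 1))"
    and "\<And>p q. P p \<Longrightarrow> P q \<Longrightarrow> P (p + q)"
  shows "P p"
proof -
  have "P (\<Sum>a\<in>F. cscale (Poly_Mapping.lookup p a) (Poly_Mapping.single a 1))"
    if "finite F" "F \<subseteq> A" for F
    using that by (induction F) (auto intro: assms)
  from this[of "Poly_Mapping.keys p"] assms(1) show ?thesis
    by (simp add: sum_cscale_single)
qed

text \<open>Constants are central even where the convolution does not commute, because the neutral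
  element \<open>0\<close> of the monoid commutes with everything.\<close>

lemma single_zero_commute:
  "p * Poly_Mapping.single 0 c = Poly_Mapping.single 0 c * (p :: 'a::monoid_add \<Rightarrow>\<^sub>0 complex)"
proof -
  have "Poly_Mapping.keys p \<subseteq> UNIV" by simp
  then show ?thesis
    by (induction rule: keys_induct)
      (simp_all add: cscale_single mult_single distrib_left distrib_right mult.commute)
qed

lemma cscale_mult_left: "cscale c p * q = cscale c (p * (q :: 'a::monoid_add \<Rightarrow>\<^sub>0 complex))"
  by (simp add: cscale_eq_single_mult mult.assoc)

lemma cscale_mult_right: "p * cscale c q = cscale c (p * (q :: 'a::monoid_add \<Rightarrow>\<^sub>0 complex))"
  by (metis cscale_eq_single_mult mult.assoc single_zero_commute)

lemma subspace_keys: "pm.subspace {p. Poly_Mapping.keys p \<subseteq> A}"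
proof (rule pm.subspaceI)
  fix p r :: "'a \<Rightarrow>\<^sub>0 complex" and c
  assume p: "p \<in> {p. Poly_Mapping.keys p \<subseteq> A}"
  then show "cscale c p \<in> {p. Poly_Mapping.keys p \<subseteq> A}"
    using keys_cscale[of c p] by auto
  assume "r \<in> {p. Poly_Mapping.keys p \<subseteq> A}"
  with p show "p + r \<in> {p. Poly_Mapping.keys p \<subseteq> A}"
    using keys_add[of p r] by auto
qed simp

lemma span_singles:
  "pm.span ((\<lambda>a. Poly_Mapping.single a 1) ` A) = {p. Poly_Mapping.keys p \<subseteq> A}"
proof
  have "(\<lambda>a. Poly_Mapping.single a (1 :: complex)) ` A \<subseteq> {p. Poly_Mapping.keys p \<subseteq> A}"
    by auto
  then show "pm.span ((\<lambda>a. Poly_Mapping.single a 1) ` A) \<subseteq> {p. Poly_Mapping.keys p \<subseteq> A}"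
    by (rule pm.span_minimal[OF _ subspace_keys])
  show "{p. Poly_Mapping.keys p \<subseteq> A} \<subseteq> pm.span ((\<lambda>a. Poly_Mapping.single a 1) ` A)"
  proof
    fix p :: "'a \<Rightarrow>\<^sub>0 complex"
    assume "p \<in> {p. Poly_Mapping.keys p \<subseteq> A}"
    then have "(\<Sum>a\<in>Poly_Mapping.keys p. cscale (Poly_Mapping.lookup p a) (Poly_Mapping.single a 1))
        \<in> pm.span ((\<lambda>a. Poly_Mapping.single a 1) ` A)"
      by (intro pm.span_sum pm.span_scale pm.span_base) auto
    then show "p \<in> pm.span ((\<lambda>a. Poly_Mapping.single a 1) ` A)"
      by (simp only: sum_cscale_single)
  qed
qed

lemma lookup_linear_extension:
  "Poly_Mapping.lookup (linear_extension f p) c =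
    (\<Sum>a\<in>Poly_Mapping.keys p. Poly_Mapping.lookup p a * Poly_Mapping.lookup (f a) c)"
  by (simp add: linear_extension_def lookup_sum lookup_cscale)

lemma lookup_linear_extension_superset:
  assumes "finite F" "Poly_Mapping.keys p \<subseteq> F"
  shows "Poly_Mapping.lookup (linear_extension f p) c =
    (\<Sum>a\<in>F. Poly_Mapping.lookup p a * Poly_Mapping.lookup (f a) c)"
  unfolding lookup_linear_extension using assms
  by (intro sum.mono_neutral_left) (auto simp: in_keys_iff)

lemma linear_extension_add: "linear_extension f (p + q) = linear_extension f p + linear_extension f q"
proof (rule poly_mapping_eqI)
  fix c
  let ?F = "Poly_Mapping.keys p \<union> Poly_Mapping.keys q"
  have "Poly_Mapping.keys (p + q) \<subseteq> ?F" by (rule keys_add)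
  then show "Poly_Mapping.lookup (linear_extension f (p + q)) c =
      Poly_Mapping.lookup (linear_extension f p + linear_extension f q) c"
    by (simp add: lookup_linear_extension_superset[of ?F] lookup_add sum.distrib algebra_simps)
qed

lemma linear_extension_cscale: "linear_extension f (cscale c p) = cscale c (linear_extension f p)"
  using keys_cscale[of c p]
  by (intro poly_mapping_eqI)
    (simp add: lookup_linear_extension_superset[of "Poly_Mapping.keys p"] lookup_cscale
      sum_distrib_left mult.assoc)

lemma linear_extension_zero [simp]: "linear_extension f 0 = 0"
  by (simp add: linear_extension_def)

lemma linear_extension_diff: "linear_extension f (p - q) = linear_extension f p - linear_extension f q"
  using linear_extension_add[of f "p - q" q] by simp

lemma linear_extension_single [simp]:
  "linear_extension f (Poly_Mapping.single a c) = cscale c (f a)"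
  by (simp add: linear_extension_def)

lemma lookup_tensor:
  "Poly_Mapping.lookup (tensor p q) (a, b) = Poly_Mapping.lookup p a * Poly_Mapping.lookup q b"
proof -
  have *: "Poly_Mapping.lookup (linear_extension (\<lambda>b. Poly_Mapping.single (a', b) 1) q) (a, b) =
      (if a' = a then Poly_Mapping.lookup q b else 0)" for a'
  proof -
    have "Poly_Mapping.lookup (linear_extension (\<lambda>b. Poly_Mapping.single (a', b) 1) q) (a, b) =
        (\<Sum>b'\<in>Poly_Mapping.keys q. if b' = b then (if a' = a then Poly_Mapping.lookup q b else 0) else 0)"
      unfolding lookup_linear_extension by (intro sum.cong) (auto simp: lookup_single when_def)
    then show ?thesis by (auto simp: in_keys_iff)
  qed
  have "Poly_Mapping.lookup (tensor p q) (a, b) =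
      (\<Sum>a'\<in>Poly_Mapping.keys p. if a' = a then Poly_Mapping.lookup p a * Poly_Mapping.lookup q b else 0)"
    unfolding tensor_def lookup_linear_extension[of _ p] * by (intro sum.cong) auto
  then show ?thesis by (auto simp: in_keys_iff)
qed

lemma poly_mapping_prod_eqI:
  "(\<And>a b. Poly_Mapping.lookup p (a, b) = Poly_Mapping.lookup q (a, b)) \<Longrightarrow> p = q"
  by (auto intro: poly_mapping_eqI)

lemma tensor_add_left: "tensor (p + p') q = tensor p q + tensor p' q"
  by (rule poly_mapping_prod_eqI) (simp add: lookup_tensor lookup_add algebra_simps)

lemma tensor_add_right: "tensor p (q + q') = tensor p q + tensor p q'"
  by (rule poly_mapping_prod_eqI) (simp add: lookup_tensor lookup_add algebra_simps)

lemma tensor_cscale_left: "tensor (cscale c p) q = cscale c (tensor p q)"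
  by (rule poly_mapping_prod_eqI) (simp add: lookup_tensor lookup_cscale)

lemma tensor_cscale_right: "tensor p (cscale c q) = cscale c (tensor p q)"
  by (rule poly_mapping_prod_eqI) (simp add: lookup_tensor lookup_cscale)

lemma tensor_diff_left: "tensor (p - p') r = tensor p r - tensor p' r"
  by (rule poly_mapping_prod_eqI) (simp add: lookup_tensor lookup_minus algebra_simps)

lemma tensor_diff_right: "tensor p (r - r') = tensor p r - tensor p r'"
  by (rule poly_mapping_prod_eqI) (simp add: lookup_tensor lookup_minus algebra_simps)

lemma tensor_zero [simp]: "tensor p 0 = 0" "tensor 0 q = 0"
  by (auto intro!: poly_mapping_prod_eqI simp: lookup_tensor)

lemma tensor_singles [simp]:
  "tensor (Poly_Mapping.single a c) (Poly_Mapping.single b d) = Poly_Mapping.single (a, b) (c * d)"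
  by (rule poly_mapping_prod_eqI) (auto simp: lookup_tensor lookup_single when_def)

abbreviation word :: "'b list \<Rightarrow> 'b list \<Rightarrow>\<^sub>0 complex" where
  "word w \<equiv> Poly_Mapping.single w 1"

lemma word_eq_iff: "word v = word w \<longleftrightarrow> v = w"
  by (metis keys_single one_neq_zero singleton_inject)

lemma word_mult: "word v * word w = word (v @ w)"
  by (simp add: mult_single plus_list_def)

lemma one_eq_word: "1 = word []"
  by (metis single_one zero_list_def)

lemma cscale_minus_one: "cscale (-1) p = - p"
  by (rule poly_mapping_eqI) (simp add: lookup_cscale)

lemma linear_extension_in_subspace:
  assumes "pm.subspace W" "Poly_Mapping.keys p \<subseteq> A" "\<And>a. a \<in> A \<Longrightarrow> f a \<in> W"
  shows "linear_extension f p \<in> W"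
  unfolding linear_extension_def using assms
  by (intro pm.subspace_sum pm.subspace_scale) auto

text \<open>The map \<open>s* \<otimes> id\<close> on a tensor product, with \<open>s*\<close> the
  coefficient functional of the basis element \<open>s\<close>. Taking it as a restriction along the
  injection \<open>Pair s\<close> gives finite support at once.\<close>

definition contract :: "'a \<Rightarrow> ('a \<times> 'b \<Rightarrow>\<^sub>0 complex) \<Rightarrow> ('b \<Rightarrow>\<^sub>0 complex)" where
  "contract s = Poly_Mapping.map_key (Pair s)"

lemma lookup_contract:
  fixes v :: 'b
  shows "Poly_Mapping.lookup (contract s t) v = Poly_Mapping.lookup t (s, v)"
proof -
  have "inj (Pair s :: 'b \<Rightarrow> _)" by (simp add: inj_def)
  then show ?thesis by (simp add: contract_def Poly_Mapping.map_key.rep_eq)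
qed

lemma contract_add: "contract s (p + r) = contract s p + contract s r"
  by (rule poly_mapping_eqI) (simp add: lookup_contract lookup_add)

lemma contract_cscale: "contract s (cscale c p) = cscale c (contract s p)"
  by (rule poly_mapping_eqI) (simp add: lookup_contract lookup_cscale)

lemma contract_zero [simp]: "contract s 0 = 0"
  by (rule poly_mapping_eqI) (simp add: lookup_contract)

lemma contract_single [simp]:
  "contract s (Poly_Mapping.single (u, v) c) = (if u = s then Poly_Mapping.single v c else 0)"
  by (rule poly_mapping_eqI) (auto simp: lookup_contract lookup_single when_def)

lemma contract_tensor: "contract s (tensor p r) = cscale (Poly_Mapping.lookup p s) r"
  by (rule poly_mapping_eqI) (simp add: lookup_contract lookup_cscale lookup_tensor)

section \<open>Ideals of free algebras\<close>

lemma carrier_free_algebra: "carrier (free_algebra B) = {p. Poly_Mapping.keys p \<subseteq> lists B}"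
  by (simp add: free_algebra_def)

lemma free_algebra_simps [simp]:
  "monoid.mult (free_algebra B) = (*)" "one (free_algebra B) = 1"
  "ring.zero (free_algebra B) = 0" "ring.add (free_algebra B) = (+)"
  by (simp_all add: free_algebra_def)

lemma word_in_free_algebra: "w \<in> lists B \<Longrightarrow> word w \<in> carrier (free_algebra B)"
  by (simp add: carrier_free_algebra)

lemma subspace_free_algebra: "pm.subspace (carrier (free_algebra B))"
  by (simp add: carrier_free_algebra subspace_keys)

lemma mult_in_free_algebra:
  assumes "p \<in> carrier (free_algebra B)" "r \<in> carrier (free_algebra B)"
  shows "p * r \<in> carrier (free_algebra B)"
  using assms keys_mult[of p r] by (fastforce simp: carrier_free_algebra plus_list_def)

lemma ring_free_algebra: "ring (free_algebra B)"
proof (rule ringI)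
  show "abelian_group (free_algebra B)"
  proof (rule abelian_groupI)
    fix p assume p: "p \<in> carrier (free_algebra B)"
    have "- p \<in> carrier (free_algebra B)"
      using pm.subspace_neg[OF subspace_free_algebra p] .
    then show "\<exists>r\<in>carrier (free_algebra B). r \<oplus>\<^bsub>free_algebra B\<^esub> p = \<zero>\<^bsub>free_algebra B\<^esub>"
      by force
  qed (use subspace_free_algebra in \<open>auto simp: add.assoc add.commute pm.subspace_def\<close>)
  show "Group.monoid (free_algebra B)"
    using word_in_free_algebra[of "[]" B]
    by unfold_locales (auto simp: mult.assoc mult_in_free_algebra one_eq_word[symmetric])
qed (auto simp: algebra_simps)

lemma a_inv_free_algebra:
  assumes "p \<in> carrier (free_algebra B)"
  shows "\<ominus>\<^bsub>free_algebra B\<^esub> p = - p"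
proof -
  interpret ring "free_algebra B" by (rule ring_free_algebra)
  show ?thesis
    using minus_equality[of "- p" p] assms pm.subspace_neg[OF subspace_free_algebra assms] by simp
qed

lemma ideal_free_algebraI:
  assumes "pm.subspace I" "I \<subseteq> carrier (free_algebra B)"
    and "\<And>p r. p \<in> I \<Longrightarrow> r \<in> carrier (free_algebra B) \<Longrightarrow> r * p \<in> I"
    and "\<And>p r. p \<in> I \<Longrightarrow> r \<in> carrier (free_algebra B) \<Longrightarrow> p * r \<in> I"
  shows "ideal I (free_algebra B)"
proof (rule idealI[OF ring_free_algebra])
  have "inv\<^bsub>add_monoid (free_algebra B)\<^esub> p \<in> I" if "p \<in> I" for p
    using a_inv_free_algebra[unfolded a_inv_def, of p B] pm.subspace_neg[OF assms(1) that] assms(2) that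
    by (metis subsetD)
  then show "subgroup I (add_monoid (free_algebra B))"
    using assms by unfold_locales (auto simp: pm.subspace_def)
qed (use assms in auto)

lemma ideal_free_algebraD:
  assumes "ideal I (free_algebra B)"
  shows ideal_subspace: "pm.subspace I"
    and ideal_subset: "I \<subseteq> carrier (free_algebra B)"
    and ideal_mult_left: "p \<in> I \<Longrightarrow> r \<in> carrier (free_algebra B) \<Longrightarrow> r * p \<in> I"
    and ideal_mult_right: "p \<in> I \<Longrightarrow> r \<in> carrier (free_algebra B) \<Longrightarrow> p * r \<in> I"
proof -
  interpret ideal I "free_algebra B" by fact
  \<comment> \<open>Scalars are multiples of the empty word, so absorption of ring elements includes
    closure under \<open>cscale\<close>; this makes every ideal a subspace.\<close>
  have "Poly_Mapping.single 0 c \<in> carrier (free_algebra B)" for c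
    by (simp add: carrier_free_algebra zero_list_def)
  then have "cscale c p \<in> I" if "p \<in> I" for c p
    using I_l_closed[OF that] by (simp add: cscale_eq_single_mult)
  then show "pm.subspace I"
    using additive_subgroup.a_closed[OF is_additive_subgroup]
      additive_subgroup.zero_closed[OF is_additive_subgroup]
    by (intro pm.subspaceI) simp_all
  show "I \<subseteq> carrier (free_algebra B)" using Icarr by blast
  show "r * p \<in> I" "p * r \<in> I" if "p \<in> I" "r \<in> carrier (free_algebra B)"
    using I_l_closed[OF that] I_r_closed[OF that] by simp_all
qed

lemma mult_mem_subspace:
  assumes "pm.subspace J" "r \<in> carrier (free_algebra B)" "\<And>w. w \<in> lists B \<Longrightarrow> word w * p \<in> J"
  shows "r * p \<in> J"
proof -
  have "Poly_Mapping.keys r \<subseteq> lists B" using assms(2) by (simp add: carrier_free_algebra)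
  then show ?thesis
    by (induction rule: keys_induct)
      (simp_all add: assms cscale_mult_left distrib_right pm.subspace_0 pm.subspace_add
        pm.subspace_scale)
qed

lemma mult_mem_subspace_right:
  assumes "pm.subspace J" "r \<in> carrier (free_algebra B)" "\<And>w. w \<in> lists B \<Longrightarrow> p * word w \<in> J"
  shows "p * r \<in> J"
proof -
  have "Poly_Mapping.keys r \<subseteq> lists B" using assms(2) by (simp add: carrier_free_algebra)
  then show ?thesis
    by (induction rule: keys_induct)
      (simp_all add: assms cscale_mult_right distrib_left pm.subspace_0 pm.subspace_add
        pm.subspace_scale)
qed

text \<open>Multiplication never shortens words, so the combinations of words of length at least
  \<open>n\<close> already form an ideal.\<close>

lemma keys_length_ideal:
  assumes "S \<subseteq> carrier (free_algebra B)" "\<And>s w. s \<in> S \<Longrightarrow> w \<in> Poly_Mapping.keys s \<Longrightarrow> n \<le> length w"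
    and "p \<in> Idl\<^bsub>free_algebra B\<^esub> S" "w \<in> Poly_Mapping.keys p"
  shows "n \<le> length w"
proof -
  let ?I = "{p. Poly_Mapping.keys p \<subseteq> {w \<in> lists B. n \<le> length w}}"
  have "r * p \<in> ?I" "p * r \<in> ?I" if "p \<in> ?I" "r \<in> carrier (free_algebra B)" for p r
  proof -
    have "{a + b |a b. a \<in> Poly_Mapping.keys r \<and> b \<in> Poly_Mapping.keys p} \<subseteq> {w \<in> lists B. n \<le> length w}"
      "{a + b |a b. a \<in> Poly_Mapping.keys p \<and> b \<in> Poly_Mapping.keys r} \<subseteq> {w \<in> lists B. n \<le> length w}"
      using that by (auto simp: carrier_free_algebra plus_list_def subset_iff in_lists_conv_set)
    then show "r * p \<in> ?I" "p * r \<in> ?I"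
      by (simp_all only: mem_Collect_eq order_trans[OF keys_mult])
  qed
  then have "ideal ?I (free_algebra B)"
    by (intro ideal_free_algebraI subspace_keys) (auto simp: carrier_free_algebra)
  moreover have "S \<subseteq> ?I" using assms(1,2) by (auto simp: carrier_free_algebra)
  ultimately have "Idl\<^bsub>free_algebra B\<^esub> S \<subseteq> ?I"
    using ring.genideal_minimal[OF ring_free_algebra] by blast
  then show ?thesis using assms(3,4) by auto
qed

section \<open>Skew derivations for diagonal braidings\<close>

text \<open>The coproduct multiplies from the left only by
  \<open>b \<otimes> 1 + 1 \<otimes> b\<close>. The second legs here are the empty word and a single
  letter, so the only group elements whose action is met are the unit and the degrees of
  letters.\<close>

locale diagonal_braiding =
  fixes G :: "('g, 'm) monoid_scheme" and V :: "('g, 'b) yd_data" and q :: "'b \<Rightarrow> 'b \<Rightarrow> complex"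
  assumes group: "group G"
    and degree_closed: "b \<in> yd_basis V \<Longrightarrow> yd_degree V b \<in> carrier G"
    and action_one: "b \<in> yd_basis V \<Longrightarrow> yd_action V \<one>\<^bsub>G\<^esub> b = Poly_Mapping.single b 1"
    and action_degree: "a \<in> yd_basis V \<Longrightarrow> b \<in> yd_basis V \<Longrightarrow>
      yd_action V (yd_degree V a) b = Poly_Mapping.single b (q a b)"
begin

abbreviation "B \<equiv> yd_basis V"
abbreviation "T \<equiv> tensor_algebra V"

definition word_scalar :: "'b \<Rightarrow> 'b list \<Rightarrow> complex" where
  "word_scalar a w = prod_list (map (q a) w)"

lemma word_scalar_simps [simp]:
  "word_scalar a [] = 1" "word_scalar a (b # w) = q a b * word_scalar a w"
  "word_scalar a (v @ w) = word_scalar a v * word_scalar a w"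
  by (simp_all add: word_scalar_def)

lemma word_action_one: "w \<in> lists B \<Longrightarrow> word_action V \<one>\<^bsub>G\<^esub> w = word w"
  by (induction w) (simp_all add: word_action_def action_one word_mult one_eq_word)

lemma word_action_degree:
  "a \<in> B \<Longrightarrow> w \<in> lists B \<Longrightarrow> word_action V (yd_degree V a) w = cscale (word_scalar a w) (word w)"
  by (induction w) (simp_all add: word_action_def action_degree word_mult one_eq_word
    cscale_mult_left cscale_mult_right)

text \<open>Left multiplication by \<open>a \<otimes> 1 + 1 \<otimes> a\<close> in the braided tensor square.\<close>

definition primitive_mult where
  "primitive_mult a = linear_extension (\<lambda>(u, v). Poly_Mapping.single (a # u, v) 1 +
    cscale (word_scalar a u) (Poly_Mapping.single (u, a # v) 1))"

lemma primitive_mult_add: "primitive_mult a (s + t) = primitive_mult a s + primitive_mult a t"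
  by (simp add: primitive_mult_def linear_extension_add)

lemma primitive_mult_cscale: "primitive_mult a (cscale c s) = cscale c (primitive_mult a s)"
  by (simp add: primitive_mult_def linear_extension_cscale)

lemma primitive_mult_zero [simp]: "primitive_mult a 0 = 0"
  by (simp add: primitive_mult_def)

lemma primitive_mult_single:
  "primitive_mult a (Poly_Mapping.single (u, v) 1) =
    Poly_Mapping.single (a # u, v) 1 + cscale (word_scalar a u) (Poly_Mapping.single (u, a # v) 1)"
  by (simp add: primitive_mult_def)

lemma braided_mult_add: "braided_mult G V s (t + t') = braided_mult G V s t + braided_mult G V s t'"
  by (simp add: braided_mult_def tensor_add_right linear_extension_add)

lemma braided_mult_cscale: "braided_mult G V s (cscale c t) = cscale c (braided_mult G V s t)"
  by (simp add: braided_mult_def tensor_cscale_right linear_extension_cscale)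

text \<open>This replaces the general braided product by a two-term operator on which all later
  computations with the coproduct run. The support of \<open>t\<close> matters because the action is
  prescribed on letters of \<open>B\<close> only.\<close>

lemma braided_mult_generator:
  assumes "a \<in> B" and "Poly_Mapping.keys t \<subseteq> lists B \<times> lists B"
  shows "braided_mult G V (tensor (gen a) 1 + tensor 1 (gen a)) t = primitive_mult a t"
  using assms(2)
proof (induction rule: keys_induct)
  case zero
  show ?case by (simp add: braided_mult_def)
next
  case (single x c)
  then obtain u v where x: "x = (u, v)" and u: "u \<in> lists B" by auto
  have "word_degree G V [] = \<one>\<^bsub>G\<^esub>" "word_degree G V [a] = yd_degree V a"
    using assms(1) group degree_closed by (simp_all add: word_degree_def group.is_monoid)
  then have "braided_mult G V (tensor (gen a) 1 + tensor 1 (gen a)) (Poly_Mapping.single x 1) =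
      primitive_mult a (Poly_Mapping.single x 1)"
    using assms(1) u
    by (simp add: braided_mult_def x one_eq_word tensor_add_left linear_extension_add word_mult
        word_action_one word_action_degree primitive_mult_single tensor_cscale_left cscale_mult_right)
  then show ?case by (simp only: braided_mult_cscale primitive_mult_cscale)
next
  case (add p r)
  then show ?case by (simp only: braided_mult_add primitive_mult_add)
qed

lemma keys_primitive_mult:
  assumes "a \<in> B" "Poly_Mapping.keys t \<subseteq> lists B \<times> lists B"
  shows "Poly_Mapping.keys (primitive_mult a t) \<subseteq> lists B \<times> lists B"
proof -
  note sub = subspace_keys[of "lists B \<times> lists B"]
  have *: "Poly_Mapping.single (a # u, v) 1 + cscale (word_scalar a u) (Poly_Mapping.single (u, a # v) 1)
      \<in> {t. Poly_Mapping.keys t \<subseteq> lists B \<times> lists B}" if "u \<in> lists B" "v \<in> lists B" for u v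
    using that assms(1) by (intro pm.subspace_add[OF sub] pm.subspace_scale[OF sub]) simp_all
  have "primitive_mult a t \<in> {t. Poly_Mapping.keys t \<subseteq> lists B \<times> lists B}"
    unfolding primitive_mult_def
    by (rule linear_extension_in_subspace[OF sub assms(2)])
      (simp add: split_beta mem_Times_iff * del: mem_Collect_eq)
  then show ?thesis by simp
qed

lemma keys_word_coproduct:
  "w \<in> lists B \<Longrightarrow> Poly_Mapping.keys (word_coproduct G V w) \<subseteq> lists B \<times> lists B"
proof (induction w)
  case (Cons a w)
  then have "a \<in> B" "Poly_Mapping.keys (word_coproduct G V w) \<subseteq> lists B \<times> lists B" by auto
  then show ?case
    by (simp only: word_coproduct.simps braided_mult_generator keys_primitive_mult)
qed (simp add: one_eq_word)

lemma word_coproduct_Cons: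
  "a \<in> B \<Longrightarrow> w \<in> lists B \<Longrightarrow>
    word_coproduct G V (a # w) = primitive_mult a (word_coproduct G V w)"
  by (simp add: braided_mult_generator keys_word_coproduct)

declare word_coproduct.simps(2) [simp del]

lemma coproduct_add: "coproduct G V (p + r) = coproduct G V p + coproduct G V r"
  by (simp add: coproduct_def linear_extension_add)

lemma coproduct_cscale: "coproduct G V (cscale c p) = cscale c (coproduct G V p)"
  by (simp add: coproduct_def linear_extension_cscale)

lemma coproduct_word [simp]: "coproduct G V (word w) = word_coproduct G V w"
  by (simp add: coproduct_def)

text \<open>On words in \<open>B\<close>, the skew derivation \<open>(b\<^sup>* \<otimes> id) \<Delta>\<close>, where \<open>b\<^sup>*\<close> extracts the coefficient of
  the one-letter word \<open>b\<close>. It maps a coideal without terms of degree below two to itself.\<close>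

fun word_derivation :: "'b \<Rightarrow> 'b list \<Rightarrow> 'b list \<Rightarrow>\<^sub>0 complex" where
  "word_derivation b [] = 0"
| "word_derivation b (a # w) =
    (if a = b then word w else 0) + cscale (q a b) (gen a * word_derivation b w)"

definition derivation :: "'b \<Rightarrow> ('b list \<Rightarrow>\<^sub>0 complex) \<Rightarrow> 'b list \<Rightarrow>\<^sub>0 complex" where
  "derivation b = linear_extension (word_derivation b)"

lemma derivation_add: "derivation b (p + r) = derivation b p + derivation b r"
  by (simp add: derivation_def linear_extension_add)

lemma derivation_cscale: "derivation b (cscale c p) = cscale c (derivation b p)"
  by (simp add: derivation_def linear_extension_cscale)

lemma derivation_zero [simp]: "derivation b 0 = 0"
  by (simp add: derivation_def)

lemma derivation_word [simp]: "derivation b (word w) = word_derivation b w"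
  by (simp add: derivation_def)

text \<open>Only the summand that prolongs the second leg can keep the first leg empty, and it does
  so with the factor \<open>word_scalar a [] = 1\<close>.\<close>

lemma contract_Nil_primitive_mult: "contract [] (primitive_mult a t) = gen a * contract [] t"
proof -
  have "Poly_Mapping.keys t \<subseteq> UNIV" by simp
  then show ?thesis
  proof (induction rule: keys_induct)
    case (single x c)
    then show ?case
      by (cases x) (simp only: primitive_mult_cscale contract_cscale cscale_mult_right,
        simp add: primitive_mult_single contract_add contract_cscale word_mult)
  qed (simp_all add: primitive_mult_add contract_add distrib_left)
qed

text \<open>A first leg \<open>[b]\<close> arises either by putting \<open>a = b\<close> in front of
  an empty leg or by letting \<open>a\<close> pass an existing leg \<open>[b]\<close>, which costs
  \<open>q a b\<close>. This is the recursion of \<open>word_derivation\<close>.\<close>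

lemma contract_gen_primitive_mult:
  "contract [b] (primitive_mult a t) =
    (if a = b then contract [] t else 0) + cscale (q a b) (gen a * contract [b] t)"
proof -
  have "Poly_Mapping.keys t \<subseteq> UNIV" by simp
  then show ?thesis
  proof (induction rule: keys_induct)
    case (single x c)
    obtain u v where x: "x = (u, v)" by fastforce
    have "contract [b] (primitive_mult a (Poly_Mapping.single x 1)) =
      (if a = b then contract [] (Poly_Mapping.single x 1) else 0) +
        cscale (q a b) (gen a * contract [b] (Poly_Mapping.single x 1))"
      by (auto simp add: x primitive_mult_single contract_add contract_cscale word_mult)
    then show ?case
      by (auto simp only: primitive_mult_cscale contract_cscale cscale_mult_right
          pm.scale_right_distrib pm.scale_left_commute[of "q a b" c] pm.scale_zero_right
          split: if_splits)
  qed (simp_all add: primitive_mult_add contract_add distrib_left pm.scale_right_distrib)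
qed

text \<open>The first equation is the counit axiom; the second identifies the recursive
  \<open>word_derivation\<close> with a contraction of the coproduct.\<close>

lemma contract_word_coproduct:
  "w \<in> lists B \<Longrightarrow> contract [] (word_coproduct G V w) = word w"
  "w \<in> lists B \<Longrightarrow> contract [b] (word_coproduct G V w) = word_derivation b w"
  by (induction w)
    (auto simp: one_eq_word word_coproduct_Cons contract_Nil_primitive_mult
      contract_gen_primitive_mult word_mult)

lemma contract_coproduct:
  assumes "p \<in> carrier T"
  shows "contract [b] (coproduct G V p) = derivation b p"
proof -
  have "Poly_Mapping.keys p \<subseteq> lists B" using assms by (simp add: carrier_free_algebra)
  then show ?thesis
  proof (induction rule: keys_induct)
    case (single w c)
    then show ?case
      by (simp only: coproduct_cscale contract_cscale derivation_cscale coproduct_word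
          derivation_word contract_word_coproduct)
  qed (simp_all add: coproduct_add contract_add derivation_add, simp add: coproduct_def)
qed

lemma derivation_coideal:
  assumes "is_coideal G V I" "pm.subspace I" "I \<subseteq> carrier T"
    and "\<And>p w. p \<in> I \<Longrightarrow> w \<in> Poly_Mapping.keys p \<Longrightarrow> 2 \<le> length w"
    and "p \<in> I"
  shows "derivation b p \<in> I"
proof -
  have "contract [b] t \<in> I" if
    "t \<in> pm.span ({tensor p q | p q. p \<in> I \<and> q \<in> carrier T} \<union> {tensor p q | p q. p \<in> carrier T \<and> q \<in> I})"
    for t
    using that
  proof (induction rule: pm.span_induct_alt)
    case base
    show ?case using assms(2) by (simp add: pm.subspace_0)
  next
    case (step c x y)
    have "contract [b] x \<in> I"
      using step(1)
    proof
      assume "x \<in> {tensor p q | p q. p \<in> I \<and> q \<in> carrier T}"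
      then obtain p r where x: "x = tensor p r" and "p \<in> I" by auto
      \<comment> \<open>One-letter words do not occur in \<open>I\<close>, so the summands with left
        factor in \<open>I\<close> disappear.\<close>
      then have "Poly_Mapping.lookup p [b] = 0"
        using assms(4)[of p "[b]"] by (auto simp: in_keys_iff)
      then show ?thesis using assms(2) by (simp add: x contract_tensor pm.subspace_0)
    next
      assume "x \<in> {tensor p q | p q. p \<in> carrier T \<and> q \<in> I}"
      then show ?thesis using assms(2) by (auto simp: contract_tensor pm.subspace_scale)
    qed
    then show ?case
      using step(2) assms(2) by (simp add: contract_add contract_cscale pm.subspace_add pm.subspace_scale)
  qed
  moreover have "coproduct G V p \<in>
    pm.span ({tensor p q | p q. p \<in> I \<and> q \<in> carrier T} \<union> {tensor p q | p q. p \<in> carrier T \<and> q \<in> I})"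
    using assms(1,5) by (auto simp: is_coideal_def)
  ultimately have "contract [b] (coproduct G V p) \<in> I" by blast
  moreover have "p \<in> carrier T" using assms(3,5) by blast
  ultimately show ?thesis by (simp only: contract_coproduct)
qed

primrec derivation_coeff :: "'b list \<Rightarrow> ('b list \<Rightarrow>\<^sub>0 complex) \<Rightarrow> complex" where
  "derivation_coeff [] p = Poly_Mapping.lookup p []"
| "derivation_coeff (b # s) p = derivation_coeff s (derivation b p)"

lemma derivation_coeff_add:
  "derivation_coeff s (p + r) = derivation_coeff s p + derivation_coeff s r"
  by (induction s arbitrary: p r) (simp_all add: lookup_add derivation_add)

lemma derivation_coeff_cscale: "derivation_coeff s (cscale c p) = c * derivation_coeff s p"
  by (induction s arbitrary: p) (simp_all add: lookup_cscale derivation_cscale)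

lemma derivation_coeff_zero [simp]: "derivation_coeff s 0 = 0"
  by (induction s) simp_all

definition homogeneous_coideal :: "('b list \<Rightarrow>\<^sub>0 complex) set \<Rightarrow> bool" where
  "homogeneous_coideal I \<longleftrightarrow> is_coideal G V I \<and>
    (\<exists>S\<subseteq>carrier T. (\<forall>s\<in>S. \<exists>n\<ge>2. homogeneous n s) \<and> I = Idl\<^bsub>T\<^esub> S)"

lemma nichols_ideal_eq: "nichols_ideal G V = pm.span (\<Union>{I. homogeneous_coideal I})"
  by (simp add: nichols_ideal_def homogeneous_coideal_def)

lemma homogeneous_coidealD:
  assumes "homogeneous_coideal I"
  shows "ideal I T" and "p \<in> I \<Longrightarrow> w \<in> Poly_Mapping.keys p \<Longrightarrow> 2 \<le> length w"
proof -
  obtain S where S: "S \<subseteq> carrier T" "\<forall>s\<in>S. \<exists>n\<ge>2. homogeneous n s" "I = Idl\<^bsub>T\<^esub> S"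
    using assms by (auto simp: homogeneous_coideal_def)
  show "ideal I T" using ring.genideal_ideal[OF ring_free_algebra S(1)] S(3) by simp
  show "2 \<le> length w" if "p \<in> I" "w \<in> Poly_Mapping.keys p"
    using that S(2) by (intro keys_length_ideal[OF S(1) _ _ that(2)])
      (auto simp: S(3) homogeneous_def)
qed

lemma derivation_coeff_homogeneous_coideal:
  assumes "homogeneous_coideal I" "p \<in> I"
  shows "derivation_coeff s p = 0"
  using assms(2)
proof (induction s arbitrary: p)
  case Nil
  then show ?case using homogeneous_coidealD(2)[OF assms(1) Nil, of "[]"] by (auto simp: in_keys_iff)
next
  case (Cons b s)
  have "derivation b p \<in> I"
    using assms(1) ideal_free_algebraD[OF homogeneous_coidealD(1)[OF assms(1)]]
      homogeneous_coidealD(2)[OF assms(1)] Cons.prems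
    by (intro derivation_coideal) (auto simp: homogeneous_coideal_def)
  with Cons.IH show ?case by simp
qed

lemma derivation_coeff_nichols_ideal:
  assumes "p \<in> nichols_ideal G V"
  shows "derivation_coeff s p = 0"
  using assms unfolding nichols_ideal_eq
  by (induction rule: pm.span_induct_alt)
    (auto simp: derivation_coeff_add derivation_coeff_cscale derivation_coeff_homogeneous_coideal)

end

section \<open>Increasing words\<close>

text \<open>If the first letters differed, each would occur later in the other word, so each would
  precede the other, against asymmetry.\<close>

lemma strict_linear_order_on_sorted_unique:
  assumes "strict_linear_order_on A lt" "sorted_wrt (\<lambda>a b. (a, b) \<in> lt) xs"
    "sorted_wrt (\<lambda>a b. (a, b) \<in> lt) ys" "set xs = set ys"
  shows "xs = ys"
  using assms(2-4)
proof (induction xs arbitrary: ys)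
  case (Cons x xs)
  then obtain y ys' where ys: "ys = y # ys'" by (cases ys) auto
  have asym: "\<not> ((a, b) \<in> lt \<and> (b, a) \<in> lt)" and irr: "(a, a) \<notin> lt" for a b
    using assms(1) by (auto simp: strict_linear_order_on_def irrefl_def dest: transD)
  have "x = y"
  proof (rule ccontr)
    assume "x \<noteq> y"
    then have "(x, y) \<in> lt" "(y, x) \<in> lt" using Cons.prems unfolding ys by (auto simp: insert_eq_iff)
    then show False using asym by blast
  qed
  moreover have "x \<notin> set xs" "y \<notin> set ys'" using Cons.prems irr unfolding ys by auto
  then have "set xs = set ys'" using Cons.prems(3) \<open>x = y\<close> unfolding ys by auto
  ultimately show ?case using Cons unfolding ys by auto
qed auto

lemma strict_linear_order_on_sorted_distinct:
  assumes "strict_linear_order_on A lt" "sorted_wrt (\<lambda>a b. (a, b) \<in> lt) xs"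
  shows "distinct xs"
  using assms(2) assms(1)
  by (induction xs) (auto simp: strict_linear_order_on_def irrefl_def)

text \<open>Insertion sort. Totality holds on \<open>A\<close> only, whereas transitivity and
  irreflexivity in \<open>strict_linear_order_on\<close> are global.\<close>

lemma strict_linear_order_on_sorted_exists:
  assumes "strict_linear_order_on A lt" "finite F" "F \<subseteq> A"
  shows "\<exists>xs. sorted_wrt (\<lambda>a b. (a, b) \<in> lt) xs \<and> set xs = F"
proof -
  have ins: "\<exists>ys. sorted_wrt (\<lambda>a b. (a, b) \<in> lt) ys \<and> set ys = insert a (set xs)"
    if "a \<in> A" "set xs \<subseteq> A" "sorted_wrt (\<lambda>a b. (a, b) \<in> lt) xs" for a xs
    using that
  proof (induction xs)
    case Nil
    show ?case by (rule exI[of _ "[a]"]) simp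
  next
    case (Cons x xs)
    then obtain ys where ys: "sorted_wrt (\<lambda>a b. (a, b) \<in> lt) ys" "set ys = insert a (set xs)"
      by auto
    consider "a = x" | "(a, x) \<in> lt" | "(x, a) \<in> lt"
      using assms(1) Cons.prems by (auto simp: strict_linear_order_on_def total_on_def)
    then show ?case
    proof cases
      case 1
      then show ?thesis using Cons.prems(3) by (intro exI[of _ "x # xs"]) auto
    next
      case 2
      moreover have "trans lt" using assms(1) by (simp add: strict_linear_order_on_def)
      ultimately show ?thesis
        using Cons.prems(3) by (intro exI[of _ "a # x # xs"]) (auto dest: transD)
    next
      case 3
      then show ?thesis using ys Cons.prems(3) by (intro exI[of _ "x # ys"]) auto
    qed
  qed
  show ?thesis
    using assms(2,3)
  proof (induction F)
    case (insert a F)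
    then obtain xs where "sorted_wrt (\<lambda>a b. (a, b) \<in> lt) xs" "set xs = F" by auto
    with ins[of a xs] insert.prems show ?case by auto
  qed (rule exI[of _ "[]"], simp)
qed

section \<open>Quantum exterior algebras\<close>

text \<open>The case \<open>a = b\<close> of symmetry only says that \<open>q a a\<close> squares to
  1; the sign -1 is what yields an exterior rather than a symmetric algebra.\<close>

locale quantum_exterior = diagonal_braiding G V q
  for G :: "('g, 'm) monoid_scheme" and V :: "('g, 'b) yd_data" and q :: "'b \<Rightarrow> 'b \<Rightarrow> complex" +
  assumes symmetric: "a \<in> yd_basis V \<Longrightarrow> b \<in> yd_basis V \<Longrightarrow> q a b * q b a = 1"
    and diagonal: "a \<in> yd_basis V \<Longrightarrow> q a a = -1"
    and finite_basis: "finite (yd_basis V)"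
begin

section \<open>The relations generate a coideal\<close>

definition relation :: "'b \<Rightarrow> 'b \<Rightarrow> 'b list \<Rightarrow>\<^sub>0 complex" where
  "relation i j = word [i, j] - cscale (q i j) (word [j, i])"

text \<open>A linear span of two-sided word multiples gives an induction principle for the elements;
  that this is the ideal generated by the relations is proved in
  \<open>genideal_quantum_linear_relations\<close>.\<close>

definition relation_ideal :: "('b list \<Rightarrow>\<^sub>0 complex) set" where
  "relation_ideal = pm.span {word u * relation i j * word v | u i j v.
    u \<in> lists B \<and> v \<in> lists B \<and> i \<in> B \<and> j \<in> B}"

lemma subspace_relation_ideal: "pm.subspace relation_ideal"
  by (simp add: relation_ideal_def)

lemma relation_in_carrier: "i \<in> B \<Longrightarrow> j \<in> B \<Longrightarrow> relation i j \<in> carrier T"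
  unfolding relation_def
  by (intro pm.subspace_diff[OF subspace_free_algebra] pm.subspace_scale[OF subspace_free_algebra]
      word_in_free_algebra) auto

lemma relation_in_relation_ideal:
  "i \<in> B \<Longrightarrow> j \<in> B \<Longrightarrow> u \<in> lists B \<Longrightarrow> v \<in> lists B \<Longrightarrow> word u * relation i j * word v \<in> relation_ideal"
  unfolding relation_ideal_def by (intro pm.span_base) blast

lemma relation_ideal_induct [consumes 1, case_names zero step]:
  assumes "p \<in> relation_ideal" "P 0"
    and "\<And>c u i j v p. u \<in> lists B \<Longrightarrow> v \<in> lists B \<Longrightarrow> i \<in> B \<Longrightarrow> j \<in> B \<Longrightarrow> P p \<Longrightarrow>
      P (cscale c (word u * relation i j * word v) + p)"
  shows "P p"
  using assms(1) unfolding relation_ideal_def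
proof (induction rule: pm.span_induct_alt)
  case (step c x y)
  then show ?case using assms(3) by blast
qed (rule assms(2))

lemma ideal_relation_ideal: "ideal relation_ideal T"
proof (rule ideal_free_algebraI)
  show "relation_ideal \<subseteq> carrier T"
    unfolding relation_ideal_def
    by (rule pm.span_minimal[OF _ subspace_free_algebra])
      (auto intro!: mult_in_free_algebra word_in_free_algebra relation_in_carrier)
  have left: "word w * p \<in> relation_ideal" if "p \<in> relation_ideal" "w \<in> lists B" for w p
    using that(1)
  proof (induction rule: relation_ideal_induct)
    case (step c u i j v p)
    have "word w * (word u * relation i j * word v) = word (w @ u) * relation i j * word v"
      by (simp add: mult.assoc[symmetric] word_mult)
    then have "word w * (word u * relation i j * word v) \<in> relation_ideal"
      using step that(2) by (simp add: relation_in_relation_ideal)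
    then show ?case
      using step subspace_relation_ideal
      by (simp add: distrib_left cscale_mult_right pm.subspace_add pm.subspace_scale)
  qed (simp add: pm.subspace_0[OF subspace_relation_ideal])
  have right: "p * word w \<in> relation_ideal" if "p \<in> relation_ideal" "w \<in> lists B" for w p
    using that(1)
  proof (induction rule: relation_ideal_induct)
    case (step c u i j v p)
    have "(word u * relation i j * word v) * word w = word u * relation i j * word (v @ w)"
      by (simp add: mult.assoc word_mult)
    then have "(word u * relation i j * word v) * word w \<in> relation_ideal"
      using step that(2) by (simp add: relation_in_relation_ideal)
    then show ?case
      using step subspace_relation_ideal
      by (simp add: distrib_right cscale_mult_left pm.subspace_add pm.subspace_scale)
  qed (simp add: pm.subspace_0[OF subspace_relation_ideal])
  show "r * p \<in> relation_ideal" "p * r \<in> relation_ideal"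
    if "p \<in> relation_ideal" "r \<in> carrier T" for p r
    using mult_mem_subspace[OF subspace_relation_ideal that(2)] left[OF that(1)]
      mult_mem_subspace_right[OF subspace_relation_ideal that(2)] right[OF that(1)] by auto
qed (rule subspace_relation_ideal)

lemma gen_power2: "gen b ^ 2 = word [b, b]"
  by (simp add: power2_eq_square word_mult)

lemma relation_same: "i \<in> B \<Longrightarrow> relation i i = cscale 2 (gen i ^ 2)"
  using pm.scale_left_distrib[of 1 1 "word [i, i]"]
  by (simp add: relation_def gen_power2 diagonal cscale_minus_one)

lemma quantum_linear_relations_eq:
  "quantum_linear_relations B (\<lambda>_. 2) q =
    {gen i ^ 2 | i. i \<in> B} \<union> {relation i j | i j. i \<in> B \<and> j \<in> B \<and> i \<noteq> j}"
  by (simp add: quantum_linear_relations_def relation_def word_mult)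

lemma quantum_linear_relations_subset: "quantum_linear_relations B (\<lambda>_. 2) q \<subseteq> carrier T"
  by (auto simp: quantum_linear_relations_eq gen_power2 intro!: relation_in_carrier word_in_free_algebra)

lemma genideal_quantum_linear_relations:
  "Idl\<^bsub>T\<^esub> (quantum_linear_relations B (\<lambda>_. 2) q) = relation_ideal"
proof
  have rel: "relation i j \<in> relation_ideal" if "i \<in> B" "j \<in> B" for i j
    using relation_in_relation_ideal[OF that, of "[]" "[]"] by (simp add: one_eq_word[symmetric])
  \<comment> \<open>The relation with \<open>i = j\<close> is twice the square, and 2 is
    invertible.\<close>
  moreover have "gen i ^ 2 \<in> relation_ideal" if "i \<in> B" for i
    using pm.subspace_scale[OF subspace_relation_ideal rel[OF that that], of "1/2"] that
    by (simp add: relation_same)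
  ultimately have "quantum_linear_relations B (\<lambda>_. 2) q \<subseteq> relation_ideal"
    by (auto simp: quantum_linear_relations_eq)
  then show "Idl\<^bsub>T\<^esub> (quantum_linear_relations B (\<lambda>_. 2) q) \<subseteq> relation_ideal"
    by (rule ring.genideal_minimal[OF ring_free_algebra ideal_relation_ideal])
  let ?I = "Idl\<^bsub>T\<^esub> (quantum_linear_relations B (\<lambda>_. 2) q)"
  have I: "ideal ?I T"
    by (rule ring.genideal_ideal[OF ring_free_algebra quantum_linear_relations_subset])
  have gens: "quantum_linear_relations B (\<lambda>_. 2) q \<subseteq> ?I"
    by (rule ring.genideal_self[OF ring_free_algebra quantum_linear_relations_subset])
  have rel: "relation i j \<in> ?I" if "i \<in> B" "j \<in> B" for i j
  proof (cases "i = j")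
    case True
    have "gen i ^ 2 \<in> ?I"
      using gens that by (auto simp: quantum_linear_relations_eq)
    then show ?thesis
      using True that by (auto simp: relation_same intro: pm.subspace_scale[OF ideal_subspace[OF I]])
  next
    case False
    then show ?thesis using gens that by (auto simp: quantum_linear_relations_eq)
  qed
  show "relation_ideal \<subseteq> ?I"
    unfolding relation_ideal_def
    by (rule pm.span_minimal[OF _ ideal_subspace[OF I]])
      (auto intro!: ideal_mult_right[OF I ideal_mult_left[OF I rel word_in_free_algebra] word_in_free_algebra])
qed

text \<open>The action of the degree of \<open>a\<close>, extended linearly from words to the tensor
  algebra.\<close>

definition scale_word where
  "scale_word a = linear_extension (\<lambda>w. cscale (word_scalar a w) (word w))"

lemma scale_word_add: "scale_word a (p + r) = scale_word a p + scale_word a r"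
  by (simp add: scale_word_def linear_extension_add)

lemma scale_word_diff: "scale_word a (p - r) = scale_word a p - scale_word a r"
  by (simp add: scale_word_def linear_extension_diff)

lemma scale_word_cscale: "scale_word a (cscale c p) = cscale c (scale_word a p)"
  by (simp add: scale_word_def linear_extension_cscale)

lemma scale_word_word: "scale_word a (word w) = cscale (word_scalar a w) (word w)"
  by (simp add: scale_word_def)

lemma scale_word_zero [simp]: "scale_word a 0 = 0"
  by (simp add: scale_word_def)

lemma scale_word_carrier:
  assumes "p \<in> carrier T" shows "scale_word a p \<in> carrier T"
  unfolding scale_word_def
proof (rule linear_extension_in_subspace[OF subspace_free_algebra])
  show "Poly_Mapping.keys p \<subseteq> lists B" using assms by (simp add: carrier_free_algebra)
qed (intro pm.subspace_scale[OF subspace_free_algebra] word_in_free_algebra)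

text \<open>Both terms of the relation contain the same letters, hence have the same eigenvalue. So
  the ideal is stable under the degrees, which the coideal property uses.\<close>

lemma scale_word_relation:
  "scale_word a (word u * relation i j * word v) =
    cscale (word_scalar a (u @ [i, j] @ v)) (word u * relation i j * word v)"
proof -
  have "word u * relation i j * word v = word (u @ [i, j] @ v) - cscale (q i j) (word (u @ [j, i] @ v))"
    by (simp add: relation_def right_diff_distrib left_diff_distrib cscale_mult_left
        cscale_mult_right word_mult)
  moreover have "word_scalar a (u @ [j, i] @ v) = word_scalar a (u @ [i, j] @ v)"
    by simp
  ultimately show ?thesis
    by (simp only: scale_word_diff scale_word_cscale scale_word_word pm.scale_right_diff_distrib
        pm.scale_left_commute[of "q i j"])
qed

lemma scale_word_relation_ideal:
  assumes "p \<in> relation_ideal" shows "scale_word a p \<in> relation_ideal"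
  using assms
proof (induction rule: relation_ideal_induct)
  case (step c u i j v p)
  then show ?case
    using subspace_relation_ideal relation_in_relation_ideal[of i j u v]
    by (simp add: scale_word_add scale_word_cscale scale_word_relation pm.subspace_add pm.subspace_scale
        del: append.simps word_scalar_simps)
qed (simp add: pm.subspace_0[OF subspace_relation_ideal])

text \<open>The product \<open>(a \<otimes> 1 + 1 \<otimes> a) (p \<otimes> r)\<close>: in the
  second summand \<open>a\<close> passes \<open>p\<close>, which applies the degree of
  \<open>a\<close> to \<open>p\<close>.\<close>

lemma primitive_mult_tensor:
  "primitive_mult a (tensor p r) = tensor (gen a * p) r + tensor (scale_word a p) (gen a * r)"
proof -
  have "Poly_Mapping.keys p \<subseteq> UNIV" by simp
  then show ?thesis
  proof (induction rule: keys_induct)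
    case (single u c)
    have "Poly_Mapping.keys r \<subseteq> UNIV" by simp
    then have "primitive_mult a (tensor (word u) r) =
        tensor (gen a * word u) r + tensor (scale_word a (word u)) (gen a * r)"
    proof (induction rule: keys_induct)
      case (single v d)
      have "primitive_mult a (tensor (word u) (word v)) =
        tensor (gen a * word u) (word v) + tensor (scale_word a (word u)) (gen a * word v)"
        by (simp add: primitive_mult_single word_mult scale_word_word tensor_cscale_left)
      then show ?case
        by (simp only: tensor_cscale_right primitive_mult_cscale cscale_mult_right pm.scale_right_distrib)
    qed (simp_all add: tensor_add_right primitive_mult_add distrib_left algebra_simps)
    then show ?case
      by (simp only: tensor_cscale_left primitive_mult_cscale cscale_mult_right
          pm.scale_right_distrib scale_word_cscale)
  qed (simp_all add: tensor_add_left primitive_mult_add distrib_left scale_word_add algebra_simps)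
qed

definition coideal_space :: "('b list \<times> 'b list \<Rightarrow>\<^sub>0 complex) set" where
  "coideal_space = pm.span ({tensor p q | p q. p \<in> relation_ideal \<and> q \<in> carrier T} \<union>
     {tensor p q | p q. p \<in> carrier T \<and> q \<in> relation_ideal})"

lemma subspace_coideal_space: "pm.subspace coideal_space"
  by (simp add: coideal_space_def)

lemma tensor_coideal_space:
  "p \<in> relation_ideal \<Longrightarrow> r \<in> carrier T \<Longrightarrow> tensor p r \<in> coideal_space"
  "p \<in> carrier T \<Longrightarrow> r \<in> relation_ideal \<Longrightarrow> tensor p r \<in> coideal_space"
  unfolding coideal_space_def by (rule pm.span_base; blast)+

text \<open>A first leg in the ideal stays there by absorption and by stability under
  \<open>scale_word\<close>, a second leg by absorption.\<close>

lemma primitive_mult_coideal_space: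
  assumes "a \<in> B" "t \<in> coideal_space"
  shows "primitive_mult a t \<in> coideal_space"
proof -
  have gen_a: "gen a \<in> carrier T" using assms(1) by (simp add: word_in_free_algebra)
  have "primitive_mult a (tensor p r) \<in> coideal_space"
    if "p \<in> relation_ideal \<and> r \<in> carrier T \<or> p \<in> carrier T \<and> r \<in> relation_ideal" for p r
    unfolding primitive_mult_tensor using that
  proof
    assume "p \<in> relation_ideal \<and> r \<in> carrier T"
    then show "tensor (gen a * p) r + tensor (scale_word a p) (gen a * r) \<in> coideal_space"
      by (intro pm.subspace_add[OF subspace_coideal_space] tensor_coideal_space(1)
          ideal_mult_left[OF ideal_relation_ideal] scale_word_relation_ideal
          mult_in_free_algebra gen_a) auto
  next
    assume "p \<in> carrier T \<and> r \<in> relation_ideal"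
    then show "tensor (gen a * p) r + tensor (scale_word a p) (gen a * r) \<in> coideal_space"
      by (intro pm.subspace_add[OF subspace_coideal_space] tensor_coideal_space(2)
          ideal_mult_left[OF ideal_relation_ideal] scale_word_carrier
          mult_in_free_algebra gen_a) auto
  qed
  note * = this
  show ?thesis
    using assms(2) unfolding coideal_space_def[abs_def]
  proof (induction rule: pm.span_induct_alt)
    case base
    then show ?case by (simp add: pm.span_zero)
  next
    case (step c x y)
    have "primitive_mult a x \<in> coideal_space" using step(1) * by blast
    with step(2) show ?case
      using subspace_coideal_space
      by (simp add: primitive_mult_add primitive_mult_cscale pm.subspace_add pm.subspace_scale
          coideal_space_def[symmetric])
  qed
qed

text \<open>The mixed terms \<open>j u \<otimes> i v\<close> and \<open>i u \<otimes> j v\<close> cancel because of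
  \<open>q\<^sub>i\<^sub>j q\<^sub>j\<^sub>i = 1\<close>.\<close>

lemma primitive_mult_relation:
  assumes "i \<in> B" "j \<in> B" "Poly_Mapping.keys t \<subseteq> lists B \<times> lists B"
  shows "primitive_mult i (primitive_mult j t) - cscale (q i j) (primitive_mult j (primitive_mult i t))
    \<in> coideal_space"
  using assms(3)
proof (induction rule: keys_induct)
  case zero
  show ?case by (simp add: pm.subspace_0[OF subspace_coideal_space])
next
  case (single x c)
  then obtain u v where x: "x = (u, v)" and uv: "u \<in> lists B" "v \<in> lists B" by auto
  \<comment> \<open>With a trailing factor the cancellation remains usable after
    \<open>algebra_simps\<close> has reassociated the products.\<close>
  have inv: "q i j * (q j i * z) = z" for z
    using symmetric[OF assms(1,2)] by (simp add: mult.assoc[symmetric])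
  \<comment> \<open>What survives has both letters in the same leg: a relation in the first, or a
    relation in the second once \<open>i\<close> and \<open>j\<close> have passed \<open>u\<close>,
    whence the two word scalars.\<close>
  have "primitive_mult i (primitive_mult j (Poly_Mapping.single (u, v) 1)) -
      cscale (q i j) (primitive_mult j (primitive_mult i (Poly_Mapping.single (u, v) 1))) =
    tensor (relation i j * word u) (word v) +
      cscale (word_scalar i u * word_scalar j u) (tensor (word u) (relation i j * word v))"
    by (intro poly_mapping_eqI) (simp add: primitive_mult_single primitive_mult_add primitive_mult_cscale
        relation_def left_diff_distrib cscale_mult_left word_mult tensor_diff_left tensor_diff_right
        tensor_cscale_left tensor_cscale_right lookup_add lookup_minus lookup_cscale algebra_simps inv)
  also have "\<dots> \<in> coideal_space"
    using relation_in_relation_ideal[OF assms(1,2), of "[]"] uv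
    by (intro pm.subspace_add[OF subspace_coideal_space] pm.subspace_scale[OF subspace_coideal_space]
          tensor_coideal_space(1)[OF _ word_in_free_algebra]
          tensor_coideal_space(2)[OF word_in_free_algebra])
      (auto simp: one_eq_word[symmetric])
  finally have "primitive_mult i (primitive_mult j (Poly_Mapping.single x 1)) -
      cscale (q i j) (primitive_mult j (primitive_mult i (Poly_Mapping.single x 1))) \<in> coideal_space"
    by (simp only: x)
  from pm.subspace_scale[OF subspace_coideal_space this, of c]
  show ?case
    by (simp only: primitive_mult_cscale pm.scale_right_diff_distrib pm.scale_left_commute[of "q i j" c])
next
  case (add s t)
  from pm.subspace_add[OF subspace_coideal_space add]
  show ?case
    by (simp add: primitive_mult_add pm.scale_right_distrib algebra_simps)
qed

lemma coproduct_gen_mult: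
  assumes "a \<in> B" "p \<in> carrier T"
  shows "coproduct G V (gen a * p) = primitive_mult a (coproduct G V p)"
proof -
  have "Poly_Mapping.keys p \<subseteq> lists B" using assms(2) by (simp add: carrier_free_algebra)
  then show ?thesis
  proof (induction rule: keys_induct)
    case (single w c)
    have "coproduct G V (gen a * word w) = primitive_mult a (coproduct G V (word w))"
      using assms(1) single by (simp add: word_mult word_coproduct_Cons)
    then show ?case by (simp only: cscale_mult_right coproduct_cscale primitive_mult_cscale)
  qed (simp_all add: distrib_left coproduct_add primitive_mult_add, simp add: coproduct_def)
qed

lemma coproduct_diff: "coproduct G V (p - r) = coproduct G V p - coproduct G V r"
  by (simp add: coproduct_def linear_extension_diff)

text \<open>The letters of \<open>u\<close> are peeled off by \<open>coproduct_gen_mult\<close>,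
  whose operator preserves \<open>coideal_space\<close>. What remains is
  \<open>primitive_mult_relation\<close>, applied to the coproduct of \<open>v\<close>.\<close>

lemma coproduct_relation:
  assumes "i \<in> B" "j \<in> B" "u \<in> lists B" "v \<in> lists B"
  shows "coproduct G V (word u * relation i j * word v) \<in> coideal_space"
  using assms(3)
proof (induction u)
  case Nil
  have "word [] * relation i j * word v = word (i # j # v) - cscale (q i j) (word (j # i # v))"
    by (simp add: one_eq_word[symmetric] relation_def left_diff_distrib cscale_mult_left word_mult)
  then have "coproduct G V (word [] * relation i j * word v) =
      primitive_mult i (primitive_mult j (word_coproduct G V v)) -
        cscale (q i j) (primitive_mult j (primitive_mult i (word_coproduct G V v)))"
    using assms by (simp add: coproduct_diff coproduct_cscale word_coproduct_Cons)
  then show ?case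
    using primitive_mult_relation[OF assms(1,2) keys_word_coproduct[OF assms(4)]] by simp
next
  case (Cons a u)
  have "word u * relation i j * word v \<in> carrier T"
    using relation_in_relation_ideal[OF assms(1,2) Cons.hyps(2) assms(4)]
      ideal_subset[OF ideal_relation_ideal] by blast
  moreover have "word (a # u) * relation i j * word v = gen a * (word u * relation i j * word v)"
    by (simp add: mult.assoc[symmetric] word_mult)
  ultimately show ?case
    using coproduct_gen_mult[OF Cons.hyps(1)] primitive_mult_coideal_space[OF Cons.hyps(1) Cons.IH]
    by simp
qed

lemma is_coideal_relation_ideal: "is_coideal G V relation_ideal"
proof -
  have "coproduct G V p \<in> coideal_space" if "p \<in> relation_ideal" for p
    using that
  proof (induction rule: relation_ideal_induct)
    case zero
    show ?case by (simp add: coproduct_def pm.subspace_0[OF subspace_coideal_space])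
  next
    case (step c u i j v p)
    then show ?case
      using coproduct_relation[of i j u v] subspace_coideal_space
      by (simp add: coproduct_add coproduct_cscale pm.subspace_add pm.subspace_scale)
  qed
  then show ?thesis by (auto simp: is_coideal_def coideal_space_def)
qed

lemma homogeneous_coideal_relation_ideal: "homogeneous_coideal relation_ideal"
proof -
  have "homogeneous 2 s" if "s \<in> quantum_linear_relations B (\<lambda>_. 2) q" for s
  proof -
    have "relation i j \<in> {p. Poly_Mapping.keys p \<subseteq> {w. length w = 2}}" for i j
      unfolding relation_def
      by (intro pm.subspace_diff[OF subspace_keys] pm.subspace_scale[OF subspace_keys]) simp_all
    with that show ?thesis
      by (auto simp: quantum_linear_relations_eq homogeneous_def gen_power2)
  qed
  then show ?thesis
    using is_coideal_relation_ideal quantum_linear_relations_subset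
      genideal_quantum_linear_relations unfolding homogeneous_coideal_def by blast
qed

section \<open>Increasing words span modulo the relations\<close>

context
  fixes lt :: "('b \<times> 'b) set"
  assumes lt: "strict_linear_order_on B lt"
begin

definition ordered_words :: "'b list set" where
  "ordered_words = {w \<in> lists B. sorted_wrt (\<lambda>a b. (a, b) \<in> lt) w}"

text \<open>The clause on letters strengthens the induction: it guarantees that a smaller head
  \<open>b\<close> may be put back in front of the word obtained from the tail. The scalar may be 0,
  since \<open>a\<close> may already occur in \<open>s\<close>.\<close>

lemma insert_ordered_word:
  assumes "a \<in> B" "s \<in> ordered_words"
  shows "\<exists>c s'. s' \<in> ordered_words \<and> set s' \<subseteq> insert a (set s) \<and>
    word (a # s) - cscale c (word s') \<in> relation_ideal"
  using assms(2)
proof (induction s)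
  case Nil
  have "word [a] - cscale 1 (word [a]) \<in> relation_ideal"
    by (simp add: pm.subspace_0[OF subspace_relation_ideal])
  moreover have "[a] \<in> ordered_words" using assms(1) by (simp add: ordered_words_def)
  ultimately show ?case by (intro exI[of _ 1] exI[of _ "[a]"]) simp
next
  case (Cons b t)
  have b: "b \<in> B" and t: "t \<in> ordered_words" "t \<in> lists B" using Cons.prems by (auto simp: ordered_words_def)
  have rel: "relation a b * word t \<in> relation_ideal"
    using relation_in_relation_ideal[OF assms(1) b, of "[]" t] t by (simp add: one_eq_word[symmetric])
  have rel_eq: "relation a b * word t = word (a # b # t) - cscale (q a b) (word (b # a # t))"
    by (simp add: relation_def left_diff_distrib cscale_mult_left word_mult)
  consider "a = b" | "(a, b) \<in> lt" | "(b, a) \<in> lt"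
    using lt assms(1) b by (auto simp: strict_linear_order_on_def total_on_def)
  then show ?case
  proof cases
    case 1
    \<comment> \<open>A repeated letter makes the word half of a relation, so it is congruent to 0;
      the empty word is only a placeholder for the coefficient 0.\<close>
    have "word (a # b # t) = cscale (1/2) (relation a b * word t)"
      using 1 assms(1) by (simp add: relation_same gen_power2 cscale_mult_left word_mult)
    then have "word (a # b # t) - cscale 0 (word []) \<in> relation_ideal"
      using pm.subspace_scale[OF subspace_relation_ideal rel, of "1/2"] by simp
    moreover have "[] \<in> ordered_words" by (simp add: ordered_words_def)
    ultimately show ?thesis by (intro exI[of _ 0] exI[of _ "[]"]) simp
  next
    case 2
    moreover have "trans lt" using lt by (simp add: strict_linear_order_on_def)
    ultimately have "a # b # t \<in> ordered_words"
      using Cons.prems assms(1) by (auto simp: ordered_words_def dest: transD)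
    moreover have "word (a # b # t) - cscale 1 (word (a # b # t)) \<in> relation_ideal"
      by (simp add: pm.subspace_0[OF subspace_relation_ideal])
    ultimately show ?thesis by (intro exI[of _ 1] exI[of _ "a # b # t"]) auto
  next
    case 3
    obtain c s' where s': "s' \<in> ordered_words" "set s' \<subseteq> insert a (set t)"
      and cong: "word (a # t) - cscale c (word s') \<in> relation_ideal"
      using Cons.IH[OF t(1)] by blast
    \<comment> \<open>\<open>b\<close> precedes \<open>a\<close> and all letters of
      \<open>t\<close>, hence all letters of \<open>s'\<close>.\<close>
    have "b # s' \<in> ordered_words"
      using Cons.prems s' b 3 by (auto simp: ordered_words_def)
    moreover have "word (a # b # t) - cscale (q a b * c) (word (b # s')) \<in> relation_ideal"
    proof -
      have "gen b * (word (a # t) - cscale c (word s')) \<in> relation_ideal"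
        using b by (intro ideal_mult_left[OF ideal_relation_ideal cong]) (simp add: word_in_free_algebra)
      then have "relation a b * word t + cscale (q a b) (gen b * (word (a # t) - cscale c (word s')))
          \<in> relation_ideal"
        using rel subspace_relation_ideal by (simp add: pm.subspace_add pm.subspace_scale)
      then show ?thesis
        by (simp add: rel_eq right_diff_distrib cscale_mult_right word_mult pm.scale_right_diff_distrib)
    qed
    ultimately show ?thesis
      using s'(2) by (intro exI[of _ "q a b * c"] exI[of _ "b # s'"]) auto
  qed
qed

lemma word_ordered_word:
  assumes "w \<in> lists B"
  shows "\<exists>c s. s \<in> ordered_words \<and> word w - cscale c (word s) \<in> relation_ideal"
  using assms
proof (induction w)
  case Nil
  have "word [] - cscale 1 (word []) \<in> relation_ideal" "[] \<in> ordered_words"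
    by (simp_all add: pm.subspace_0[OF subspace_relation_ideal] ordered_words_def)
  then show ?case by blast
next
  case (Cons a w)
  then obtain c s where s: "s \<in> ordered_words" and cong: "word w - cscale c (word s) \<in> relation_ideal"
    by blast
  obtain d s' where s': "s' \<in> ordered_words" "word (a # s) - cscale d (word s') \<in> relation_ideal"
    using insert_ordered_word[OF Cons.hyps(1) s] by blast
  have "gen a * (word w - cscale c (word s)) \<in> relation_ideal"
    using Cons.hyps(1) by (intro ideal_mult_left[OF ideal_relation_ideal cong]) (simp add: word_in_free_algebra)
  then have "gen a * (word w - cscale c (word s)) + cscale c (word (a # s) - cscale d (word s'))
      \<in> relation_ideal"
    using s'(2) subspace_relation_ideal by (simp add: pm.subspace_add pm.subspace_scale)
  then have "word (a # w) - cscale (c * d) (word s') \<in> relation_ideal"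
    by (simp add: right_diff_distrib cscale_mult_right word_mult pm.scale_right_diff_distrib)
  with s'(1) show ?case by blast
qed

lemma ordered_words_span:
  assumes "p \<in> carrier T"
  shows "\<exists>y. Poly_Mapping.keys y \<subseteq> ordered_words \<and> p - y \<in> relation_ideal"
proof -
  let ?W = "{y. Poly_Mapping.keys y \<subseteq> ordered_words}"
  have "Poly_Mapping.keys p \<subseteq> lists B" using assms by (simp add: carrier_free_algebra)
  then have "\<exists>y\<in>?W. p - y \<in> relation_ideal"
  proof (induction rule: keys_induct)
    case zero
    show ?case by (rule bexI[of _ 0]) (simp_all add: pm.subspace_0[OF subspace_relation_ideal])
  next
    case (single w c)
    then obtain d s where s: "s \<in> ordered_words" "word w - cscale d (word s) \<in> relation_ideal"
      using word_ordered_word by blast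
    have "cscale c (word w) - cscale c (cscale d (word s)) \<in> relation_ideal"
      using pm.subspace_scale[OF subspace_relation_ideal s(2), of c]
      by (simp only: pm.scale_right_diff_distrib)
    moreover have "cscale c (cscale d (word s)) \<in> ?W"
      using s(1) by (intro pm.subspace_scale[OF subspace_keys]) simp
    ultimately show ?case by blast
  next
    case (add p r)
    then obtain y z where yz: "y \<in> ?W" "p - y \<in> relation_ideal" "z \<in> ?W" "r - z \<in> relation_ideal"
      by blast
    have "p + r - (y + z) \<in> relation_ideal"
      using pm.subspace_add[OF subspace_relation_ideal yz(2,4)] by (simp add: algebra_simps)
    with pm.subspace_add[OF subspace_keys yz(1,3)] show ?case by blast
  qed
  then show ?thesis by blast
qed

end

section \<open>Duality between derivations and increasing words\<close>

lemma word_derivation_distinct: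
  "b \<notin> set w \<Longrightarrow> word_derivation b w = 0"
  "distinct w \<Longrightarrow> w \<in> lists B \<Longrightarrow> b \<in> set w \<Longrightarrow>
    \<exists>c. c \<noteq> 0 \<and> word_derivation b w = cscale c (word (remove1 b w))"
proof -
  show *: "b \<notin> set w \<Longrightarrow> word_derivation b w = 0" for w
    by (induction w) auto
  show "\<exists>c. c \<noteq> 0 \<and> word_derivation b w = cscale c (word (remove1 b w))"
    if "distinct w" "w \<in> lists B" "b \<in> set w"
    using that
  proof (induction w)
    case (Cons a w)
    show ?case
    proof (cases "a = b")
      case True
      with Cons.prems(1) show ?thesis by (intro exI[of _ 1]) (simp add: *)
    next
      case False
      with Cons obtain c where c: "c \<noteq> 0" "word_derivation b w = cscale c (word (remove1 b w))"
        by auto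
      have "a \<in> B" "b \<in> B" using Cons.prems by auto
      \<comment> \<open>Moving the derivation past \<open>a\<close> costs \<open>q a b\<close>,
        which is invertible by symmetry.\<close>
      then have "q a b \<noteq> 0" using symmetric by fastforce
      with False c show ?thesis
        by (intro exI[of _ "q a b * c"]) (simp add: cscale_mult_right word_mult)
    qed
  qed simp
qed

text \<open>Each derivation deletes its letter or annihilates the word, and the final constant term
  is nonzero exactly if no letter is left over. The order of the letters in \<open>s\<close> affects
  the value, but not whether it vanishes.\<close>

lemma derivation_coeff_distinct:
  "distinct s \<Longrightarrow> distinct w \<Longrightarrow> w \<in> lists B \<Longrightarrow>
    derivation_coeff s (word w) \<noteq> 0 \<longleftrightarrow> set w = set s"
proof (induction s arbitrary: w)
  case Nil
  then show ?case by (simp add: lookup_single when_def)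
next
  case (Cons b s)
  show ?case
  proof (cases "b \<in> set w")
    case True
    then obtain c where c: "c \<noteq> 0" "word_derivation b w = cscale c (word (remove1 b w))"
      using word_derivation_distinct(2) Cons.prems by blast
    have "remove1 b w \<in> lists B" using Cons.prems(3) set_remove1_subset by fastforce
    then have "derivation_coeff s (word (remove1 b w)) \<noteq> 0 \<longleftrightarrow> set (remove1 b w) = set s"
      using Cons.IH Cons.prems by simp
    moreover have "set (remove1 b w) = set w - {b}" using Cons.prems(2) by simp
    ultimately show ?thesis
      using c True Cons.prems(1) by (auto simp: derivation_coeff_cscale)
  next
    case False
    then show ?thesis by (auto simp: word_derivation_distinct(1))
  qed
qed

text \<open>Increasing words have distinct letters and are determined by their letter sets, so
  comparing sets amounts to comparing words.\<close>

lemma derivation_coeff_ordered_words: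
  assumes "strict_linear_order_on B lt" "s \<in> ordered_words lt" "w \<in> ordered_words lt"
  shows "derivation_coeff s (word w) \<noteq> 0 \<longleftrightarrow> w = s"
proof -
  have "distinct s" "distinct w"
    using assms strict_linear_order_on_sorted_distinct unfolding ordered_words_def[OF assms(1)] by blast+
  then have "derivation_coeff s (word w) \<noteq> 0 \<longleftrightarrow> set w = set s"
    using assms by (intro derivation_coeff_distinct) (auto simp: ordered_words_def[OF assms(1)])
  also have "\<dots> \<longleftrightarrow> w = s"
    using assms strict_linear_order_on_sorted_unique unfolding ordered_words_def[OF assms(1)] by blast
  finally show ?thesis .
qed

end

section \<open>Bases of quotients of free algebras\<close>

text \<open>A copy of the complex numbers inside the ring: linear algebra in HOL-Algebra is relative
  to a subfield of the ring itself.\<close>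

definition scalars :: "('b list \<Rightarrow>\<^sub>0 complex) set" where
  "scalars = {cscale c 1 | c. True}"

lemma cscale_one_mult: "cscale c 1 * p = cscale c (p :: 'b list \<Rightarrow>\<^sub>0 complex)"
  by (simp add: cscale_mult_left)

lemma scalars_subset: "scalars \<subseteq> carrier (free_algebra B)"
  using pm.subspace_scale[OF subspace_free_algebra word_in_free_algebra[of "[]" B]]
  by (auto simp: scalars_def one_eq_word)

lemma subfield_scalars: "subfield scalars (free_algebra (B :: 'b set))"
proof -
  interpret ring "free_algebra B" by (rule ring_free_algebra)
  have mult: "cscale c 1 * cscale d 1 = cscale (c * d) (1 :: 'b list \<Rightarrow>\<^sub>0 complex)" for c d
    by (simp add: cscale_one_mult)
  have "subring scalars (free_algebra B)"
  proof (rule subringI)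
    show "\<one>\<^bsub>free_algebra B\<^esub> \<in> scalars"
      by (auto simp: scalars_def intro: exI[of _ 1])
  next
    fix h assume h: "h \<in> (scalars :: ('b list \<Rightarrow>\<^sub>0 complex) set)"
    then obtain c where c: "h = cscale c 1" by (auto simp: scalars_def)
    have "\<ominus>\<^bsub>free_algebra B\<^esub> h = - h"
      using a_inv_free_algebra scalars_subset h by blast
    also have "\<dots> = cscale (- c) 1" by (simp add: c pm.scale_minus_left)
    finally show "\<ominus>\<^bsub>free_algebra B\<^esub> h \<in> scalars" unfolding scalars_def by blast
  next
    fix h h' assume "h \<in> (scalars :: ('b list \<Rightarrow>\<^sub>0 complex) set)" "h' \<in> (scalars :: ('b list \<Rightarrow>\<^sub>0 complex) set)"
    then obtain c d where "h = cscale c 1" "h' = cscale d 1" by (auto simp: scalars_def)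
    then show "h \<otimes>\<^bsub>free_algebra B\<^esub> h' \<in> scalars" "h \<oplus>\<^bsub>free_algebra B\<^esub> h' \<in> scalars"
      using mult[of c d] pm.scale_left_distrib[of c d 1, symmetric] by (auto simp: scalars_def)
  qed (rule scalars_subset)
  then have "subcring scalars (free_algebra B)"
    by (rule subcringI) (auto simp: scalars_def mult mult.commute)
  moreover have "Units (free_algebra B\<lparr>carrier := scalars\<rparr>) = scalars - {\<zero>\<^bsub>free_algebra B\<^esub>}"
  proof (intro equalityI subsetI)
    fix h assume "h \<in> Units (free_algebra B\<lparr>carrier := scalars\<rparr>)"
    then have "h \<in> scalars" "\<exists>h'. h' * h = 1" by (auto simp: Units_def)
    then show "h \<in> scalars - {\<zero>\<^bsub>free_algebra B\<^esub>}" by auto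
  next
    fix h assume h: "h \<in> scalars - {\<zero>\<^bsub>free_algebra B\<^esub>}"
    then obtain c where c: "h = cscale c 1" "c \<noteq> 0" by (auto simp: scalars_def)
    then have "cscale (inverse c) 1 * h = 1" "h * cscale (inverse c) 1 = 1"
      by (simp_all add: mult)
    then show "h \<in> Units (free_algebra B\<lparr>carrier := scalars\<rparr>)"
      using h by (auto simp: Units_def scalars_def)
  qed
  ultimately show ?thesis by (rule subfieldI)
qed

text \<open>Properness of the ideal makes 1 nonzero in the quotient, so the image of
  \<open>scalars\<close> is again a field.\<close>

locale free_quotient =
  fixes B :: "'b set" and I :: "('b list \<Rightarrow>\<^sub>0 complex) set"
  assumes ideal: "ideal I (free_algebra B)" and one_notin: "1 \<notin> I"
begin

abbreviation "A \<equiv> free_algebra B"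
abbreviation "Q \<equiv> A Quot I"
abbreviation "cls p \<equiv> I +>\<^bsub>A\<^esub> p"

sublocale cls: ring_hom_ring A Q cls
  by (rule ideal.rcos_ring_hom_ring[OF ideal])

lemma carrier_Q: "carrier Q = cls ` carrier A"
  by (auto simp: FactRing_def A_RCOSETS_def')

lemma cls_mult: "p \<in> carrier A \<Longrightarrow> r \<in> carrier A \<Longrightarrow> cls p \<otimes>\<^bsub>Q\<^esub> cls r = cls (p * r)"
  using cls.hom_mult by simp

lemma cls_add: "p \<in> carrier A \<Longrightarrow> r \<in> carrier A \<Longrightarrow> cls p \<oplus>\<^bsub>Q\<^esub> cls r = cls (p + r)"
  using cls.hom_add by simp

lemma cls_eq_iff:
  assumes "p \<in> carrier A" "r \<in> carrier A"
  shows "cls p = cls r \<longleftrightarrow> p - r \<in> I"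
proof -
  interpret I: ideal I A by (rule ideal)
  have "p \<ominus>\<^bsub>A\<^esub> r = p - r"
    using a_inv_free_algebra[OF assms(2)] by (simp add: a_minus_def)
  then have "p \<in> cls r \<longleftrightarrow> p - r \<in> I"
    using I.a_rcos_module_minus[OF cls.R.ring_axioms assms(2,1)] by simp
  moreover have "p \<in> cls r \<longleftrightarrow> cls p = cls r"
    using I.a_rcos_self[OF assms(1)] cls.R.a_repr_independence[OF _ assms(2) I.a_subgroup] by metis
  ultimately show ?thesis by simp
qed

lemma subfield_cls_scalars: "subfield (cls ` scalars) Q"
proof -
  have "1 \<in> carrier A" "0 \<in> carrier A"
    using word_in_free_algebra[of "[]" B] pm.subspace_0[OF subspace_free_algebra]
    by (auto simp: one_eq_word)
  then have "cls 1 \<noteq> cls 0" using cls_eq_iff[of 1 0] one_notin by simp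
  then have "\<one>\<^bsub>Q\<^esub> \<noteq> \<zero>\<^bsub>Q\<^esub>" using cls.hom_one cls.hom_zero by simp
  then show ?thesis by (rule cls.img_is_subfield(2)[OF subfield_scalars])
qed

text \<open>This lets the linear algebra of the quotient be done in the free algebra; each further
  list entry adds a line, which matches \<open>pm.span_insert\<close>.\<close>

lemma Span_cls:
  assumes "set ps \<subseteq> carrier A"
  shows "cls.S.Span (cls ` scalars) (map cls ps) = cls ` pm.span (set ps)"
  using assms
proof (induction ps)
  case Nil
  show ?case using cls.hom_zero by simp
next
  case (Cons p ps)
  have sub: "pm.span (set ps) \<subseteq> carrier A"
    using Cons.prems by (intro pm.span_minimal subspace_free_algebra) auto
  have p: "p \<in> carrier A" using Cons.prems by simp
  have eq: "cls (cscale c 1) \<otimes>\<^bsub>Q\<^esub> cls p \<oplus>\<^bsub>Q\<^esub> cls v = cls (cscale c p + v)" if "v \<in> carrier A" for c v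
  proof -
    have "cscale c 1 \<in> carrier A" using scalars_subset by (auto simp: scalars_def)
    moreover have "cscale c p \<in> carrier A" using p by (rule pm.subspace_scale[OF subspace_free_algebra])
    ultimately show ?thesis using p that by (simp add: cls_mult cls_add cscale_one_mult)
  qed
  have "cls.S.Span (cls ` scalars) (map cls (p # ps)) =
      cls.S.line_extension (cls ` scalars) (cls p) (cls ` pm.span (set ps))"
    using Cons by simp
  also have "\<dots> = cls ` pm.span (set (p # ps))"
  proof (intro equalityI subsetI)
    fix x assume "x \<in> cls.S.line_extension (cls ` scalars) (cls p) (cls ` pm.span (set ps))"
    then obtain c v where v: "v \<in> pm.span (set ps)"
      and x: "x = cls (cscale c 1) \<otimes>\<^bsub>Q\<^esub> cls p \<oplus>\<^bsub>Q\<^esub> cls v"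
      by (auto simp: cls.S.line_extension_mem_iff scalars_def)
    have "cscale c p + v \<in> pm.span (set (p # ps))"
      using v subsetD[OF pm.span_mono, of "set ps" "set (p # ps)" v]
      by (intro pm.span_add pm.span_scale pm.span_base[of p]) auto
    moreover have "x = cls (cscale c p + v)" using x eq v sub by auto
    ultimately show "x \<in> cls ` pm.span (set (p # ps))" by blast
  next
    fix x assume "x \<in> cls ` pm.span (set (p # ps))"
    then obtain y where y: "y \<in> pm.span (insert p (set ps))" "x = cls y" by auto
    then obtain c where c: "y - cscale c p \<in> pm.span (set ps)"
      by (auto simp: pm.span_insert)
    then have "x = cls (cscale c 1) \<otimes>\<^bsub>Q\<^esub> cls p \<oplus>\<^bsub>Q\<^esub> cls (y - cscale c p)"
      using eq[of "y - cscale c p" c] sub y(2) by auto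
    then show "x \<in> cls.S.line_extension (cls ` scalars) (cls p) (cls ` pm.span (set ps))"
      using c unfolding cls.S.line_extension_mem_iff scalars_def by blast
  qed
  finally show ?case .
qed

text \<open>Independence is witnessed by a family of linear functionals that is dual to the given
  elements up to nonzero factors.\<close>

lemma independent_cls:
  fixes \<phi> :: "('b list \<Rightarrow>\<^sub>0 complex) \<Rightarrow> ('b list \<Rightarrow>\<^sub>0 complex) \<Rightarrow> complex"
  assumes "distinct ps" "set ps \<subseteq> carrier A"
    and add: "\<And>p x y. \<phi> p (x + y) = \<phi> p x + \<phi> p y"
    and scale: "\<And>p c x. \<phi> p (cscale c x) = c * \<phi> p x"
    and I: "\<And>p x. x \<in> I \<Longrightarrow> \<phi> p x = 0"
    and dual: "\<And>p r. p \<in> set ps \<Longrightarrow> r \<in> set ps \<Longrightarrow> \<phi> p r = 0 \<longleftrightarrow> p \<noteq> r"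
  shows "cls.S.independent (cls ` scalars) (map cls ps)"
  using assms(1,2) dual
proof (induction ps)
  case (Cons p ps)
  have "cls p \<notin> cls ` pm.span (set ps)"
  proof
    assume "cls p \<in> cls ` pm.span (set ps)"
    then obtain y where y: "y \<in> pm.span (set ps)" "cls p = cls y" by auto
    have "y \<in> carrier A"
      using y(1) Cons.prems(2) pm.span_minimal[OF _ subspace_free_algebra, of "set ps" B] by auto
    then have "p - y \<in> I" using y(2) Cons.prems(2) cls_eq_iff by simp
    \<comment> \<open>The functional of the head kills every later entry and thus their whole span,
      but not the head itself.\<close>
    have "\<phi> p y = 0"
      using y(1)
    proof (induction rule: pm.span_induct_alt)
      case base
      show ?case using scale[of p 0 0] by simp
    next
      case (step c x y)
      then have "\<phi> p x = 0" using Cons.prems(1) Cons.prems(3)[of p x] by auto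
      with step show ?case by (simp add: add scale)
    qed
    moreover have "\<phi> p p = \<phi> p (p - y) + \<phi> p y" using add[of p "p - y" y] by simp
    ultimately have "\<phi> p p = 0" using I[OF \<open>p - y \<in> I\<close>] by simp
    then show False using Cons.prems(3)[of p p] by simp
  qed
  then show ?case
    using Cons by (auto simp: Span_cls simp del: cls.S.Span.simps intro!: cls.S.independent.li_Cons)
qed simp

end

section \<open>The quotient by the Nichols ideal, and infinite dimension for braiding scalar
  1\<close>

context diagonal_braiding
begin

text \<open>The span is over a union of ideals, so absorption need only be checked on members of one
  ideal at a time.\<close>

lemma ideal_nichols_ideal: "ideal (nichols_ideal G V) T"
proof (rule ideal_free_algebraI)
  show "pm.subspace (nichols_ideal G V)" by (simp add: nichols_ideal_eq)
  have sub: "\<Union>{I. homogeneous_coideal I} \<subseteq> carrier T"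
    using ideal_subset[OF homogeneous_coidealD(1)] by blast
  then show "nichols_ideal G V \<subseteq> carrier T"
    unfolding nichols_ideal_eq by (rule pm.span_minimal[OF _ subspace_free_algebra])
  show "r * p \<in> nichols_ideal G V" if "p \<in> nichols_ideal G V" "r \<in> carrier T" for p r
    using that(1) unfolding nichols_ideal_eq
  proof (induction rule: pm.span_induct_alt)
    case base
    show ?case by (simp add: pm.span_zero)
  next
    case (step c x y)
    then have "r * x \<in> \<Union>{I. homogeneous_coideal I}"
      using ideal_mult_left[OF homogeneous_coidealD(1) _ that(2)] by blast
    with step show ?case
      by (simp add: distrib_left cscale_mult_right pm.span_add pm.span_scale pm.span_base)
  qed
  show "p * r \<in> nichols_ideal G V" if "p \<in> nichols_ideal G V" "r \<in> carrier T" for p r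
    using that(1) unfolding nichols_ideal_eq
  proof (induction rule: pm.span_induct_alt)
    case base
    show ?case by (simp add: pm.span_zero)
  next
    case (step c x y)
    then have "x * r \<in> \<Union>{I. homogeneous_coideal I}"
      using ideal_mult_right[OF homogeneous_coidealD(1) _ that(2)] by blast
    with step show ?case
      by (simp add: distrib_right cscale_mult_left pm.span_add pm.span_scale pm.span_base)
  qed
qed

text \<open>The constant term, which is \<open>derivation_coeff []\<close>, vanishes on the Nichols
  ideal but not on 1.\<close>

lemma one_notin_nichols_ideal: "1 \<notin> nichols_ideal G V"
  using derivation_coeff_nichols_ideal[of 1 "[]"] by (auto simp: one_eq_word)

sublocale nichols: free_quotient B "nichols_ideal G V"
  by (rule free_quotient.intro[OF ideal_nichols_ideal one_notin_nichols_ideal])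

lemma nichols_scalars_eq: "nichols_scalars G V = nichols.cls ` scalars"
  by (auto simp: nichols_scalars_def nichols_class_def scalars_def)

text \<open>With \<open>q b b = 1\<close> the derivation acts on powers of \<open>b\<close> like
  ordinary differentiation; the resulting factorials are nonzero complex numbers.\<close>

lemma derivation_coeff_replicate:
  assumes "q b b = 1"
  shows "derivation_coeff (replicate m b) (word (replicate n b)) = (if m = n then fact n else 0)"
proof -
  \<comment> \<open>At \<open>n = 0\<close> the truncated \<open>n - 1\<close> does no harm, because
    the coefficient is 0.\<close>
  have der: "word_derivation b (replicate n b) = cscale (of_nat n) (word (replicate (n - 1) b))" for n
  proof (induction n)
    case (Suc n)
    then show ?case
      using assms pm.scale_left_distrib[of 1 "of_nat n" "word (replicate n b)", symmetric]
      by (cases n) (auto simp: cscale_mult_right word_mult)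
  qed simp
  show ?thesis
  proof (induction m arbitrary: n)
    case 0
    then show ?case by (simp add: lookup_single when_def)
  next
    case (Suc m)
    have "derivation_coeff (replicate (Suc m) b) (word (replicate n b)) =
        derivation_coeff (replicate m b) (cscale (of_nat n) (word (replicate (n - 1) b)))"
      by (simp only: replicate_Suc derivation_coeff.simps derivation_word der)
    then show ?case
      by (cases n) (simp_all add: derivation_coeff_cscale Suc.IH del: replicate_Suc)
  qed
qed

lemma nichols_dim_infinite:
  assumes "b \<in> B" "q b b = 1"
  shows "\<not> nichols_dim G V n"
proof
  assume dim: "nichols_dim G V n"
  \<comment> \<open>One power more than the supposed dimension allows.\<close>
  let ?ps = "map (\<lambda>m. word (replicate m b)) [0..<Suc n]"
  \<comment> \<open>\<open>independent_cls\<close> indexes the functionals by the elements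
    themselves, so the word is recovered from its basis vector; \<open>word_eq_iff\<close> makes
    this well defined.\<close>
  let ?\<phi> = "\<lambda>p. derivation_coeff (THE w. p = word w)"
  have sub: "set ?ps \<subseteq> carrier T"
    using assms(1) by (auto intro!: word_in_free_algebra)
  have "nichols.cls.S.independent (nichols.cls ` scalars) (map nichols.cls ?ps)"
  proof (rule nichols.independent_cls[OF _ sub, of ?\<phi>])
    show "distinct ?ps" by (simp add: distinct_map inj_on_def word_eq_iff del: upt_Suc)
    show "?\<phi> p r = 0 \<longleftrightarrow> p \<noteq> r" if "p \<in> set ?ps" "r \<in> set ?ps" for p r
      using that by (auto simp: word_eq_iff derivation_coeff_replicate[OF assms(2)] simp del: upt_Suc)
  qed (simp_all add: derivation_coeff_add derivation_coeff_cscale derivation_coeff_nichols_ideal)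
  moreover have "set (map nichols.cls ?ps) \<subseteq> carrier nichols.Q"
    using sub unfolding nichols.carrier_Q by auto
  ultimately have "length (map nichols.cls ?ps) \<le> n"
    using nichols.cls.S.independent_length_le_dimension[OF nichols.subfield_cls_scalars] dim
    unfolding nichols_dim_def nichols_algebra_def nichols_scalars_eq by blast
  then show False by simp
qed

end

section \<open>Basis and dimension of the Nichols algebra of a quantum exterior system\<close>

context quantum_exterior
begin

lemma exists_strict_linear_order: "\<exists>lt. strict_linear_order_on B lt"
proof -
  obtain f :: "'b \<Rightarrow> nat" where f: "inj_on f B"
    using finite_imp_inj_to_nat_seg[OF finite_basis] by blast
  have "f a < f b \<or> f b < f a" if "a \<in> B" "b \<in> B" "a \<noteq> b" for a b
    using that inj_onD[OF f] by (metis linorder_neqE_nat)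
  then have "strict_linear_order_on B {(a, b). f a < f b}"
    by (auto simp: strict_linear_order_on_def trans_def irrefl_def total_on_def)
  then show ?thesis by blast
qed

text \<open>The functional of an increasing word in the support isolates its coefficient up to a
  nonzero factor.\<close>

lemma derivation_coeff_combination:
  assumes "strict_linear_order_on B lt" "Poly_Mapping.keys y \<subseteq> ordered_words lt"
    and "\<And>s. derivation_coeff s y = 0"
  shows "y = 0"
proof (rule ccontr)
  assume "y \<noteq> 0"
  then obtain s where s: "s \<in> Poly_Mapping.keys y" by (metis keys_eq_empty ex_in_conv)
  have "derivation_coeff s (\<Sum>w\<in>F. cscale (Poly_Mapping.lookup y w) (word w)) =
      (\<Sum>w\<in>F. Poly_Mapping.lookup y w * derivation_coeff s (word w))" if "finite F" for F
    using that by induction (simp_all add: derivation_coeff_add derivation_coeff_cscale)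
  from this[of "Poly_Mapping.keys y"]
  have "derivation_coeff s y = (\<Sum>w\<in>Poly_Mapping.keys y. Poly_Mapping.lookup y w * derivation_coeff s (word w))"
    by (simp only: sum_cscale_single finite_keys)
  also have "\<dots> = (\<Sum>w\<in>Poly_Mapping.keys y. if w = s then Poly_Mapping.lookup y s * derivation_coeff s (word s) else 0)"
    using derivation_coeff_ordered_words[OF assms(1)] s assms(2) by (intro sum.cong) auto
  also have "\<dots> = Poly_Mapping.lookup y s * derivation_coeff s (word s)" using s by simp
  also have "\<dots> \<noteq> 0"
    using s derivation_coeff_ordered_words[OF assms(1), of s s] assms(2) by (auto simp: in_keys_iff)
  finally show False using assms(3) by blast
qed

lemma nichols_ideal_eq_relation_ideal: "nichols_ideal G V = relation_ideal"
proof
  obtain lt where lt: "strict_linear_order_on B lt" using exists_strict_linear_order by blast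
  show "nichols_ideal G V \<subseteq> relation_ideal"
  proof
    fix p assume p: "p \<in> nichols_ideal G V"
    have "p \<in> carrier T" using p ideal_subset[OF ideal_nichols_ideal] by blast
    then obtain y where y: "Poly_Mapping.keys y \<subseteq> ordered_words lt" "p - y \<in> relation_ideal"
      using ordered_words_span[OF lt] by blast
    \<comment> \<open>The functionals vanish on \<open>p\<close> and on \<open>p - y\<close>, as
      both lie in coideals or sums of them; so they vanish on \<open>y\<close>.\<close>
    have "derivation_coeff s y = 0" for s
    proof -
      have "derivation_coeff s p = derivation_coeff s (p - y) + derivation_coeff s y"
        using derivation_coeff_add[of s "p - y" y] by simp
      then show ?thesis
        using derivation_coeff_nichols_ideal[OF p]
          derivation_coeff_homogeneous_coideal[OF homogeneous_coideal_relation_ideal y(2)] by simp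
    qed
    then have "y = 0" using derivation_coeff_combination[OF lt y(1)] by blast
    then show "p \<in> relation_ideal" using y(2) by simp
  qed
  show "relation_ideal \<subseteq> nichols_ideal G V"
    unfolding nichols_ideal_eq using homogeneous_coideal_relation_ideal by (auto intro: pm.span_base)
qed

text \<open>Increasing words correspond to subsets of \<open>B\<close>: the letter set determines
  the word, and every finite subset can be sorted.\<close>

lemma finite_ordered_words:
  assumes "strict_linear_order_on B lt"
  shows "finite (ordered_words lt)" "card (ordered_words lt) = 2 ^ card B"
proof -
  have "bij_betw set (ordered_words lt) (Pow B)"
  proof (rule bij_betwI')
    show "(set x = set y) = (x = y)" if "x \<in> ordered_words lt" "y \<in> ordered_words lt" for x y
      using that strict_linear_order_on_sorted_unique[OF assms]
      unfolding ordered_words_def[OF assms] by blast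
    show "set x \<in> Pow B" if "x \<in> ordered_words lt" for x
      using that unfolding ordered_words_def[OF assms] by auto
    show "\<exists>x\<in>ordered_words lt. F = set x" if "F \<in> Pow B" for F
      using that strict_linear_order_on_sorted_exists[OF assms, of F] finite_basis
      unfolding ordered_words_def[OF assms] by (auto intro: finite_subset)
  qed
  then show "finite (ordered_words lt)" "card (ordered_words lt) = 2 ^ card B"
    using finite_basis by (auto simp: bij_betw_finite bij_betw_same_card card_Pow)
qed

lemma ordered_words_basis:
  assumes lt: "strict_linear_order_on B lt" and ws: "distinct ws" "set ws = ordered_words lt"
  defines "Us \<equiv> map (\<lambda>w. nichols_class G V (word w)) ws"
  shows "ring.independent (nichols_algebra G V) (nichols_scalars G V) Us"
    and "ring.Span (nichols_algebra G V) (nichols_scalars G V) Us = carrier (nichols_algebra G V)"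
proof -
  let ?ps = "map word ws :: ('b list \<Rightarrow>\<^sub>0 complex) list"
  let ?\<phi> = "\<lambda>p. derivation_coeff (THE w. p = word w)"
  have Us: "Us = map nichols.cls ?ps" by (simp add: Us_def nichols_class_def)
  have sub: "set ?ps \<subseteq> carrier T"
    using ws(2) by (auto simp: ordered_words_def[OF lt] intro!: word_in_free_algebra)
  have "nichols.cls.S.independent (nichols.cls ` scalars) (map nichols.cls ?ps)"
  proof (rule nichols.independent_cls[OF _ sub, of ?\<phi>])
    show "distinct ?ps" using ws(1) by (simp add: distinct_map inj_on_def word_eq_iff)
    show "?\<phi> p r = 0 \<longleftrightarrow> p \<noteq> r" if "p \<in> set ?ps" "r \<in> set ?ps" for p r
    proof -
      have "derivation_coeff v (word w) = 0 \<longleftrightarrow> v \<noteq> w" if "v \<in> set ws" "w \<in> set ws" for v w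
        using derivation_coeff_ordered_words[OF lt, of v w] that ws(2) by auto
      then show ?thesis using that by (auto simp: word_eq_iff)
    qed
  qed (simp_all add: derivation_coeff_add derivation_coeff_cscale derivation_coeff_nichols_ideal)
  then show "ring.independent (nichols_algebra G V) (nichols_scalars G V) Us"
    by (simp only: Us nichols_algebra_def nichols_scalars_eq)
  have "nichols.cls ` pm.span (set ?ps) = nichols.cls ` carrier T"
  proof
    show "nichols.cls ` pm.span (set ?ps) \<subseteq> nichols.cls ` carrier T"
      using pm.span_minimal[OF sub subspace_free_algebra] by blast
    show "nichols.cls ` carrier T \<subseteq> nichols.cls ` pm.span (set ?ps)"
    proof
      fix x assume "x \<in> nichols.cls ` carrier T"
      then obtain p where p: "p \<in> carrier T" "x = nichols.cls p" by blast
      obtain y where y: "Poly_Mapping.keys y \<subseteq> ordered_words lt" "p - y \<in> relation_ideal"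
        using ordered_words_span[OF lt p(1)] by blast
      have "y \<in> pm.span (set ?ps)"
        using y(1) span_singles[of "ordered_words lt"] ws(2) by simp
      moreover have "y \<in> carrier T"
        using y(1) by (auto simp: carrier_free_algebra ordered_words_def[OF lt])
      then have "x = nichols.cls y"
        using nichols.cls_eq_iff[OF p(1)] y(2) p(2) nichols_ideal_eq_relation_ideal by simp
      ultimately show "x \<in> nichols.cls ` pm.span (set ?ps)" by blast
    qed
  qed
  then show "ring.Span (nichols_algebra G V) (nichols_scalars G V) Us = carrier (nichols_algebra G V)"
    unfolding Us nichols_algebra_def nichols_scalars_eq nichols.Span_cls[OF sub] nichols.carrier_Q .
qed

lemma nichols_dim_exterior: "nichols_dim G V (2 ^ card B)"
proof -
  obtain lt where lt: "strict_linear_order_on B lt" using exists_strict_linear_order by blast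
  obtain ws where ws: "distinct ws" "set ws = ordered_words lt"
    using finite_ordered_words(1)[OF lt] finite_distinct_list by blast
  have "length ws = 2 ^ card B"
    using finite_ordered_words(2)[OF lt] ws distinct_card by metis
  with nichols.cls.S.dimensionI[OF nichols.subfield_cls_scalars[folded nichols_scalars_eq]
      ordered_words_basis[OF lt ws, unfolded nichols_algebra_def]]
  show ?thesis unfolding nichols_dim_def nichols_algebra_def by simp
qed

lemma foldr_powers:
  assumes "set \<nu>s \<subseteq> B" "length ms = length \<nu>s"
  shows "foldr (\<lambda>(\<nu>, m) y. (nichols_class G V (gen \<nu>) [^]\<^bsub>nichols_algebra G V\<^esub> m)
      \<otimes>\<^bsub>nichols_algebra G V\<^esub> y) (zip \<nu>s ms) \<one>\<^bsub>nichols_algebra G V\<^esub> =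
    nichols_class G V (word (concat (map2 (\<lambda>\<nu> m. replicate m \<nu>) \<nu>s (ms :: nat list))))"
  using assms(2,1)
proof (induction ms \<nu>s rule: list_induct2)
  case Nil
  then show ?case
    using nichols.cls.hom_one by (simp add: nichols_class_def nichols_algebra_def one_eq_word)
next
  case (Cons m ms \<nu> \<nu>s)
  have pow: "nichols.cls (gen \<nu>) [^]\<^bsub>nichols.Q\<^esub> m = nichols.cls (word (replicate m \<nu>))" for m
  proof (induction m)
    case 0
    then show ?case using nichols.cls.hom_one by (simp add: one_eq_word)
  next
    case (Suc m)
    have "word (replicate m \<nu>) \<in> carrier T" "gen \<nu> \<in> carrier T"
      using Cons.prems by (auto intro!: word_in_free_algebra)
    then show ?case
      using Suc by (simp add: nichols.cls_mult word_mult replicate_append_same)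
  qed
  let ?w = "concat (map2 (\<lambda>\<nu> m. replicate m \<nu>) \<nu>s ms)"
  have "?w \<in> lists B"
    using Cons.prems by (auto dest!: set_zip_leftD)
  then show ?case
    using Cons word_in_free_algebra[of "replicate m \<nu>" B] word_in_free_algebra[of ?w B]
    by (simp add: nichols_class_def nichols_algebra_def pow nichols.cls_mult word_mult in_lists_conv_set)
qed

text \<open>Exponents below 2 keep or drop a letter, so the monomials are the increasing words.
  Exponents 0 let several exponent lists give the same monomial, which is harmless for a
  set.\<close>

lemma pbw_monomials_eq:
  assumes lt: "strict_linear_order_on B lt" and N: "\<And>b. b \<in> B \<Longrightarrow> N b = 2"
  shows "pbw_monomials (nichols_algebra G V) B lt N (\<lambda>b. nichols_class G V (gen b)) =
    (\<lambda>w. nichols_class G V (word w)) ` ordered_words lt"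
proof -
  have sorted: "sorted_wrt (\<lambda>a b. (a, b) \<in> lt) (concat (map2 (\<lambda>\<nu> m. replicate m \<nu>) \<nu>s ms))"
    if "length ms = length \<nu>s" "sorted_wrt (\<lambda>a b. (a, b) \<in> lt) \<nu>s" "\<forall>m\<in>set ms. m < 2"
    for \<nu>s and ms :: "nat list"
    using that
  proof (induction ms \<nu>s rule: list_induct2)
    case (Cons m ms \<nu> \<nu>s)
    then have "m = 0 \<or> m = 1" by auto
    then show ?case
      using Cons by (auto dest!: set_zip_leftD)
  qed simp
  show ?thesis
  proof (intro equalityI subsetI)
    fix x assume "x \<in> pbw_monomials (nichols_algebra G V) B lt N (\<lambda>b. nichols_class G V (gen b))"
    then obtain \<nu>s ms where *: "set \<nu>s \<subseteq> B" "sorted_wrt (\<lambda>a b. (a, b) \<in> lt) \<nu>s"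
        "length ms = length \<nu>s" "\<forall>s<length \<nu>s. ms ! s < N (\<nu>s ! s)"
      and x: "x = nichols_class G V (word (concat (map2 (\<lambda>\<nu> m. replicate m \<nu>) \<nu>s ms)))"
      unfolding pbw_monomials_def by (auto simp: foldr_powers)
    have "\<forall>m\<in>set ms. m < 2"
      using * N by (metis in_set_conv_nth nth_mem subsetD)
    then have "concat (map2 (\<lambda>\<nu> m. replicate m \<nu>) \<nu>s ms) \<in> ordered_words lt"
      using sorted[OF *(3,2)] *(1) unfolding ordered_words_def[OF lt] by (auto dest!: set_zip_leftD)
    then show "x \<in> (\<lambda>w. nichols_class G V (word w)) ` ordered_words lt" using x by blast
  next
    fix x assume "x \<in> (\<lambda>w. nichols_class G V (word w)) ` ordered_words lt"
    then obtain w where w: "set w \<subseteq> B" "sorted_wrt (\<lambda>a b. (a, b) \<in> lt) w"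
      and x: "x = nichols_class G V (word w)"
      unfolding ordered_words_def[OF lt] by auto
    have "concat (map2 (\<lambda>\<nu> m. replicate m \<nu>) w (replicate (length w) 1)) = w" for w :: "'b list"
      by (induction w) auto
    then have "x = foldr (\<lambda>(\<nu>, m) y. (nichols_class G V (gen \<nu>) [^]\<^bsub>nichols_algebra G V\<^esub> m)
      \<otimes>\<^bsub>nichols_algebra G V\<^esub> y) (zip w (replicate (length w) (1 :: nat))) \<one>\<^bsub>nichols_algebra G V\<^esub>"
      by (simp only: x foldr_powers[OF w(1) length_replicate])
    moreover have "\<forall>s<length w. replicate (length w) 1 ! s < N (w ! s)"
      using w(1) N by (auto simp: subset_iff)
    ultimately show "x \<in> pbw_monomials (nichols_algebra G V) B lt N (\<lambda>b. nichols_class G V (gen b))"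
      using w unfolding pbw_monomials_def
      by (intro CollectI exI[of _ w] exI[of _ "replicate (length w) 1"] conjI length_replicate)
  qed
qed

lemma is_basis_pbw_monomials:
  assumes lt: "strict_linear_order_on B lt" and N: "\<And>b. b \<in> B \<Longrightarrow> N b = 2"
  shows "is_basis (nichols_algebra G V) (nichols_scalars G V)
    (pbw_monomials (nichols_algebra G V) B lt N (\<lambda>b. nichols_class G V (gen b)))"
proof -
  obtain ws where ws: "distinct ws" "set ws = ordered_words lt"
    using finite_ordered_words(1)[OF lt] finite_distinct_list by blast
  show ?thesis
    using ordered_words_basis[OF lt ws] ws(2) pbw_monomials_eq[OF assms]
    unfolding is_basis_def by (intro exI[of _ "map (\<lambda>w. nichols_class G V (word w)) ws"]) auto
qed

lemma generalized_quantum_linear_space_nichols: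
  assumes N: "\<And>b. b \<in> B \<Longrightarrow> N b = 2" and "scalar_ord (-1) = 2"
  shows "generalized_quantum_linear_space (nichols_algebra G V) B N"
proof -
  \<comment> \<open>\<open>N\<close> is known on \<open>B\<close> only, and the relations consult it
    there only.\<close>
  have "quantum_linear_relations B N q = quantum_linear_relations B (\<lambda>_. 2) q"
    unfolding quantum_linear_relations_def
    by (intro arg_cong2[of _ _ _ _ "(\<union>)"] Collect_cong iffI refl) (metis N)+
  then have "nichols_algebra G V = T Quot (Idl\<^bsub>T\<^esub> (quantum_linear_relations B N q))"
    by (simp add: nichols_algebra_def genideal_quantum_linear_relations nichols_ideal_eq_relation_ideal)
  moreover have "q i j \<noteq> 0" if "i \<in> B" "j \<in> B" for i j
    using symmetric[OF that] by auto
  ultimately show ?thesis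
    unfolding generalized_quantum_linear_space_def
    using finite_basis N assms(2) diagonal by (intro conjI exI[of _ q]) auto
qed

end

section \<open>Central ramification systems\<close>

lemma scalar_ord_minus_one: "scalar_ord (-1) = 2"
proof -
  let ?M = "\<lparr>carrier = - {0}, monoid.mult = (*), one = 1\<rparr> :: complex monoid"
  have M: "group ?M"
  proof (rule groupI)
    fix x assume "x \<in> carrier ?M"
    then show "\<exists>y\<in>carrier ?M. y \<otimes>\<^bsub>?M\<^esub> x = \<one>\<^bsub>?M\<^esub>"
      by (intro bexI[of _ "inverse x"]) auto
  qed auto
  have pow: "x [^]\<^bsub>?M\<^esub> (n :: nat) = x ^ n" for x n
    by (induction n) (simp_all add: nat_pow_def)
  have ord: "group.ord ?M (-1) dvd n \<longleftrightarrow> (-1 :: complex) ^ n = 1" for n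
    using group.pow_eq_id[OF M, of "-1" n] pow by simp
  have "group.ord ?M (-1) dvd 2" "\<not> group.ord ?M (-1) dvd 1"
    by (simp_all only: ord) simp_all
  then have "group.ord ?M (-1) \<le> 2" "group.ord ?M (-1) \<noteq> 1"
    by (auto dest: dvd_imp_le)
  \<comment> \<open>The value 0 stands for infinite order and passes the bound, so it is excluded
    separately.\<close>
  moreover have "group.ord ?M (-1) \<noteq> 0"
  proof
    assume "group.ord ?M (-1) = 0"
    with \<open>group.ord ?M (-1) dvd 2\<close> show False by simp
  qed
  ultimately show ?thesis unfolding scalar_ord_def by linarith
qed

text \<open>Orthogonality of the characters of a cyclic group, with a primitive root of unity as
  \<open>\<eta>\<close>; the proof of Schur's lemma averages with it.\<close>

lemma exists_root_of_unity_sum: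
  assumes "0 < (n :: nat)"
  shows "\<exists>\<eta> :: complex. \<eta> ^ n = 1 \<and> (\<forall>k<n. (\<Sum>j<n. \<eta> ^ (j * k)) = (if k = 0 then of_nat n else 0))"
proof -
  let ?\<eta> = "cis (2 * pi / n)"
  have pow: "?\<eta> ^ k = cis (2 * pi * k / n)" for k
    by (simp add: DeMoivre mult_ac)
  have n: "?\<eta> ^ n = 1" using assms by (simp add: pow)
  have "(\<Sum>j<n. ?\<eta> ^ (j * k)) = 0" if "k < n" "k \<noteq> 0" for k
  proof -
    have "?\<eta> ^ k \<noteq> 1"
    proof
      assume "?\<eta> ^ k = 1"
      then have "cis (2 * pi * real k / real n) = cis (2 * pi * real 0 / real n)" by (simp add: pow)
      then show False
        using bij_betw_imp_inj_on[OF bij_betw_roots_unity[OF assms]] that assms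
        by (metis inj_onD lessThan_iff)
    qed
    then have "(\<Sum>j<n. (?\<eta> ^ k) ^ j) = ((?\<eta> ^ k) ^ n - 1) / (?\<eta> ^ k - 1)"
      by (rule geometric_sum)
    also have "(?\<eta> ^ k) ^ n = 1" by (metis n power_commutes power_mult power_one mult.commute)
    finally show ?thesis by (simp add: power_mult[symmetric] mult.commute)
  qed
  then show ?thesis using n by (intro exI[of _ ?\<eta>]) auto
qed

text \<open>Schur's lemma. An eigenvector of the central element \<open>z\<close> is obtained from any
  nonzero vector by averaging over the cyclic group generated by \<open>z\<close>.\<close>

lemma central_acts_by_scalar:
  fixes G :: "('g, 'm) monoid_scheme" and X :: "'x :: ab_group_add set"
  assumes "vector_space scale" "group G" "finite (carrier G)"
    and irr: "irreducible_right_rep G (carrier G) scale X act" and z: "z \<in> group_center G"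
  shows "\<exists>c. \<forall>v\<in>X. act v z = scale c v"
proof -
  interpret vector_space scale by fact
  interpret group G by fact
  have zG: "z \<in> carrier G" and comm: "\<And>h. h \<in> carrier G \<Longrightarrow> z \<otimes>\<^bsub>G\<^esub> h = h \<otimes>\<^bsub>G\<^esub> z"
    using z by (auto simp: group_center_def)
  have rep: "right_rep G (carrier G) scale X act" and "X \<noteq> {0}"
    and min: "\<And>W. W \<subseteq> X \<Longrightarrow> right_rep G (carrier G) scale W act \<Longrightarrow> W = {0} \<or> W = X"
    using irr by (auto simp: irreducible_right_rep_def)
  have X: "subspace X" and act_closed: "\<And>v h. v \<in> X \<Longrightarrow> h \<in> carrier G \<Longrightarrow> act v h \<in> X"
    and act_add: "\<And>v w h. v \<in> X \<Longrightarrow> w \<in> X \<Longrightarrow> h \<in> carrier G \<Longrightarrow> act (v + w) h = act v h + act w h"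
    and act_scale: "\<And>c v h. v \<in> X \<Longrightarrow> h \<in> carrier G \<Longrightarrow> act (scale c v) h = scale c (act v h)"
    and act_one: "\<And>v. v \<in> X \<Longrightarrow> act v \<one>\<^bsub>G\<^esub> = v"
    and act_mult: "\<And>v h h'. v \<in> X \<Longrightarrow> h \<in> carrier G \<Longrightarrow> h' \<in> carrier G \<Longrightarrow>
      act v (h \<otimes>\<^bsub>G\<^esub> h') = act (act v h) h'"
    using rep by (auto simp: right_rep_def)
  obtain v where v: "v \<in> X" "v \<noteq> 0" using \<open>X \<noteq> {0}\<close> subspace_0[OF X] by blast
  \<comment> \<open>The group order serves as a period of \<open>z\<close>; it may exceed the order
    of \<open>z\<close>.\<close>
  define n where "n = order G"
  have n: "0 < n" unfolding n_def order_def using assms(3) one_closed by (auto simp: card_gt_0_iff)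
  obtain \<eta> :: complex where \<eta>: "\<eta> ^ n = 1"
    and \<eta>_sum: "\<And>k. k < n \<Longrightarrow> (\<Sum>j<n. \<eta> ^ (j * k)) = (if k = 0 then of_nat n else 0)"
    using exists_root_of_unity_sum[OF n] by blast
  have "\<eta> \<noteq> 0" using \<eta> n by (auto simp: power_0_left)
  let ?a = "\<lambda>k :: nat. act v (z [^]\<^bsub>G\<^esub> k)"
  have aX: "?a k \<in> X" for k using act_closed[OF v(1)] zG by simp
  have a0: "?a 0 = v" using act_one[OF v(1)] by simp
  have an: "?a n = v" using act_one[OF v(1)] pow_order_eq_1[OF zG] by (simp add: n_def)
  have aSuc: "act (?a k) z = ?a (Suc k)" for k
    using act_mult[OF v(1), of "z [^]\<^bsub>G\<^esub> k" z] zG by simp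
  \<comment> \<open>Up to the factor \<open>n\<close>, the component of \<open>v\<close> for the
    eigenvalue \<open>inverse (\<eta> ^ j)\<close> of \<open>z\<close>.\<close>
  define P where "P j = (\<Sum>k<n. scale (\<eta> ^ (j * k)) (?a k))" for j
  have act_sum: "(\<Sum>k\<in>F. f k) \<in> X \<and> act (\<Sum>k\<in>F. f k) z = (\<Sum>k\<in>F. act (f k) z)"
    if "finite F" "\<And>k. f k \<in> X" for F :: "nat set" and f
    using that(1)
  proof induction
    case empty
    have "act (scale 0 v) z = scale 0 (act v z)" using act_scale v(1) zG by blast
    then show ?case using subspace_0[OF X] by simp
  next
    case (insert k F)
    then show ?case using act_add[OF that(2) _ zG] subspace_add[OF X that(2)] by simp
  qed
  have PX: "P j \<in> X" for j
    unfolding P_def using aX by (intro subspace_sum[OF X] subspace_scale[OF X])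
  have eigen: "act (P j) z = scale (inverse (\<eta> ^ j)) (P j)" for j
  proof -
    have "act (P j) z = (\<Sum>k<n. act (scale (\<eta> ^ (j * k)) (?a k)) z)"
      unfolding P_def by (rule conjunct2[OF act_sum]) (simp_all add: subspace_scale[OF X aX])
    also have "\<dots> = (\<Sum>k<n. scale (\<eta> ^ (j * k)) (?a (Suc k)))"
      using act_scale[OF aX zG] aSuc by simp
    also have "\<dots> = (\<Sum>k<n. scale (inverse (\<eta> ^ j)) (scale (\<eta> ^ (j * Suc k)) (?a (Suc k))))"
    proof -
      have "inverse (\<eta> ^ j) * \<eta> ^ (j * Suc k) = \<eta> ^ (j * k)" for k
        using \<open>\<eta> \<noteq> 0\<close> by (simp add: power_add)
      then show ?thesis by (simp only: scale_scale)
    qed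
    also have "\<dots> = scale (inverse (\<eta> ^ j)) (\<Sum>k<n. scale (\<eta> ^ (j * Suc k)) (?a (Suc k)))"
      by (simp add: scale_sum_right)
    \<comment> \<open>Shifting the index exchanges the summand at 0 for the one at \<open>n\<close>,
      and these agree since both \<open>\<eta>\<close> and \<open>z\<close> have period
      \<open>n\<close>.\<close>
    also have "(\<Sum>k<n. scale (\<eta> ^ (j * Suc k)) (?a (Suc k))) = P j"
    proof -
      define g where "g k = scale (\<eta> ^ (j * k)) (?a k)" for k
      have "\<eta> ^ (j * n) = (\<eta> ^ n) ^ j" by (simp only: power_mult[symmetric] mult.commute)
      then have "\<eta> ^ (j * n) = 1" by (simp only: \<eta> power_one)
      then have "g n = g 0" using a0 an by (simp add: g_def)
      moreover have "g 0 + (\<Sum>k<n. g (Suc k)) = (\<Sum>k<n. g k) + g n"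
        using sum.lessThan_Suc_shift[of g n] sum.lessThan_Suc[of g n] by (rule trans[OF sym])
      ultimately have "(\<Sum>k<n. g (Suc k)) = (\<Sum>k<n. g k)"
        by (simp only: add.commute[of _ "g 0"] add_left_cancel)
      then show ?thesis by (simp only: g_def P_def)
    qed
    finally show ?thesis .
  qed
  \<comment> \<open>By orthogonality the components add up to \<open>n\<close> times
    \<open>v\<close>, so not all of them vanish.\<close>
  have "(\<Sum>j<n. P j) = (\<Sum>k<n. scale (\<Sum>j<n. \<eta> ^ (j * k)) (?a k))"
    unfolding P_def by (subst sum.swap) (simp add: scale_sum_left)
  also have "\<dots> = (\<Sum>k<n. if k = 0 then scale (of_nat n) v else 0)"
    using a0 by (intro sum.cong) (auto simp: \<eta>_sum)
  also have "\<dots> = scale (of_nat n) v" using n by simp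
  finally have "(\<Sum>j<n. P j) \<noteq> 0" using n v(2) by simp
  then obtain j where j: "P j \<noteq> 0" by (metis sum.neutral)
  let ?c = "inverse (\<eta> ^ j)"
  \<comment> \<open>Centrality of \<open>z\<close> makes this eigenspace invariant, so
    irreducibility forces it to be the whole space.\<close>
  let ?W = "{w \<in> X. act w z = scale ?c w}"
  have "act 0 z = 0" using act_sum[of "{}" "\<lambda>_. v"] v(1) by simp
  then have "subspace ?W"
    using X zG act_add act_scale unfolding subspace_def
    by (auto simp: scale_right_distrib mult.commute)
  moreover have "act w h \<in> ?W" if "w \<in> ?W" "h \<in> carrier G" for w h
  proof -
    have "act (act w h) z = act (act w z) h"
      using that zG act_mult[of w h z] act_mult[of w z h] comm[of h] by simp
    then show ?thesis using that act_scale act_closed by simp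
  qed
  ultimately have "right_rep G (carrier G) scale ?W act"
    using act_add act_scale act_one act_mult unfolding right_rep_def by simp
  moreover have "P j \<in> ?W" using PX eigen by simp
  ultimately have "?W = X" using min[of ?W] j by blast
  then show ?thesis by blast
qed

lemma (in diagonal_braiding) braiding_single:
  "a \<in> B \<Longrightarrow> b \<in> B \<Longrightarrow>
    braiding V (Poly_Mapping.single (a, b) 1) = Poly_Mapping.single (b, a) (q a b)"
  by (simp add: braiding_def action_degree)

section \<open>Central classes and the diagonal braiding of the arrow module\<close>

lemma (in group) conj_class_central:
  assumes "x \<in> group_center G" shows "conj_class G x = {x}"
proof -
  have "g \<otimes> x \<otimes> inv g = x" if "g \<in> carrier G" for g
  proof -
    have "g \<otimes> x = x \<otimes> g" "x \<in> carrier G" using assms that by (auto simp: group_center_def)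
    then show ?thesis using that by (simp add: m_assoc)
  qed
  moreover have "x \<in> carrier G" using assms by (simp add: group_center_def)
  ultimately show ?thesis by (auto simp: conj_class_def intro!: exI[of _ \<one>])
qed

lemma (in group) inv_group_center:
  assumes "x \<in> group_center G" shows "inv x \<in> group_center G"
proof -
  have x: "x \<in> carrier G" "\<And>g. g \<in> carrier G \<Longrightarrow> x \<otimes> g = g \<otimes> x"
    using assms by (auto simp: group_center_def)
  have "inv x \<otimes> g = g \<otimes> inv x" if "g \<in> carrier G" for g
  proof -
    have "inv x \<otimes> g = inv x \<otimes> (g \<otimes> x) \<otimes> inv x" using x(1) that by (simp add: m_assoc)
    also have "\<dots> = inv x \<otimes> (x \<otimes> g) \<otimes> inv x" using x(2)[OF that] by simp
    also have "\<dots> = g \<otimes> inv x" using x(1) that by (simp add: m_assoc[symmetric])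
    finally show ?thesis .
  qed
  then show ?thesis using x by (simp add: group_center_def)
qed

text \<open>The setting common to both halves of the theorem; symmetry and finiteness enter as
  hypotheses of single lemmas, because the halves start from different ones.\<close>

locale central_rsr = group G for G :: "('g, 'm) monoid_scheme" (structure) +
  fixes R :: "('g, 'i, 'j, 'x :: ab_group_add) rsr"
  assumes finite_group: "finite (carrier G)" and rsr: "is_rsr G R"
    and central: "C \<in> rsr_classes G R \<Longrightarrow> C \<subseteq> group_center G"
begin

sublocale vs: vector_space "rsr_scale R"
  using rsr by (simp add: is_rsr_def)

lemma class_eq:
  assumes "C \<in> rsr_classes G R"
  shows "C = {rsr_u R C}" "rsr_u R C \<in> group_center G"
proof -
  obtain x where x: "x \<in> carrier G" "C = conj_class G x"
    using assms by (auto simp: rsr_classes_def conj_classes_def)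
  then have "x \<in> C" by (auto simp: conj_class_def intro!: exI[of _ \<one>])
  then have "C = {x}" using central[OF assms] conj_class_central x(2) by auto
  moreover have "rsr_u R C \<in> C" using assms rsr by (auto simp: is_rsr_def rsr_classes_def)
  ultimately show "C = {rsr_u R C}" "rsr_u R C \<in> group_center G"
    using central[OF assms] by auto
qed

lemma conj_class_u: "C \<in> rsr_classes G R \<Longrightarrow> conj_class G (rsr_u R C) = C"
  using class_eq conj_class_central by metis

lemma centralizer_u: "C \<in> rsr_classes G R \<Longrightarrow> centralizer G (rsr_u R C) = carrier G"
  using class_eq(2) by (force simp: centralizer_def group_center_def)

lemma u_closed: "C \<in> rsr_classes G R \<Longrightarrow> rsr_u R C \<in> carrier G"
  using class_eq(2) by (auto simp: group_center_def)

lemma rsrD: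
  assumes "C \<in> rsr_classes G R"
  shows "finite (rsr_I R C)" "rsr_T R C \<subseteq> carrier G"
    and "g \<in> carrier G \<Longrightarrow> \<exists>!t. t \<in> rsr_T R C \<and> g \<in> carrier G #> t"
proof -
  note * = bspec[OF conjunct2[OF conjunct2[OF rsr[unfolded is_rsr_def]]] assms,
      unfolded centralizer_u[OF assms]]
  from * show "finite (rsr_I R C)" by (elim conjE)
  from * show "rsr_T R C \<subseteq> carrier G" by (elim conjE)
  from * have "\<forall>g\<in>carrier G. \<exists>!t. t \<in> rsr_T R C \<and> g \<in> carrier G #> t" by (elim conjE)
  then show "g \<in> carrier G \<Longrightarrow> \<exists>!t. t \<in> rsr_T R C \<and> g \<in> carrier G #> t" by (rule bspec)
qed

lemma rsr_repD:
  assumes "C \<in> rsr_classes G R" "i \<in> rsr_I R C"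
  shows "irreducible_right_rep G (carrier G) (rsr_scale R) (rsr_X R C i) (rsr_act R C i)"
    and "finite (rsr_J R C i)" "card (rsr_J R C i) = rsr_deg R C i"
    and "inj_on (rsr_x R C i) (rsr_J R C i)"
    and "vs.independent (rsr_x R C i ` rsr_J R C i)"
    and "vs.span (rsr_x R C i ` rsr_J R C i) = rsr_X R C i"
proof -
  note * = bspec[OF conjunct2[OF conjunct2[OF rsr[unfolded is_rsr_def]]] assms(1),
      unfolded centralizer_u[OF assms(1)]]
  from * have "irreducible_right_rep G (carrier G) (rsr_scale R) (rsr_X R C i) (rsr_act R C i) \<and>
      finite (rsr_J R C i) \<and> card (rsr_J R C i) = rsr_deg R C i \<and>
      inj_on (rsr_x R C i) (rsr_J R C i) \<and>
      vs.independent (rsr_x R C i ` rsr_J R C i) \<and>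
      vs.span (rsr_x R C i ` rsr_J R C i) = rsr_X R C i"
    by (elim conjE) (rule bspec[OF _ assms(2)])
  then show "irreducible_right_rep G (carrier G) (rsr_scale R) (rsr_X R C i) (rsr_act R C i)"
    "finite (rsr_J R C i)" "card (rsr_J R C i) = rsr_deg R C i"
    "inj_on (rsr_x R C i) (rsr_J R C i)"
    "vs.independent (rsr_x R C i ` rsr_J R C i)"
    "vs.span (rsr_x R C i ` rsr_J R C i) = rsr_X R C i"
    by simp_all
qed

lemma J_nonempty:
  assumes "C \<in> rsr_classes G R" "i \<in> rsr_I R C"
  shows "rsr_J R C i \<noteq> {}"
  using rsr_repD(1,6)[OF assms] by (auto simp: irreducible_right_rep_def)

text \<open>Schur's lemma is used for every central \<open>h\<close> and not only for the
  representative of \<open>C\<close>, because the degrees of arrows of one class act on the arrows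
  of all others.\<close>

definition central_scalar :: "'g set \<Rightarrow> 'i \<Rightarrow> 'g \<Rightarrow> complex" where
  "central_scalar C i h = (SOME c. \<forall>v\<in>rsr_X R C i. rsr_act R C i v h = rsr_scale R c v)"

lemma act_central:
  assumes "C \<in> rsr_classes G R" "i \<in> rsr_I R C" "h \<in> group_center G" "v \<in> rsr_X R C i"
  shows "rsr_act R C i v h = rsr_scale R (central_scalar C i h) v"
proof -
  have "\<exists>c. \<forall>v\<in>rsr_X R C i. rsr_act R C i v h = rsr_scale R c v"
    using central_acts_by_scalar[OF vs.vector_space_axioms is_group finite_group rsr_repD(1)[OF assms(1,2)]
      assms(3)] .
  then have "\<forall>v\<in>rsr_X R C i. rsr_act R C i v h = rsr_scale R (central_scalar C i h) v"
    unfolding central_scalar_def by (rule someI_ex)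
  then show ?thesis using assms(4) by blast
qed

lemma central_scalar_unique:
  assumes "C \<in> rsr_classes G R" "i \<in> rsr_I R C" "h \<in> group_center G"
    and "\<And>v. v \<in> rsr_X R C i \<Longrightarrow> rsr_act R C i v h = rsr_scale R c v"
  shows "central_scalar C i h = c"
proof -
  obtain j where j: "j \<in> rsr_J R C i" using J_nonempty[OF assms(1,2)] by blast
  let ?v = "rsr_x R C i j"
  have v: "?v \<in> rsr_X R C i"
    using rsr_repD(6)[OF assms(1,2)] vs.span_base[OF imageI[OF j], of "rsr_x R C i"] by simp
  have "?v \<noteq> 0"
  proof
    assume "?v = 0"
    then have "0 \<in> rsr_x R C i ` rsr_J R C i" using imageI[OF j, of "rsr_x R C i"] by simp
    then show False using vs.dependent_zero rsr_repD(5)[OF assms(1,2)] by blast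
  qed
  moreover have "rsr_scale R (central_scalar C i h) ?v = rsr_scale R c ?v"
    using act_central[OF assms(1-3) v] assms(4)[OF v] by (rule trans[OF sym])
  ultimately show ?thesis by (metis vs.scale_cancel_right)
qed

lemma one_central: "\<one> \<in> group_center G"
  by (simp add: group_center_def)

lemma act_one:
  assumes "C \<in> rsr_classes G R" "i \<in> rsr_I R C" "v \<in> rsr_X R C i"
  shows "rsr_act R C i v \<one> = v"
  using rsr_repD(1)[OF assms(1,2)] assms(3) by (auto simp: irreducible_right_rep_def right_rep_def)

lemma central_scalar_one:
  assumes "C \<in> rsr_classes G R" "i \<in> rsr_I R C"
  shows "central_scalar C i \<one> = 1"
  using assms by (intro central_scalar_unique one_central) (simp_all add: act_one)

lemma central_scalar_inv:
  assumes "C \<in> rsr_classes G R" "i \<in> rsr_I R C" "h \<in> group_center G"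
  shows "central_scalar C i h * central_scalar C i (inv h) = 1"
proof -
  have h: "h \<in> carrier G" using assms(3) by (simp add: group_center_def)
  have "rsr_act R C i v \<one> = rsr_scale R (central_scalar C i h * central_scalar C i (inv h)) v"
    if v: "v \<in> rsr_X R C i" for v
  proof -
    have rep: "right_rep G (carrier G) (rsr_scale R) (rsr_X R C i) (rsr_act R C i)"
      using rsr_repD(1)[OF assms(1,2)] by (simp add: irreducible_right_rep_def)
    have "rsr_act R C i v (h \<otimes> inv h) = rsr_act R C i (rsr_act R C i v h) (inv h)"
      using rep h v unfolding right_rep_def by (meson inv_closed)
    also have "\<dots> = rsr_scale R (central_scalar C i h) (rsr_act R C i v (inv h))"
      using rep h v unfolding act_central[OF assms v] right_rep_def by (meson inv_closed)
    also have "\<dots> = rsr_scale R (central_scalar C i h * central_scalar C i (inv h)) v"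
      using act_central[OF assms(1,2) inv_group_center[OF assms(3)] v] by simp
    finally show ?thesis using h by simp
  qed
  then show ?thesis
    using central_scalar_unique[OF assms(1,2) one_central] central_scalar_one[OF assms(1,2)] by metis
qed

text \<open>The braiding involves the inverse of the representative, \<open>rsr_N\<close> and the
  characters the representative itself; this translates the value -1 between the two.\<close>

lemma central_scalar_inv_minus_one:
  assumes "C \<in> rsr_classes G R" "i \<in> rsr_I R C" "h \<in> group_center G"
  shows "central_scalar C i (inv h) = -1 \<longleftrightarrow> central_scalar C i h = -1"
proof -
  have "x = -1 \<longleftrightarrow> y = -1" if "x * y = 1" for x y :: complex
  proof
    assume "x = -1"
    then have "- y = 1" using that by simp
    then show "y = -1" by (metis minus_minus)
  next
    assume "y = -1"
    then have "- x = 1" using that by simp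
    then show "x = -1" by (metis minus_minus)
  qed
  from this[OF central_scalar_inv[OF assms]] show ?thesis by simp
qed

lemma acts_by_scalar_iff:
  assumes "C \<in> rsr_classes G R" "i \<in> rsr_I R C"
  shows "acts_by_scalar R C i c \<longleftrightarrow> c = central_scalar C i (rsr_u R C)"
  using act_central[OF assms class_eq(2)[OF assms(1)]]
    central_scalar_unique[OF assms class_eq(2)[OF assms(1)]]
  unfolding acts_by_scalar_def by metis

lemma rsr_scalar_eq:
  assumes "C \<in> rsr_classes G R" "i \<in> rsr_I R C"
  shows "rsr_scalar R C i = central_scalar C i (rsr_u R C)"
proof -
  have "acts_by_scalar R C i = (\<lambda>c. c = central_scalar C i (rsr_u R C))"
    using acts_by_scalar_iff[OF assms] by (rule ext)
  then show ?thesis by (simp add: rsr_scalar_def)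
qed

lemma rsr_coeff_central:
  assumes "C \<in> rsr_classes G R" "i \<in> rsr_I R C" "h \<in> group_center G"
    "j \<in> rsr_J R C i" "p \<in> rsr_J R C i"
  shows "rsr_coeff R C i j h p = (if p = j then central_scalar C i h else 0)"
proof -
  let ?b = "rsr_x R C i ` rsr_J R C i"
  have span: "rsr_x R C i j \<in> vs.span ?b" using assms(4) by (simp add: vs.span_base)
  then have "rsr_act R C i (rsr_x R C i j) h = rsr_scale R (central_scalar C i h) (rsr_x R C i j)"
    using act_central[OF assms(1-3)] rsr_repD(6)[OF assms(1,2)] by simp
  then have "rsr_coeff R C i j h p = central_scalar C i h * (if rsr_x R C i p = rsr_x R C i j then 1 else 0)"
    using vs.representation_scale[OF rsr_repD(5)[OF assms(1,2)] span]
      vs.representation_basis[OF rsr_repD(5)[OF assms(1,2)], of "rsr_x R C i j"] assms(4)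
    by (simp add: rsr_coeff_def)
  then show ?thesis using inj_onD[OF rsr_repD(4)[OF assms(1,2)] _ assms(5,4)] by auto
qed

text \<open>The centralizer is the whole group, so there is a single coset, with a representative
  \<open>t0\<close> that need not be the unit. Centrality removes \<open>t0\<close> from
  \<open>\<zeta>\<close>, leaving the inverse of \<open>h\<close>, which acts by its scalar.\<close>

lemma arrow_action_central:
  assumes C: "C \<in> rsr_classes G R" "i \<in> rsr_I R C" and h: "h \<in> group_center G"
    and a: "a \<in> component_arrows R C i"
  shows "arrow_action G R h a = Poly_Mapping.single a (central_scalar C i (inv h))"
proof -
  let ?u = "rsr_u R C"
  obtain j where a: "a = (?u, i, j)" and j: "j \<in> rsr_J R C i"
    using a class_eq(1)[OF C(1)] by (auto simp: component_arrows_def)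
  note [simp] = u_closed[OF C(1)]
  have hG: "h \<in> carrier G" and hc: "\<And>g. g \<in> carrier G \<Longrightarrow> h \<otimes> g = g \<otimes> h"
    and invc: "\<And>g. g \<in> carrier G \<Longrightarrow> inv h \<otimes> g = g \<otimes> inv h"
    using h inv_group_center[OF h] by (auto simp: group_center_def)
  have uc: "\<And>g. g \<in> carrier G \<Longrightarrow> ?u \<otimes> g = g \<otimes> ?u"
    using class_eq(2)[OF C(1)] by (auto simp: group_center_def)
  have coset: "g \<in> carrier G #> t" if "g \<in> carrier G" "t \<in> carrier G" for g t
    using that unfolding r_coset_def by (auto simp: m_assoc intro!: bexI[of _ "g \<otimes> inv t"])
  obtain t0 where T: "rsr_T R C = {t0}" and t0: "t0 \<in> carrier G"
  proof -
    obtain t0 where "t0 \<in> rsr_T R C" "\<And>t. t \<in> rsr_T R C \<Longrightarrow> t = t0"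
      using rsrD(3)[OF C(1) one_closed] coset[OF one_closed] rsrD(2)[OF C(1)] by blast
    then show ?thesis using that[of t0] rsrD(2)[OF C(1)] by blast
  qed
  have "inv t0 \<otimes> ?u \<otimes> t0 = ?u" using t0 uc[of t0] by (simp add: m_assoc inv_solve_left')
  then have t: "(THE t. t \<in> rsr_T R C \<and> ?u = inv t \<otimes> ?u \<otimes> t) = t0"
    using T by (intro the_equality) auto
  have t': "(THE t'. t' \<in> rsr_T R C \<and> t0 \<otimes> inv h \<in> centralizer G ?u #> t') = t0"
    using T coset[of "t0 \<otimes> inv h" t0] t0 hG centralizer_u[OF C(1)] by (intro the_equality) auto
  have \<zeta>: "t0 \<otimes> inv h \<otimes> inv t0 = inv h" using t0 hG by (simp add: invc[OF t0, symmetric] m_assoc)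
  have "h \<otimes> ?u \<otimes> inv h = ?u" using hc[of ?u] hG by (simp add: m_assoc)
  then have "arrow_action G R h a =
      (\<Sum>p\<in>rsr_J R C i. Poly_Mapping.single (?u, i, p) (rsr_coeff R C i j (inv h) p))"
    by (simp add: arrow_action_def a conj_class_u[OF C(1)] t t' \<zeta> Let_def)
  also have "\<dots> = (\<Sum>p\<in>rsr_J R C i. if p = j then Poly_Mapping.single (?u, i, j) (central_scalar C i (inv h)) else 0)"
    using rsr_coeff_central[OF C inv_group_center[OF h] j] by (intro sum.cong) auto
  also have "\<dots> = Poly_Mapping.single a (central_scalar C i (inv h))"
    using j rsr_repD(2)[OF C] by (simp add: a)
  finally show ?thesis .
qed

text \<open>An arrow does not record its class; since the classes in question are singletons, the
  class of the second arrow is recovered as \<open>{y}\<close>.\<close>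

definition braiding_coeff :: "'g \<times> 'i \<times> 'j \<Rightarrow> 'g \<times> 'i \<times> 'j \<Rightarrow> complex" where
  "braiding_coeff = (\<lambda>(x, _, _) (y, i, _). central_scalar {y} i (inv x))"

lemma braiding_coeff_eq:
  assumes "C \<in> rsr_classes G R" "D \<in> rsr_classes G R"
    "a \<in> component_arrows R C i" "b \<in> component_arrows R D k"
  shows "braiding_coeff a b = central_scalar D k (inv (rsr_u R C))"
proof -
  obtain j l where "a = (rsr_u R C, i, j)" "b = (rsr_u R D, k, l)"
    using assms(3,4) class_eq(1)[OF assms(1)] class_eq(1)[OF assms(2)]
    by (auto simp: component_arrows_def)
  then show ?thesis using class_eq(1)[OF assms(2)] by (simp add: braiding_coeff_def)
qed

text \<open>An arbitrary set \<open>S\<close> of arrows is allowed so that the whole arrow module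
  and each component are instances with the same coefficients.\<close>

lemma diagonal_braiding_arrows:
  assumes "S \<subseteq> arrows G R"
  shows "diagonal_braiding G ((arrow_module G R)\<lparr>yd_basis := S\<rparr>) braiding_coeff"
proof
  fix b assume "b \<in> yd_basis ((arrow_module G R)\<lparr>yd_basis := S\<rparr>)"
  then obtain D k where D: "D \<in> rsr_classes G R" "k \<in> rsr_I R D" "b \<in> component_arrows R D k"
    using assms by (auto simp: arrows_def)
  have "fst b = rsr_u R D" using D class_eq(1) by (force simp: component_arrows_def)
  then show "yd_degree ((arrow_module G R)\<lparr>yd_basis := S\<rparr>) b \<in> carrier G"
    using u_closed[OF D(1)] by (simp add: arrow_module_def)
  show "yd_action ((arrow_module G R)\<lparr>yd_basis := S\<rparr>) \<one> b = Poly_Mapping.single b 1"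
    using arrow_action_central[OF D(1,2) one_central D(3)] central_scalar_one[OF D(1,2)]
    by (simp add: arrow_module_def)
  fix a assume "a \<in> yd_basis ((arrow_module G R)\<lparr>yd_basis := S\<rparr>)"
  then obtain C i where C: "C \<in> rsr_classes G R" "i \<in> rsr_I R C" "a \<in> component_arrows R C i"
    using assms by (auto simp: arrows_def)
  have "fst a = rsr_u R C" using C class_eq(1) by (force simp: component_arrows_def)
  then show "yd_action ((arrow_module G R)\<lparr>yd_basis := S\<rparr>)
      (yd_degree ((arrow_module G R)\<lparr>yd_basis := S\<rparr>) a) b = Poly_Mapping.single b (braiding_coeff a b)"
    using arrow_action_central[OF D(1,2) class_eq(2)[OF C(1)] D(3)]
      braiding_coeff_eq[OF C(1) D(1) C(3) D(3)]
    by (simp add: arrow_module_def)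
qed

lemma arrow_module_eq: "arrow_module G R = (arrow_module G R)\<lparr>yd_basis := arrows G R\<rparr>"
  by (simp add: arrow_module_def)

sublocale arrow: diagonal_braiding G "arrow_module G R" braiding_coeff
  using diagonal_braiding_arrows[OF order_refl] arrow_module_eq by simp

lemma component_arrows_subset:
  "C \<in> rsr_classes G R \<Longrightarrow> i \<in> rsr_I R C \<Longrightarrow> component_arrows R C i \<subseteq> arrows G R"
  by (auto simp: arrows_def)

lemma diagonal_braiding_component:
  assumes "C \<in> rsr_classes G R" "i \<in> rsr_I R C"
  shows "diagonal_braiding G (component_module G R C i) braiding_coeff"
  unfolding component_module_def
  by (rule diagonal_braiding_arrows[OF component_arrows_subset[OF assms]])

lemma component_arrows_nonempty:
  assumes "C \<in> rsr_classes G R" "i \<in> rsr_I R C"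
  obtains a where "a \<in> component_arrows R C i"
  using J_nonempty[OF assms] class_eq(1)[OF assms(1)] by (force simp: component_arrows_def)

lemma card_component_arrows:
  assumes "C \<in> rsr_classes G R" "i \<in> rsr_I R C"
  shows "finite (component_arrows R C i)" "card (component_arrows R C i) = rsr_deg R C i * card C"
proof -
  have eq: "component_arrows R C i = (\<lambda>j. (rsr_u R C, i, j)) ` rsr_J R C i"
    using class_eq(1)[OF assms(1)] by (auto simp: component_arrows_def)
  show "finite (component_arrows R C i)" using rsr_repD(2)[OF assms] by (simp add: eq)
  have "card (component_arrows R C i) = rsr_deg R C i"
    unfolding eq using rsr_repD(3)[OF assms] by (subst card_image) (auto simp: inj_on_def)
  moreover have "card C = 1" using class_eq(1)[OF assms(1)] by (metis card.empty card_insert_if empty_iff finite.emptyI One_nat_def)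
  ultimately show "card (component_arrows R C i) = rsr_deg R C i * card C" by simp
qed

lemma finite_classes: "finite (rsr_classes G R)"
  using finite_group by (auto simp: rsr_classes_def conj_classes_def)

text \<open>The unions are disjoint: arrows of different classes differ in the group element, and
  those of different components of one class in the index \<open>i\<close>.\<close>

lemma card_arrows:
  "finite (arrows G R)"
  "card (arrows G R) = (\<Sum>C\<in>rsr_classes G R. \<Sum>i\<in>rsr_I R C. rsr_deg R C i * card C)"
proof -
  have fin: "finite (\<Union>i\<in>rsr_I R C. component_arrows R C i)" if "C \<in> rsr_classes G R" for C
    using rsrD(1)[OF that] card_component_arrows(1)[OF that] by blast
  then show "finite (arrows G R)" unfolding arrows_def using finite_classes by blast
  have "card (arrows G R) = (\<Sum>C\<in>rsr_classes G R. card (\<Union>i\<in>rsr_I R C. component_arrows R C i))"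
    unfolding arrows_def
  proof (rule card_UN_disjoint[OF finite_classes])
    show "\<forall>C\<in>rsr_classes G R. \<forall>D\<in>rsr_classes G R. C \<noteq> D \<longrightarrow>
        (\<Union>i\<in>rsr_I R C. component_arrows R C i) \<inter> (\<Union>i\<in>rsr_I R D. component_arrows R D i) = {}"
    proof (intro ballI impI)
      fix C D assume CD: "C \<in> rsr_classes G R" "D \<in> rsr_classes G R" "C \<noteq> D"
      have "C = D" if "x \<in> C" "x \<in> D" for x
        using class_eq(1)[OF CD(1)] class_eq(1)[OF CD(2)] that by (metis singletonD)
      with CD(3) show "(\<Union>i\<in>rsr_I R C. component_arrows R C i) \<inter> (\<Union>i\<in>rsr_I R D. component_arrows R D i) = {}"
        by (auto simp: component_arrows_def)
    qed
  qed (use fin in blast)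
  also have "\<dots> = (\<Sum>C\<in>rsr_classes G R. \<Sum>i\<in>rsr_I R C. card (component_arrows R C i))"
    using rsrD(1) card_component_arrows(1)
    by (intro sum.cong refl card_UN_disjoint) (auto simp: component_arrows_def)
  also have "\<dots> = (\<Sum>C\<in>rsr_classes G R. \<Sum>i\<in>rsr_I R C. rsr_deg R C i * card C)"
    by (intro sum.cong refl card_component_arrows(2))
  finally show "card (arrows G R) = (\<Sum>C\<in>rsr_classes G R. \<Sum>i\<in>rsr_I R C. rsr_deg R C i * card C)" .
qed

text \<open>\<open>inv_into\<close> is meaningful only on the image, so a preimage of the basis
  tensor is exhibited; it exists because the braiding scalars are invertible.\<close>

lemma braidings_inverseD:
  assumes inverse: "braidings_inverse G R C i D k"
    and C: "C \<in> rsr_classes G R" "i \<in> rsr_I R C" "a \<in> component_arrows R C i"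
    and D: "D \<in> rsr_classes G R" "k \<in> rsr_I R D" "b \<in> component_arrows R D k"
  shows "braiding_coeff a b * braiding_coeff b a = 1"
proof -
  let ?\<sigma> = "braiding (arrow_module G R)"
  let ?t = "Poly_Mapping.single (a, b) (1 :: complex)"
  have ab: "a \<in> arrow.B" "b \<in> arrow.B"
    using C D component_arrows_subset by (auto simp: arrow_module_def)
  have nonzero: "braiding_coeff b a \<noteq> 0"
    using central_scalar_inv[OF C(1,2) class_eq(2)[OF D(1)]] braiding_coeff_eq[OF D(1) C(1) D(3) C(3)]
    by auto
  have scale: "?\<sigma> (Poly_Mapping.single (x, y) c) = cscale c (Poly_Mapping.single (y, x) (braiding_coeff x y))"
    if "x \<in> arrow.B" "y \<in> arrow.B" for x y c
    using arrow.braiding_single[OF that] linear_extension_cscale[of _ c "Poly_Mapping.single (x, y) 1"]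
    by (simp add: braiding_def cscale_single)
  have "?t = ?\<sigma> (Poly_Mapping.single (b, a) (1 / braiding_coeff b a))"
    using nonzero ab by (simp add: scale cscale_single)
  moreover have "Poly_Mapping.single (b, a) (1 / braiding_coeff b a) \<in> component_tensor R D k C i"
    using C D by (simp add: component_tensor_def)
  ultimately have "?t \<in> ?\<sigma> ` component_tensor R D k C i" by blast
  then have "?\<sigma> (inv_into (component_tensor R D k C i) ?\<sigma> ?t) = ?t"
    by (rule f_inv_into_f)
  moreover have "?\<sigma> ?t = inv_into (component_tensor R D k C i) ?\<sigma> ?t"
    using inverse C(3) D(3) by (simp add: braidings_inverse_def component_tensor_def)
  ultimately have "?\<sigma> (?\<sigma> ?t) = ?t" by simp
  then have "Poly_Mapping.single (a, b) (braiding_coeff a b * braiding_coeff b a) = ?t"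
    using ab by (simp add: scale cscale_single)
  then show ?thesis by (metis lookup_single_eq)
qed

text \<open>This serves the pair of a component with itself, which weak symmetry leaves open: a map
  that preserves a set and squares to the identity there is its own \<open>inv_into\<close>.\<close>

lemma braidings_inverse_involutive:
  assumes C: "C \<in> rsr_classes G R" "i \<in> rsr_I R C"
    and square: "\<And>a b. a \<in> component_arrows R C i \<Longrightarrow> b \<in> component_arrows R C i \<Longrightarrow>
      braiding_coeff a b * braiding_coeff b a = 1"
  shows "braidings_inverse G R C i C i"
proof -
  let ?\<sigma> = "braiding (arrow_module G R)" and ?X = "component_tensor R C i C i"
  let ?A = "component_arrows R C i"
  have AB: "?A \<subseteq> arrow.B" using component_arrows_subset[OF C] by (simp add: arrow_module_def)
  have X: "?X = {t. Poly_Mapping.keys t \<subseteq> ?A \<times> ?A}" by (simp add: component_tensor_def)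
  have lin: "?\<sigma> (s + t) = ?\<sigma> s + ?\<sigma> t" "?\<sigma> (cscale c t) = cscale c (?\<sigma> t)" "?\<sigma> 0 = 0" for s t c
    by (simp_all add: braiding_def linear_extension_add linear_extension_cscale)
  have \<sigma>: "?\<sigma> t \<in> ?X \<and> ?\<sigma> (?\<sigma> t) = t" if "t \<in> ?X" for t
  proof -
    have "Poly_Mapping.keys t \<subseteq> ?A \<times> ?A" using that by (simp add: X)
    then show ?thesis
    proof (induction rule: keys_induct)
      case zero
      then show ?case by (simp add: lin X)
    next
      case (single x c)
      then obtain a b where x: "x = (a, b)" and ab: "a \<in> ?A" "b \<in> ?A" by auto
      have eq: "?\<sigma> (Poly_Mapping.single (a, b) 1) = cscale (braiding_coeff a b) (Poly_Mapping.single (b, a) 1)"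
        "?\<sigma> (Poly_Mapping.single (b, a) 1) = cscale (braiding_coeff b a) (Poly_Mapping.single (a, b) 1)"
        using arrow.braiding_single[of a b] arrow.braiding_single[of b a] subsetD[OF AB] ab
        by (simp_all add: cscale_single)
      have "cscale c (cscale (braiding_coeff a b) (Poly_Mapping.single (b, a) 1)) \<in> ?X"
        unfolding X using ab by (intro pm.subspace_scale[OF subspace_keys]) simp
      then show ?case
        using square[OF ab] by (simp only: x lin eq) (simp add: mult.assoc)
    next
      case (add s t)
      then show ?case
        using pm.subspace_add[OF subspace_keys, of "?\<sigma> s" "?A \<times> ?A" "?\<sigma> t"] by (simp add: lin X)
    qed
  qed
  then have "inj_on ?\<sigma> ?X" by (metis inj_on_inverseI)
  then have "inv_into ?X ?\<sigma> t = ?\<sigma> t" if "t \<in> ?X" for t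
    using \<sigma>[OF that] by (intro inv_into_f_eq) auto
  then show ?thesis by (simp add: braidings_inverse_def)
qed

text \<open>Symmetry is asked on \<open>S\<close> only: for a single component it follows from the
  value -1 of the scalars.\<close>

lemma quantum_exterior_subset:
  assumes "S \<subseteq> arrows G R"
    and minus_one: "\<And>C i. C \<in> rsr_classes G R \<Longrightarrow> i \<in> rsr_I R C \<Longrightarrow>
      central_scalar C i (rsr_u R C) = -1"
    and symmetric: "\<And>a b. a \<in> S \<Longrightarrow> b \<in> S \<Longrightarrow> braiding_coeff a b * braiding_coeff b a = 1"
  shows "quantum_exterior G ((arrow_module G R)\<lparr>yd_basis := S\<rparr>) braiding_coeff"
proof (rule quantum_exterior.intro[OF diagonal_braiding_arrows[OF assms(1)]], unfold_locales)
  fix a assume "a \<in> yd_basis ((arrow_module G R)\<lparr>yd_basis := S\<rparr>)"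
  then obtain C i where C: "C \<in> rsr_classes G R" "i \<in> rsr_I R C" "a \<in> component_arrows R C i"
    using assms(1) by (auto simp: arrows_def)
  then show "braiding_coeff a a = -1"
    using braiding_coeff_eq[OF C(1) C(1) C(3) C(3)] minus_one[OF C(1,2)]
      central_scalar_inv_minus_one[OF C(1,2) class_eq(2)[OF C(1)]] by simp
qed (use assms card_arrows(1) finite_subset in auto)

lemma quantum_exterior_minus_one:
  assumes minus_one: "\<And>C i. C \<in> rsr_classes G R \<Longrightarrow> i \<in> rsr_I R C \<Longrightarrow>
      central_scalar C i (rsr_u R C) = -1"
    and symmetric: "quantum_symmetric G R"
  shows "quantum_exterior G (arrow_module G R) braiding_coeff"
    and "\<And>C i. C \<in> rsr_classes G R \<Longrightarrow> i \<in> rsr_I R C \<Longrightarrow> rsr_N R C i = 2"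
    and "\<And>a. a \<in> arrows G R \<Longrightarrow> arrow_N G R a = 2"
proof -
  have sym: "braiding_coeff a b * braiding_coeff b a = 1" if ab: "a \<in> arrows G R" "b \<in> arrows G R" for a b
  proof -
    obtain C i where C: "C \<in> rsr_classes G R" "i \<in> rsr_I R C" "a \<in> component_arrows R C i"
      using ab by (auto simp: arrows_def)
    obtain D k where D: "D \<in> rsr_classes G R" "k \<in> rsr_I R D" "b \<in> component_arrows R D k"
      using ab by (auto simp: arrows_def)
    have "braidings_inverse G R C i D k" using symmetric C D by (simp add: quantum_symmetric_def)
    then show ?thesis using braidings_inverseD C D by blast
  qed
  then show "quantum_exterior G (arrow_module G R) braiding_coeff"
    using quantum_exterior_subset[OF order_refl minus_one] arrow_module_eq by simp
  show N: "rsr_N R C i = 2" if "C \<in> rsr_classes G R" "i \<in> rsr_I R C" for C i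
    using that by (simp add: rsr_N_def rsr_scalar_eq minus_one scalar_ord_minus_one)
  show "arrow_N G R a = 2" if a: "a \<in> arrows G R" for a
  proof -
    obtain C i where C: "C \<in> rsr_classes G R" "i \<in> rsr_I R C" "a \<in> component_arrows R C i"
      using a by (auto simp: arrows_def)
    then obtain j where "a = (rsr_u R C, i, j)"
      using class_eq(1)[OF C(1)] by (auto simp: component_arrows_def)
    then show ?thesis using N[OF C(1,2)] by (simp add: arrow_N_def conj_class_u[OF C(1)])
  qed
qed

lemma finite_type_minus_one:
  assumes "quantum_symmetric G R" "non_essentially_infinite_type G R"
    and C: "C \<in> rsr_classes G R" "i \<in> rsr_I R C"
  shows "central_scalar C i (rsr_u R C) = -1"
proof -
  obtain a where a: "a \<in> component_arrows R C i" using component_arrows_nonempty[OF C] .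
  interpret V: diagonal_braiding G "component_module G R C i" braiding_coeff
    by (rule diagonal_braiding_component[OF C])
  let ?q = "braiding_coeff a a"
  obtain n where "nichols_dim G (component_module G R C i) n"
    using assms(2) C by (auto simp: non_essentially_infinite_type_def)
  then have "?q \<noteq> 1"
    using V.nichols_dim_infinite[of a n] a by (auto simp: component_module_def)
  moreover have "braidings_inverse G R C i C i"
    using assms(1) C by (simp add: quantum_symmetric_def)
  then have "?q * ?q = 1" using braidings_inverseD[OF _ C a C a] by blast
  ultimately have "?q = -1" by (metis power2_eq_1_iff power2_eq_square)
  then show ?thesis
    using central_scalar_inv_minus_one[OF C class_eq(2)[OF C(1)]] braiding_coeff_eq[OF C(1) C(1) a a]
    by simp
qed

text \<open>A central element acts by a scalar matrix, so its character value is the degree times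
  the scalar; the degree is nonzero and cancels.\<close>

lemma character_minus_one:
  assumes C: "C \<in> rsr_classes G R" "i \<in> rsr_I R C"
    and "rsr_character R C i (rsr_u R C) = - rsr_character R C i \<one>"
  shows "central_scalar C i (rsr_u R C) = -1"
proof -
  have char: "rsr_character R C i h = of_nat (card (rsr_J R C i)) * central_scalar C i h"
    if "h \<in> group_center G" for h
    using rsr_coeff_central[OF C that] by (simp add: rsr_character_def)
  have "card (rsr_J R C i) \<noteq> 0" using J_nonempty[OF C] rsr_repD(2)[OF C] by simp
  then show ?thesis
    using assms(3) char[OF class_eq(2)[OF C(1)]] char[OF one_central] central_scalar_one[OF C]
    by (metis mult.right_neutral mult_cancel_left mult_minus_right of_nat_eq_0_iff)
qed

text \<open>Within one component all braiding coefficients equal -1, so their products are 1 and the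
  missing case of quantum symmetry is \<open>braidings_inverse_involutive\<close>. The finite
  dimension is that of a quantum exterior algebra on the component.\<close>

lemma weakly_symmetric_minus_one_central_type:
  assumes "quantum_weakly_symmetric G R"
    and minus_one: "\<And>C i. C \<in> rsr_classes G R \<Longrightarrow> i \<in> rsr_I R C \<Longrightarrow>
      central_scalar C i (rsr_u R C) = -1"
  shows "central_quantum_linear_type G R"
proof -
  have comp: "braiding_coeff a b * braiding_coeff b a = 1"
    if C: "C \<in> rsr_classes G R" "i \<in> rsr_I R C"
      and ab: "a \<in> component_arrows R C i" "b \<in> component_arrows R C i" for C i a b
    using braiding_coeff_eq[OF C(1) C(1) ab] braiding_coeff_eq[OF C(1) C(1) ab(2,1)] minus_one[OF C]
      central_scalar_inv_minus_one[OF C class_eq(2)[OF C(1)]] by simp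
  have "quantum_symmetric G R"
    unfolding quantum_symmetric_def
  proof (intro ballI)
    fix C D i k
    assume "C \<in> rsr_classes G R" "D \<in> rsr_classes G R" "i \<in> rsr_I R C" "k \<in> rsr_I R D"
    then show "braidings_inverse G R C i D k"
      using assms(1) braidings_inverse_involutive comp
      by (cases "(C, i) = (D, k)") (auto simp: quantum_weakly_symmetric_def)
  qed
  moreover have "nichols_dim G (component_module G R C i) (2 ^ card (component_arrows R C i))"
    if C: "C \<in> rsr_classes G R" "i \<in> rsr_I R C" for C i
  proof -
    interpret V: quantum_exterior G "component_module G R C i" braiding_coeff
      unfolding component_module_def
      by (rule quantum_exterior_subset[OF component_arrows_subset[OF C] minus_one comp[OF C]])
    show ?thesis using V.nichols_dim_exterior by (simp add: component_module_def)
  qed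
  ultimately show ?thesis
    using central unfolding central_quantum_linear_type_def non_essentially_infinite_type_def by blast
qed

lemma nichols_dim_arrows:
  assumes "quantum_exterior G (arrow_module G R) braiding_coeff"
  shows "nichols_dim G (arrow_module G R)
    (2 ^ (\<Sum>C\<in>rsr_classes G R. \<Sum>i\<in>rsr_I R C. rsr_deg R C i * card C))"
  using quantum_exterior.nichols_dim_exterior[OF assms] card_arrows(2) by (simp add: arrow_module_def)

end

theorem proposition3p15:
  fixes G :: "('g, 'm) monoid_scheme"
    and R :: "('g, 'i, 'j, 'x :: ab_group_add) rsr"
  assumes "group G"
    and "finite (carrier G)"
    and "is_rsr G R"
  shows
    "(central_quantum_linear_type G R \<longrightarrow>
        (\<forall>C\<in>rsr_classes G R. C = {rsr_u R C}) \<and>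
        (\<forall>C\<in>rsr_classes G R. \<forall>i\<in>rsr_I R C. \<exists>!q. acts_by_scalar R C i q) \<and>
        generalized_quantum_linear_space
          (nichols_algebra G (arrow_module G R)) (arrows G R) (arrow_N G R) \<and>
        (\<forall>lt. strict_linear_order_on (arrows G R) lt \<longrightarrow>
          is_basis (nichols_algebra G (arrow_module G R)) (nichols_scalars G (arrow_module G R))
            (pbw_monomials (nichols_algebra G (arrow_module G R)) (arrows G R) lt (arrow_N G R)
              (\<lambda>a. nichols_class G (arrow_module G R) (gen a)))) \<and>
        nichols_dim G (arrow_module G R)
          (\<Prod>C\<in>rsr_classes G R. \<Prod>i\<in>rsr_I R C. rsr_N R C i ^ (rsr_deg R C i * card C)))
     \<and>
     (quantum_weakly_symmetric G R \<and> minus_one_type G R \<and>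
      (\<forall>C\<in>rsr_classes G R. C \<subseteq> group_center G) \<longrightarrow>
        central_quantum_linear_type G R \<and>
        (\<forall>C\<in>rsr_classes G R. \<forall>i\<in>rsr_I R C. rsr_N R C i = 2) \<and>
        nichols_dim G (arrow_module G R)
          (2 ^ (\<Sum>C\<in>rsr_classes G R. \<Sum>i\<in>rsr_I R C. rsr_deg R C i * card C)))"
proof (rule conjI; intro impI)
  assume type: "central_quantum_linear_type G R"
  interpret central_rsr G R
    using assms type by (intro central_rsr.intro central_rsr_axioms.intro)
      (auto simp: central_quantum_linear_type_def)
  have minus_one: "central_scalar C i (rsr_u R C) = -1" if "C \<in> rsr_classes G R" "i \<in> rsr_I R C" for C i
    using finite_type_minus_one that type by (simp add: central_quantum_linear_type_def)
  have sym: "quantum_symmetric G R" using type by (simp add: central_quantum_linear_type_def)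
  note concl = quantum_exterior_minus_one[OF minus_one sym]
  interpret V: quantum_exterior G "arrow_module G R" braiding_coeff by (rule concl(1))
  have basis: "yd_basis (arrow_module G R) = arrows G R" by (simp add: arrow_module_def)
  \<comment> \<open>All the orders are 2, so the product of powers collapses to one power of
    2.\<close>
  have "(\<Prod>C\<in>rsr_classes G R. \<Prod>i\<in>rsr_I R C. rsr_N R C i ^ (rsr_deg R C i * card C)) =
      2 ^ (\<Sum>C\<in>rsr_classes G R. \<Sum>i\<in>rsr_I R C. rsr_deg R C i * card C)"
    using concl(2) by (simp add: power_sum)
  then have dim: "nichols_dim G (arrow_module G R)
      (\<Prod>C\<in>rsr_classes G R. \<Prod>i\<in>rsr_I R C. rsr_N R C i ^ (rsr_deg R C i * card C))"
    using nichols_dim_arrows[OF concl(1)] by simp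
  have scalar: "\<exists>!q. acts_by_scalar R C i q" if "C \<in> rsr_classes G R" "i \<in> rsr_I R C" for C i
    using acts_by_scalar_iff[OF that] by simp
  have space: "generalized_quantum_linear_space
      (nichols_algebra G (arrow_module G R)) (arrows G R) (arrow_N G R)"
    using V.generalized_quantum_linear_space_nichols[OF _ scalar_ord_minus_one, of "arrow_N G R"] concl(3)
    unfolding basis by blast
  have pbw: "is_basis (nichols_algebra G (arrow_module G R)) (nichols_scalars G (arrow_module G R))
      (pbw_monomials (nichols_algebra G (arrow_module G R)) (arrows G R) lt (arrow_N G R)
        (\<lambda>a. nichols_class G (arrow_module G R) (gen a)))"
    if "strict_linear_order_on (arrows G R) lt" for lt
    using V.is_basis_pbw_monomials[of lt "arrow_N G R"] concl(3) that unfolding basis by blast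
  show "(\<forall>C\<in>rsr_classes G R. C = {rsr_u R C}) \<and>
      (\<forall>C\<in>rsr_classes G R. \<forall>i\<in>rsr_I R C. \<exists>!q. acts_by_scalar R C i q) \<and>
      generalized_quantum_linear_space
        (nichols_algebra G (arrow_module G R)) (arrows G R) (arrow_N G R) \<and>
      (\<forall>lt. strict_linear_order_on (arrows G R) lt \<longrightarrow>
        is_basis (nichols_algebra G (arrow_module G R)) (nichols_scalars G (arrow_module G R))
          (pbw_monomials (nichols_algebra G (arrow_module G R)) (arrows G R) lt (arrow_N G R)
            (\<lambda>a. nichols_class G (arrow_module G R) (gen a)))) \<and>
      nichols_dim G (arrow_module G R)
        (\<Prod>C\<in>rsr_classes G R. \<Prod>i\<in>rsr_I R C. rsr_N R C i ^ (rsr_deg R C i * card C))"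
    by (intro conjI ballI allI impI class_eq(1) scalar space pbw dim)
next
  assume type: "quantum_weakly_symmetric G R \<and> minus_one_type G R \<and>
    (\<forall>C\<in>rsr_classes G R. C \<subseteq> group_center G)"
  interpret central_rsr G R
    using assms type by (intro central_rsr.intro central_rsr_axioms.intro) auto
  have minus_one: "central_scalar C i (rsr_u R C) = -1" if "C \<in> rsr_classes G R" "i \<in> rsr_I R C" for C i
    using character_minus_one[OF that] that type by (simp add: minus_one_type_def)
  have central_type: "central_quantum_linear_type G R"
    using weakly_symmetric_minus_one_central_type minus_one type by blast
  then have sym: "quantum_symmetric G R" by (simp add: central_quantum_linear_type_def)
  note concl = quantum_exterior_minus_one[OF minus_one sym]
  show "central_quantum_linear_type G R \<and>
      (\<forall>C\<in>rsr_classes G R. \<forall>i\<in>rsr_I R C. rsr_N R C i = 2) \<and>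
      nichols_dim G (arrow_module G R)
        (2 ^ (\<Sum>C\<in>rsr_classes G R. \<Sum>i\<in>rsr_I R C. rsr_deg R C i * card C))"
    using central_type concl(2) nichols_dim_arrows[OF concl(1)] by blast
qed

end
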